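(* Let $\Gamma$ be a finitely generated dense just infinite subgroup of a profinite group $G$. Then $\liminf_{U\unlhd_o G}\frac{d({\rm H}_1(U;\widehat{\mathbb{Z}}))}{|G:U|}=0$.
   Context: A just infinite group is an infinite group all of whose non-trivial normal subgroups have finite index. For a profinite group $G$, the (lower) normal homology rank gradient is $\liminf_{U\unlhd_o G}\frac{d({\rm H}_1(U;\widehat{\mathbb{Z}}))}{|G:U|}=\sup_{V\unlhd_o G}\inf_{U\unlhd_o G,\,U\le V}\frac{d({\rm H}_1(U;\widehat{\mathbb{Z}}))}{|G:U|}$, where $U$ ranges over open normal subgroups, $d(\cdot)$ denotes the minimal number of (topological) generators, and ${\rm H}_1(U;\widehat{\mathbb{Z}})\cong U/\overline{[U,U]}$. *)

theory Defs
  imports "HOL-Analysis.Analysis" "HOL-Algebra.Algebra"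
begin

definition profinite_group :: "('a, 'b) monoid_scheme \<Rightarrow> 'a topology \<Rightarrow> bool" where
  "profinite_group G T \<longleftrightarrow>
     group G \<and> topspace T = carrier G \<and>
     continuous_map (prod_topology T T) T (\<lambda>(x, y). x \<otimes>\<^bsub>G\<^esub> y) \<and>
     continuous_map T T (\<lambda>x. inv\<^bsub>G\<^esub> x) \<and>
     compact_space T \<and> Hausdorff_space T \<and>
     (\<forall>x\<in>topspace T. connected_component_of_set T x = {x})"

definition open_normal_subgroup :: "('a, 'b) monoid_scheme \<Rightarrow> 'a topology \<Rightarrow> 'a set \<Rightarrow> bool" where
  "open_normal_subgroup G T U \<longleftrightarrow> U \<lhd> G \<and> openin T U"

definition quot_top :: "'a topology \<Rightarrow> ('a, 'b) monoid_scheme \<Rightarrow> 'a set \<Rightarrow> 'a set topology" where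
  "quot_top T G N = topology (\<lambda>A. A \<subseteq> rcosets\<^bsub>G\<^esub> N \<and> openin T (\<Union>A))"

definition top_rank :: "('a, 'b) monoid_scheme \<Rightarrow> 'a topology \<Rightarrow> nat" where
  "top_rank H Tp = (LEAST n. \<exists>Y. Y \<subseteq> carrier H \<and> finite Y \<and> card Y = n \<and>
                               Tp closure_of (generate H Y) = carrier H)"

definition closed_commutator :: "('a, 'b) monoid_scheme \<Rightarrow> 'a topology \<Rightarrow> 'a set \<Rightarrow> 'a set" where
  "closed_commutator G T U = T closure_of (derived G U)"

text \<open>H_1(U; Zhat) = U / closure [U,U], as a topological group with the quotient topology.\<close>
definition H1_group :: "('a, 'b) monoid_scheme \<Rightarrow> 'a topology \<Rightarrow> 'a set \<Rightarrow> 'a set monoid" where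
  "H1_group G T U = (G\<lparr>carrier := U\<rparr>) Mod (closed_commutator G T U)"

definition H1_top :: "('a, 'b) monoid_scheme \<Rightarrow> 'a topology \<Rightarrow> 'a set \<Rightarrow> 'a set topology" where
  "H1_top G T U = quot_top (subtopology T U) (G\<lparr>carrier := U\<rparr>) (closed_commutator G T U)"

definition normal_homology_rank_gradient :: "('a, 'b) monoid_scheme \<Rightarrow> 'a topology \<Rightarrow> ereal" where
  "normal_homology_rank_gradient G T =
     (SUP V \<in> {V. open_normal_subgroup G T V}.
        INF U \<in> {U. open_normal_subgroup G T U \<and> U \<subseteq> V}.
          ereal (real (top_rank (H1_group G T U) (H1_top G T U)) / real (card (rcosets\<^bsub>G\<^esub> U))))"

definition just_infinite :: "('a, 'b) monoid_scheme \<Rightarrow> bool" where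
  "just_infinite H \<longleftrightarrow> infinite (carrier H) \<and>
     (\<forall>N. N \<lhd> H \<and> N \<noteq> {\<one>\<^bsub>H\<^esub>} \<longrightarrow> finite (rcosets\<^bsub>H\<^esub> N))"

end

theory Submission
  imports Defs
begin

text \<open>
  Suppose that the rank of \<open>H\<^sub>1(U)\<close> is at least \<open>c |G:U|\<close> for all open normal \<open>U \<le> V\<close>, with \<open>c > 0\<close>.
  Let \<open>\<gamma> \<in> \<Gamma> \<inter> V\<close> be nontrivial. As \<open>\<Gamma>\<close> is just infinite, the closure \<open>U\<close> of its normal closure is
  open, and \<open>H\<^sub>1(U)\<close> is generated by the conjugates of \<open>\<gamma>\<close>; hence the centralizer of \<open>\<gamma>\<close> has at most
  \<open>1/c\<close> elements modulo \<open>U\<close>. For a power \<open>\<gamma> = x\<^sup>m\<close>, with \<open>m\<close> the order of \<open>x\<close> modulo some \<open>W \<le> V\<close>, the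
  centralizer contains \<open>x\<close>, so \<open>m > 1/c\<close> forces \<open>x\<^sup>m = 1\<close>. It follows that some coset \<open>W x\<close> in \<open>\<Gamma>\<close>
  satisfies the law \<open>g\<^sup>m = 1\<close>; for minimal \<open>m\<close> one can achieve \<open>x\<^sup>r \<noteq> 1\<close> for \<open>0 < r < m\<close>.

  Let \<open>U\<^sub>0 > U\<^sub>1 > U\<^sub>2 > U\<^sub>3\<close> be the closed derived series of a small open normal subgroup \<open>U\<^sub>0\<close>; its
  terms are open. Put \<open>M = U\<^sub>2/U\<^sub>3\<close>. The law yields \<open>\<Sum>\<^sub>i\<^sub><\<^sub>m \<psi>\<^sub>i(w) x\<^sup>i = 0\<close> on \<open>M\<close> for all \<open>w \<in> U\<^sub>1/U\<^sub>2\<close>,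
  where \<open>\<psi>\<^sub>i(w) = w w\<^sup>x \<dots>\<close> (\<open>i\<close> factors) is an endomorphism of \<open>U\<^sub>1/U\<^sub>2\<close>. As in Artin's independence
  of characters this gives \<open>(1 - \<psi>\<^sub>1(w\<^sub>1)) \<dots> (1 - \<psi>\<^sub>m\<^sub>-\<^sub>1(w\<^sub>m\<^sub>-\<^sub>1)) M = 0\<close>. The image \<open>Q\<^sub>j\<close> of \<open>\<psi>\<^sub>j\<close> is large:
  it contains \<open>[U\<^sub>1, x\<^sup>j]\<close> modulo \<open>U\<^sub>2\<close>, and boundedly many conjugates of \<open>x\<^sup>j\<close> generate a group
  containing \<open>U\<^sub>0\<close>, while \<open>U\<^sub>1/[U\<^sub>1, U\<^sub>0]\<close> has small rank. So \<open>M/[M, Q\<^sub>j]\<close> has rank far below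
  \<open>|G:U\<^sub>2|\<close>, and therefore so has \<open>M\<close>, a contradiction.
\<close>

section \<open>Generators and commutators\<close>

text \<open>Write \<open>a\<close>, \<open>b\<close>, \<open>h\<close> for the indices of
  \<open>U0\<close>, \<open>U1\<close>, \<open>U2\<close> in \<open>G\<close> and \<open>d\<close>
  for the number of generators of \<open>\<Gamma>\<close>. The three factors of the derived series
  have different roles. Rank at least \<open>c a\<close> of \<open>U0/U1\<close> gives
  \<open>b \<ge> 2^(c a)\<close>, which makes the error term \<open>(d a)^2\<close> in the rank of
  \<open>U1/U2\<close> negligible against \<open>c b\<close>. If \<open>s\<close> is the least size
  of the generating sets chosen for the \<open>Q r\<close> over \<open>U2\<close>, that rank is at
  most \<open>(d a)^2 + l s\<close>; so \<open>s\<close> is at least a constant multiple of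
  \<open>b\<close>, and every \<open>Q r\<close> has index at most \<open>h / 2^s\<close>. The
  \<open>m - 1\<close> factors acting on \<open>U2/U3\<close> then cost only a polynomial in
  \<open>b\<close>, which \<open>2^s\<close> outgrows. The order of the choices is the obstacle:
  \<open>m\<close>, \<open>l\<close> and \<open>d\<close> must be fixed before \<open>U0\<close>,
  whose index has to be large in terms of them. Hence the law and the conjugates of
  \<open>x^r\<close> are found in the abstract group \<open>\<Gamma>\<close>, while the counting
  takes place in the finite group \<open>G/U3\<close>, where closures disappear.\<close>

definition comm :: "('a, 'b) monoid_scheme \<Rightarrow> 'a \<Rightarrow> 'a \<Rightarrow> 'a" where
  "comm G x y = x \<otimes>\<^bsub>G\<^esub> y \<otimes>\<^bsub>G\<^esub> inv\<^bsub>G\<^esub> x \<otimes>\<^bsub>G\<^esub> inv\<^bsub>G\<^esub> y"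

context group
begin

lemma cancel_left [simp]:
  assumes "x \<in> carrier G" "y \<in> carrier G"
  shows "inv x \<otimes> (x \<otimes> y) = y" "x \<otimes> (inv x \<otimes> y) = y"
  using assms by (simp_all add: m_assoc [symmetric])

lemmas word_simps = m_assoc inv_mult_group

lemma comm_closed [simp]: "x \<in> carrier G \<Longrightarrow> y \<in> carrier G \<Longrightarrow> comm G x y \<in> carrier G"
  by (simp add: comm_def)

lemma comm_mult: "x \<in> carrier G \<Longrightarrow> y \<in> carrier G \<Longrightarrow> comm G x y \<otimes> y = x \<otimes> y \<otimes> inv x"
  by (simp add: comm_def m_assoc)

lemma inv_comm_swap: "x \<in> carrier G \<Longrightarrow> y \<in> carrier G \<Longrightarrow> inv (comm G x y) = comm G y x"
  by (simp add: comm_def word_simps)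

lemma comm_in_derived: "x \<in> H \<Longrightarrow> y \<in> H \<Longrightarrow> comm G x y \<in> derived G H"
  unfolding comm_def derived_def by (rule generate.incl) blast

lemma comm_in_normal:
  assumes "N \<lhd> G" "x \<in> carrier G" "y \<in> N"
  shows "comm G x y \<in> N" "comm G y x \<in> N"
proof -
  interpret N: normal N G by fact
  have y: "y \<in> carrier G" using assms by (simp add: N.mem_carrier)
  show "comm G x y \<in> N"
    using assms unfolding comm_def by (simp add: N.inv_op_closed2)
  have "comm G y x = y \<otimes> (x \<otimes> inv y \<otimes> inv x)"
    using assms y unfolding comm_def by (simp add: word_simps)
  then show "comm G y x \<in> N"
    using assms by (simp add: N.inv_op_closed2)
qed

lemma derived_mono_target:
  assumes "subgroup D G" and "\<And>x y. x \<in> U \<Longrightarrow> y \<in> U \<Longrightarrow> comm G x y \<in> D"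
  shows "derived G U \<subseteq> D"
  unfolding derived_def by (rule generate_subgroup_incl) (use assms in \<open>auto simp: comm_def\<close>)

text \<open>The identity for \<open>comm G (h \<otimes> k) u\<close> produces a commutator with
  another element of \<open>A\<close>, the conjugate of \<open>u\<close> by \<open>k\<close>, and
  never a conjugate of an element of \<open>C\<close>. So whether a whole group acts trivially on
  \<open>A\<close> modulo \<open>C\<close> can be checked on generators.\<close>

lemma act_trivially_subgroup:
  assumes A: "A \<lhd> G" and C: "subgroup C G"
  shows "subgroup {h \<in> carrier G. \<forall>u\<in>A. comm G h u \<in> C} G" (is "subgroup ?T G")
proof (rule subgroupI)
  interpret A: normal A G by fact
  show "?T \<subseteq> carrier G" by auto
  have "comm G \<one> u = \<one>" if "u \<in> A" for u
    using that by (simp add: comm_def A.mem_carrier)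
  then have "\<one> \<in> ?T" using C by (simp add: subgroup.one_closed)
  then show "?T \<noteq> {}" by blast
  show "inv h \<in> ?T" if h: "h \<in> ?T" for h
  proof -
    have "comm G (inv h) u \<in> C" if u: "u \<in> A" for u
    proof -
      have hc: "h \<in> carrier G" and uc: "u \<in> carrier G" using h u A.mem_carrier by auto
      have "comm G (inv h) u = inv (comm G h (inv h \<otimes> u \<otimes> h))"
        using hc uc by (simp add: comm_def word_simps)
      moreover have "inv h \<otimes> u \<otimes> h \<in> A" using A.inv_op_closed1 hc u by blast
      ultimately show ?thesis using h C by (simp add: subgroup.m_inv_closed)
    qed
    then show ?thesis using h by auto
  qed
  show "h \<otimes> k \<in> ?T" if h: "h \<in> ?T" and k: "k \<in> ?T" for h k
  proof -
    have "comm G (h \<otimes> k) u \<in> C" if u: "u \<in> A" for u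
    proof -
      have hc: "h \<in> carrier G" "k \<in> carrier G" and uc: "u \<in> carrier G"
        using h k u A.mem_carrier by auto
      have "comm G (h \<otimes> k) u = comm G h (k \<otimes> u \<otimes> inv k) \<otimes> comm G k u"
        using hc uc by (simp add: comm_def word_simps)
      moreover have "k \<otimes> u \<otimes> inv k \<in> A" using A.inv_op_closed2 hc u by blast
      ultimately show ?thesis using h k u C by (simp add: subgroup.m_closed)
    qed
    then show ?thesis using h k by auto
  qed
qed

text \<open>In \<open>[u v, t] = u [v, t] u^-1 [u, t]\<close> the conjugation is absorbed by
  \<open>norm\<close>, so commutators of words reduce to commutators of generators, first in one
  entry and, after inverting, in the other.\<close>

lemma derived_generate_subset:
  assumes S: "S \<subseteq> carrier G" and D: "subgroup D G"
    and norm: "\<And>u d. u \<in> generate G S \<Longrightarrow> d \<in> D \<Longrightarrow> u \<otimes> d \<otimes> inv u \<in> D"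
    and comm: "\<And>s t. s \<in> S \<Longrightarrow> t \<in> S \<Longrightarrow> comm G s t \<in> D"
  shows "derived G (generate G S) \<subseteq> D"
proof -
  interpret D: subgroup D G by fact
  have gc: "u \<in> carrier G" if "u \<in> generate G S" for u
    using that generate_in_carrier[OF S] by blast
  have ginv: "inv u \<in> generate G S" if "u \<in> generate G S" for u
    using that generate_m_inv_closed[OF S] by blast
  have inv_step: "comm G (inv u) t \<in> D" if "comm G u t \<in> D" "u \<in> generate G S" "t \<in> carrier G" for u t
  proof -
    have "comm G (inv u) t = inv u \<otimes> inv (comm G u t) \<otimes> inv (inv u)"
      using that gc by (simp add: comm_def word_simps)
    then show ?thesis using norm[OF ginv] that by simp
  qed
  have swap: "comm G t u \<in> D" if "comm G u t \<in> D" "u \<in> carrier G" "t \<in> carrier G" for u t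
  proof -
    have "comm G t u = inv (comm G u t)" using that by (simp add: comm_def word_simps)
    then show ?thesis using that by simp
  qed
  have mult_step: "comm G (u \<otimes> v) t \<in> D"
    if "comm G u t \<in> D" "comm G v t \<in> D" "u \<in> generate G S" "v \<in> generate G S" "t \<in> carrier G" for u v t
  proof -
    have "comm G (u \<otimes> v) t = (u \<otimes> comm G v t \<otimes> inv u) \<otimes> comm G u t"
      using that gc by (simp add: comm_def word_simps)
    then show ?thesis using norm that by simp
  qed
  have one_step: "comm G \<one> t \<in> D" if "t \<in> carrier G" for t
    using that by (simp add: comm_def)
  have gen: "comm G u t \<in> D" if "u \<in> generate G S" "t \<in> carrier G" "\<And>s. s \<in> S \<Longrightarrow> comm G s t \<in> D" for u t
    using that(1)
  proof (induction u rule: generate.induct)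
    case one then show ?case using one_step that by simp
  next
    case (incl h) then show ?case using that by simp
  next
    case (inv h) then show ?case using that inv_step generate.incl by metis
  next
    case (eng h1 h2) then show ?case using that mult_step by simp
  qed
  have "comm G u t \<in> D" if "u \<in> generate G S" "t \<in> generate G S" for u t
  proof (rule gen[OF that(1)])
    show "t \<in> carrier G" using gc that by simp
    show "comm G s t \<in> D" if s: "s \<in> S" for s
    proof (rule swap)
      show "comm G t s \<in> D"
        by (rule gen[OF \<open>t \<in> generate G S\<close>]) (use s S comm in auto)
    qed (use s S gc \<open>t \<in> generate G S\<close> in auto)
  qed
  then show ?thesis using derived_mono_target[OF D] by blast
qed

text \<open>Maps such as \<open>tpow\<close> and \<open>comm G x\<close> are homomorphisms only up
  to elements of \<open>N\<close>; up to \<open>N\<close> they still send words in \<open>Y\<close>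
  to words in the images. The choice \<open>N = {\<one>}\<close> covers ordinary
  homomorphisms.\<close>

lemma generate_image_modulo:
  assumes N: "N \<lhd> G" and A: "subgroup A G" and Y: "Y \<subseteq> A"
    and f: "\<And>a. a \<in> A \<Longrightarrow> f a \<in> carrier G"
    and hom: "\<And>a b. a \<in> A \<Longrightarrow> b \<in> A \<Longrightarrow> \<exists>n\<in>N. f (a \<otimes> b) = f a \<otimes> f b \<otimes> n"
  shows "f ` generate G Y \<subseteq> generate G (f ` Y \<union> N)"
proof -
  interpret N: normal N G by fact
  interpret A: subgroup A G by fact
  let ?R = "generate G (f ` Y \<union> N)"
  have sub: "f ` Y \<union> N \<subseteq> carrier G" using f Y N.subset by auto
  interpret R: subgroup ?R G by (rule generate_is_subgroup[OF sub])
  have NR: "n \<in> ?R" if "n \<in> N" for n using that generate.incl[of n "f ` Y \<union> N" G] by blast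
  have gA: "a \<in> A" if "a \<in> generate G Y" for a using generate_subgroup_incl[OF Y A] that by blast
  \<comment> \<open>The defect at the pair of units forces \<open>f \<one>\<close> into
    \<open>N\<close>.\<close>
  obtain n where n: "n \<in> N" "f \<one> = f \<one> \<otimes> f \<one> \<otimes> n"
    using hom[of \<one> \<one>] A.one_closed by auto
  have c1: "f \<one> \<in> carrier G" "n \<in> carrier G" using n(1) f A.one_closed by auto
  have "f \<one> \<otimes> (f \<one> \<otimes> n) = f \<one>" using n(2) m_assoc c1 by metis
  then have "f \<one> \<otimes> n = \<one>" using c1 using l_cancel_one[of "f \<one>" "f \<one> \<otimes> n"] by simp
  then have f1: "f \<one> = inv n" using c1 by (simp add: inv_equality)
  then have f1R: "f \<one> \<in> ?R" using NR[OF n(1)] by simp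
  have "f a \<in> ?R" if "a \<in> generate G Y" for a
    using that
  proof (induction a rule: generate.induct)
    case one then show ?case using f1R .
  next
    case (incl h) then show ?case by (simp add: generate.incl)
  next
    case (inv h)
    have hA: "h \<in> A" using inv Y by auto
    obtain k where k: "k \<in> N" "f (h \<otimes> inv h) = f h \<otimes> f (inv h) \<otimes> k"
      using hom[of h "inv h"] hA by auto
    have kc: "k \<in> carrier G" "f h \<in> carrier G" "f (inv h) \<in> carrier G" using k f hA by auto
    have "f (inv h) = inv (f h) \<otimes> f \<one> \<otimes> inv k"
      using k hA kc by (simp add: m_assoc)
    moreover have "f h \<in> ?R" using inv by (simp add: generate.incl)
    ultimately show ?case using f1R NR k by simp
  next
    case (eng h1 h2)
    then obtain k where k: "k \<in> N" "f (h1 \<otimes> h2) = f h1 \<otimes> f h2 \<otimes> k"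
      using hom[of h1 h2] gA by auto
    then show ?case using eng NR by simp
  qed
  then show ?thesis by blast
qed

lemma generate_union_subgroup:
  assumes "Z \<subseteq> carrier G" "Y \<subseteq> carrier G"
  shows "generate G (generate G Z \<union> Y) = generate G (Z \<union> Y)"
proof
  have "generate G Z \<subseteq> generate G (Z \<union> Y)" by (rule mono_generate) blast
  moreover have "Y \<subseteq> generate G (Z \<union> Y)" by (blast intro: generate.incl)
  ultimately show "generate G (generate G Z \<union> Y) \<subseteq> generate G (Z \<union> Y)"
    using generate_is_subgroup[of "Z \<union> Y"] assms by (intro generate_subgroup_incl) auto
  show "generate G (Z \<union> Y) \<subseteq> generate G (generate G Z \<union> Y)"
    by (rule mono_generate) (blast intro: generate.incl)
qed

lemma card_double_subgroup:
  assumes K: "subgroup K G" and L: "subgroup L G" and "K \<subset> L" and fin: "finite L"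
  shows "2 * card K \<le> card L"
proof -
  obtain y where y: "y \<in> L" "y \<notin> K" using assms by blast
  have yc: "y \<in> carrier G" using subgroup.mem_carrier[OF L y(1)] .
  have Kc: "K \<subseteq> carrier G" using subgroup.subset[OF K] .
  have "inj_on (\<lambda>k. k \<otimes> y) K" by (rule inj_on_subset[OF inj_on_multc[OF yc] Kc])
  then have c: "card ((\<lambda>k. k \<otimes> y) ` K) = card K" by (rule card_image)
  have disj: "K \<inter> (\<lambda>k. k \<otimes> y) ` K = {}"
  proof -
    have "k \<otimes> y \<notin> K" if k: "k \<in> K" for k
    proof
      assume "k \<otimes> y \<in> K"
      then have "inv k \<otimes> (k \<otimes> y) \<in> K" using K k by (simp add: subgroup.m_closed subgroup.m_inv_closed)
      then show False using y yc k Kc by auto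
    qed
    then show ?thesis by auto
  qed
  have KL: "K \<subseteq> L" using assms by blast
  have sub: "K \<union> (\<lambda>k. k \<otimes> y) ` K \<subseteq> L" using KL y(1) subgroup.m_closed[OF L] by blast
  have "card (K \<union> (\<lambda>k. k \<otimes> y) ` K) = card K + card K"
    using disj c fin sub by (metis card_Un_disjoint finite_subset le_sup_iff)
  then show ?thesis using card_mono[OF fin sub] by simp
qed

text \<open>Greedy choice: each new generator at least doubles the order of the subgroup reached so
  far. This is the exchange that turns a large rank into an exponentially large index.\<close>

lemma small_generating_set_over:
  assumes K: "subgroup K G" and L: "subgroup L G" and KL: "K \<subseteq> L" and fin: "finite L"
  shows "\<exists>Y. finite Y \<and> Y \<subseteq> L \<and> L = generate G (Y \<union> K) \<and> 2 ^ card Y * card K \<le> card L"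
  using K KL
proof (induction "card L - card K" arbitrary: K rule: less_induct)
  case less
  show ?case
  proof (cases "K = L")
    case True
    have "generate G L = L"
      using L by (intro subset_antisym generate_subgroup_incl) (auto intro: generate.incl)
    then show ?thesis using True by (intro exI[of _ "{}"]) auto
  next
    case False
    then obtain y where y: "y \<in> L" "y \<notin> K" using less.prems by blast
    have Lc: "L \<subseteq> carrier G" using subgroup.subset[OF L] .
    let ?K = "generate G (insert y K)"
    have sK: "subgroup ?K G" using generate_is_subgroup[of "insert y K"] Lc less.prems y by auto
    have KsubL: "?K \<subseteq> L" using less.prems y L by (intro generate_subgroup_incl) auto
    have "K \<subset> ?K" using y by (auto intro: generate.incl)
    then have dbl: "2 * card K \<le> card ?K"
      using card_double_subgroup[OF less.prems(1) sK] fin KsubL finite_subset by blast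
    have posK: "card K > 0" using subgroup.one_closed[OF less.prems(1)] finite_subset[OF less.prems(2) fin] card_gt_0_iff by blast
    have "card ?K \<le> card L" using KsubL fin card_mono by blast
    then have "card L - card ?K < card L - card K" using dbl posK by linarith
    from less.hyps[OF this sK KsubL]
    obtain Y where Y: "finite Y" "Y \<subseteq> L" and LY: "L = generate G (Y \<union> ?K)"
      and cY: "2 ^ card Y * card ?K \<le> card L"
      by blast
    have "L = generate G (insert y Y \<union> K)"
    proof -
      have "generate G (?K \<union> Y) = generate G (insert y K \<union> Y)"
        using Y(2) Lc less.prems y by (intro generate_union_subgroup) auto
      moreover have "insert y K \<union> Y = insert y Y \<union> K" by auto
      moreover have "Y \<union> ?K = ?K \<union> Y" by auto
      ultimately show ?thesis using LY by presburger
    qed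
    moreover have "2 ^ card (insert y Y) * card K \<le> card L"
    proof -
      have "card (insert y Y) \<le> Suc (card Y)" by (rule card_insert_le_m1) auto
      then have "(2::nat) ^ card (insert y Y) \<le> 2 ^ Suc (card Y)" by (intro power_increasing) auto
      then have "2 ^ card (insert y Y) * card K \<le> 2 ^ Suc (card Y) * card K" by simp
      also have "\<dots> = 2 ^ card Y * (2 * card K)" by simp
      also have "\<dots> \<le> 2 ^ card Y * card ?K" using dbl by (intro mult_le_mono2)
      finally show ?thesis using cY by linarith
    qed
    moreover have "finite (insert y Y)" "insert y Y \<subseteq> L" using Y y by auto
    ultimately show ?thesis by blast
  qed
qed

end

section \<open>Schreier generators, and generators of derived subgroups\<close>

context group
begin

text \<open>Schreier's lemma with its count: one generator for each pair of a coset and an element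
  of \<open>S\<close>.\<close>

lemma schreier_generators:
  assumes S: "finite S" "S \<subseteq> carrier G" "generate G S = carrier G"
    and K: "subgroup K G" and fin: "finite (rcosets K)"
  shows "\<exists>E. finite E \<and> E \<subseteq> K \<and> generate G E = K \<and> card E \<le> card (rcosets K) * card S"
proof -
  interpret K: subgroup K G by fact
  \<comment> \<open>Representing the coset \<open>K\<close> by \<open>\<one>\<close> makes
    \<open>r k = \<one>\<close> for \<open>k\<close> in \<open>K\<close>, so that \<open>P k\<close>
    will say that \<open>k\<close> itself lies in the group generated by \<open>E\<close>.\<close>
  define rep where "rep C = (if C = K then \<one> else SOME c. c \<in> C)" for C
  have rep_in: "rep C \<in> C" if C: "C \<in> rcosets K" for C
  proof -
    have "C \<noteq> {}" using C K.rcosets_non_empty by blast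
    then show ?thesis unfolding rep_def using some_in_eq K.one_closed by auto
  qed
  have rep_c: "rep C \<in> carrier G" if C: "C \<in> rcosets K" for C
    using rep_in[OF C] C K.rcosets_carrier by blast
  define r where "r g = rep (K #> g)" for g
  have cos: "K #> g \<in> rcosets K" if "g \<in> carrier G" for g
    using that K.subset by (simp add: rcosetsI)
  have r_c: "r g \<in> carrier G" if "g \<in> carrier G" for g
    using that cos rep_c by (simp add: r_def)
  have r_cos: "K #> r g = K #> g" if g: "g \<in> carrier G" for g
    using repr_independence[OF _ g K] rep_in[OF cos[OF g]] by (simp add: r_def)
  have rr: "r (r g \<otimes> s) = r (g \<otimes> s)" if "g \<in> carrier G" "s \<in> carrier G" for g s
  proof -
    have "K #> (r g \<otimes> s) = K #> (g \<otimes> s)"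
      using that r_c r_cos K.subset by (simp add: coset_mult_assoc [symmetric])
    then show ?thesis by (simp add: r_def)
  qed
  define e where "e = (\<lambda>(C, s). rep C \<otimes> s \<otimes> inv (r (rep C \<otimes> s)))"
  define E where "E = e ` ((rcosets K) \<times> S)"
  have finE: "finite E" unfolding E_def using fin S by simp
  have cardE: "card E \<le> card (rcosets K) * card S"
    unfolding E_def using card_image_le[of "(rcosets K) \<times> S" e] fin S by (simp add: card_cartesian_product)
  have EK: "E \<subseteq> K"
  proof
    fix y assume "y \<in> E"
    then obtain C s where C: "C \<in> rcosets K" "s \<in> S" and y: "y = rep C \<otimes> s \<otimes> inv (r (rep C \<otimes> s))"
      unfolding E_def e_def by auto
    have c: "rep C \<otimes> s \<in> carrier G" using C rep_c S by auto
    have "rep C \<otimes> s \<in> K #> r (rep C \<otimes> s)"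
      using r_cos[OF c] rcos_self[OF c K] by simp
    then show "y \<in> K" using K.rcos_module_imp[OF is_group r_c[OF c]] y by simp
  qed
  have Ec: "E \<subseteq> carrier G" using EK K.subset by blast
  let ?K = "generate G E"
  interpret K': subgroup ?K G by (rule generate_is_subgroup[OF Ec])
  \<comment> \<open>Right multiplication of \<open>g\<close> by an element of \<open>S\<close>
    changes \<open>g \<otimes> inv (r g)\<close> by a factor from \<open>E\<close>. So
    \<open>P\<close> spreads from \<open>\<one>\<close> over the whole group.\<close>
  define P where "P g \<longleftrightarrow> g \<otimes> inv (r g) \<in> ?K" for g
  have step: "P (g \<otimes> s) \<longleftrightarrow> P g" if g: "g \<in> carrier G" and s: "s \<in> S" for g s
  proof -
    have sc: "s \<in> carrier G" using s S by auto
    have rc: "r g \<in> carrier G" "r (g \<otimes> s) \<in> carrier G" using r_c g sc by auto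
    have t: "r g \<otimes> s \<otimes> inv (r (g \<otimes> s)) \<in> E"
    proof -
      have "e (K #> g, s) = r g \<otimes> s \<otimes> inv (r (r g \<otimes> s))" by (simp add: e_def r_def)
      then show ?thesis using cos[OF g] s rr[OF g sc] unfolding E_def by force
    qed
    let ?t = "r g \<otimes> s \<otimes> inv (r (g \<otimes> s))"
    have tK: "?t \<in> ?K" using t by (rule generate.incl)
    have eq: "g \<otimes> s \<otimes> inv (r (g \<otimes> s)) = (g \<otimes> inv (r g)) \<otimes> ?t"
      using g sc rc by (simp add: m_assoc)
    have eq': "g \<otimes> inv (r g) = (g \<otimes> s \<otimes> inv (r (g \<otimes> s))) \<otimes> inv ?t"
      using g sc rc by (simp add: word_simps)
    show ?thesis unfolding P_def using eq eq' tK by (metis K'.m_closed K'.m_inv_closed)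
  qed
  have gc: "g \<in> carrier G" if "g \<in> generate G S" for g using that S by simp
  have mv: "P (c \<otimes> g) \<longleftrightarrow> P c" if "c \<in> carrier G" "g \<in> generate G S" for c g
    using that(2,1)
  proof (induction g arbitrary: c rule: generate.induct)
    case one then show ?case by simp
  next
    case (incl h) then show ?case using step by simp
  next
    case (inv h)
    have hc: "h \<in> carrier G" using inv S by auto
    have "P (c \<otimes> inv h \<otimes> h) \<longleftrightarrow> P (c \<otimes> inv h)" using step inv hc by simp
    then show ?case using inv hc by (simp add: m_assoc)
  next
    case (eng h1 h2)
    have "h1 \<in> carrier G" "h2 \<in> carrier G" using eng gc by auto
    then show ?case using eng by (simp add: m_assoc [symmetric])
  qed
  have "r \<one> = \<one>" by (simp add: r_def rep_def K.subset)
  then have P1: "P \<one>" by (simp add: P_def)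
  have "K \<subseteq> ?K"
  proof
    fix k assume k: "k \<in> K"
    then have kc: "k \<in> carrier G" by simp
    have "r k = \<one>" using k K coset_join2[OF kc K] by (simp add: r_def rep_def)
    moreover have "P k" using mv[of \<one> k] P1 kc S by simp
    ultimately show "k \<in> ?K" using kc by (simp add: P_def)
  qed
  moreover have "?K \<subseteq> K" by (rule generate_subgroup_incl[OF EK K])
  ultimately show ?thesis using finE EK cardE by blast
qed

text \<open>Modulo \<open>C\<close> the derived subgroup is central, so the group generated by the
  commutators of generators is already normalized. This is the source of the term
  \<open>card V * card V\<close> in the bound for the rank of \<open>U1/U2\<close>.\<close>

lemma derived_generators_over:
  assumes V: "V \<subseteq> carrier G" and C: "subgroup C G" "C \<subseteq> derived G (generate G V)"
    and act: "\<And>h u. h \<in> generate G V \<Longrightarrow> u \<in> derived G (generate G V) \<Longrightarrow> comm G h u \<in> C"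
  shows "derived G (generate G V) = generate G ((\<lambda>(v, w). comm G v w) ` (V \<times> V) \<union> C)"
proof -
  let ?U = "generate G V" and ?W = "(\<lambda>(v, w). comm G v w) ` (V \<times> V)"
  let ?D = "generate G (?W \<union> C)"
  have Uc: "?U \<subseteq> carrier G" using V by (rule generate_incl)
  interpret U1: subgroup "derived G ?U" G by (rule derived_is_subgroup[OF Uc])
  have W: "?W \<subseteq> derived G ?U" using comm_in_derived[of _ ?U] by (auto intro: generate.incl)
  have DU: "?D \<subseteq> derived G ?U"
    by (rule generate_subgroup_incl[OF _ U1.subgroup_axioms]) (use W C in auto)
  interpret D: subgroup ?D G by (rule generate_is_subgroup) (use W C U1.subset in blast)
  have "derived G ?U \<subseteq> ?D"
  proof (rule derived_generate_subset[OF V D.subgroup_axioms])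
    show "u \<otimes> d \<otimes> inv u \<in> ?D" if "u \<in> ?U" "d \<in> ?D" for u d
    proof -
      have uc: "u \<in> carrier G" using that Uc by auto
      have dc: "d \<in> carrier G" using D.mem_carrier[OF that(2)] .
      have "comm G u d \<in> C" using act[OF that(1)] that(2) DU by (meson subsetD)
      then have "comm G u d \<in> ?D" by (simp add: generate.incl)
      then have "comm G u d \<otimes> d \<in> ?D" using that(2) by (rule D.m_closed)
      moreover have "comm G u d \<otimes> d = u \<otimes> d \<otimes> inv u" using comm_mult[OF uc dc] .
      ultimately show ?thesis by simp
    qed
    show "comm G s t \<in> ?D" if "s \<in> V" "t \<in> V" for s t
      using that by (intro generate.incl) auto
  qed
  then show ?thesis using DU by blast
qed

end

section \<open>Powers of products and elimination of characters\<close>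

text \<open>The product of the conjugates of \<open>u\<close> by \<open>x^0\<close>, ...,
  \<open>x^(r-1)\<close>, called \<open>\<psi>\<close> in the overview: it is the cocycle that
  compares \<open>(u x)^r\<close> with \<open>x^r\<close>. On an abelian normal section it is the
  operator \<open>1 + x + ... + x^(r-1)\<close>.\<close>

primrec tpow :: "('a, 'b) monoid_scheme \<Rightarrow> 'a \<Rightarrow> 'a \<Rightarrow> nat \<Rightarrow> 'a" where
  "tpow G x u 0 = \<one>\<^bsub>G\<^esub>"
| "tpow G x u (Suc r) = u \<otimes>\<^bsub>G\<^esub> (x \<otimes>\<^bsub>G\<^esub> tpow G x u r \<otimes>\<^bsub>G\<^esub> inv\<^bsub>G\<^esub> x)"

context group
begin

lemma tpow_in_normal:
  assumes "N \<lhd> G" "x \<in> carrier G" "u \<in> N"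
  shows "tpow G x u r \<in> N"
proof -
  interpret N: normal N G by fact
  show ?thesis by (induction r) (use assms in \<open>simp_all add: N.inv_op_closed2\<close>)
qed

lemma tpow_closed [simp]: "x \<in> carrier G \<Longrightarrow> u \<in> carrier G \<Longrightarrow> tpow G x u r \<in> carrier G"
  by (induction r) simp_all

lemma mult_pow_eq_tpow:
  assumes x: "x \<in> carrier G" and u: "u \<in> carrier G"
  shows "(u \<otimes> x) [^] (r::nat) = tpow G x u r \<otimes> x [^] r"
proof (induction r)
  case 0 then show ?case by simp
next
  case (Suc r)
  have "(u \<otimes> x) [^] Suc r = (u \<otimes> x) \<otimes> (tpow G x u r \<otimes> x [^] r)"
    using x u Suc by (subst nat_pow_Suc2) simp_all
  moreover have "x [^] Suc r = x \<otimes> x [^] r" using x by (rule nat_pow_Suc2)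
  ultimately show ?case using x u by (simp add: m_assoc del: nat_pow_Suc)
qed

lemma tpow_Suc_right:
  assumes x: "x \<in> carrier G" and u: "u \<in> carrier G"
  shows "tpow G x u (Suc r) = tpow G x u r \<otimes> (x [^] r \<otimes> u \<otimes> inv (x [^] r))"
proof -
  have c: "tpow G x u r \<in> carrier G" "x [^] r \<in> carrier G" "x [^] Suc r \<in> carrier G" using x u by auto
  have "tpow G x u (Suc r) \<otimes> x [^] Suc r = (u \<otimes> x) [^] r \<otimes> (u \<otimes> x)"
    using mult_pow_eq_tpow[OF x u, of "Suc r"] nat_pow_Suc by metis
  also have "\<dots> = tpow G x u r \<otimes> x [^] r \<otimes> (u \<otimes> x)"
    using mult_pow_eq_tpow[OF x u, of r] by simp
  also have "\<dots> = (tpow G x u r \<otimes> (x [^] r \<otimes> u \<otimes> inv (x [^] r))) \<otimes> x [^] Suc r"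
    using c x u by (simp add: m_assoc)
  finally show ?thesis using c x u by (metis inv_closed m_closed r_cancel tpow_closed)
qed

lemma commute_modulo:
  "a \<in> carrier G \<Longrightarrow> b \<in> carrier G \<Longrightarrow> b \<otimes> a = a \<otimes> b \<otimes> comm G (inv b) (inv a)"
  by (simp add: comm_def word_simps)

lemma comm_inv_in_derived:
  assumes "A \<lhd> G" "a \<in> A" "b \<in> A"
  shows "comm G (inv a) (inv b) \<in> derived G A"
proof -
  interpret A: normal A G by fact
  show ?thesis using assms by (intro comm_in_derived) simp_all
qed

text \<open>On the abelian section \<open>A/N\<close> the twisted power is a sum of conjugations,
  hence additive. The errors are collected on the right, where normality keeps them in
  \<open>N\<close>.\<close>

lemma tpow_hom_modulo:
  assumes A: "A \<lhd> G" and N: "N \<lhd> G" and AN: "derived G A \<subseteq> N"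
    and x: "x \<in> carrier G" and u: "u \<in> A" and v: "v \<in> A"
  shows "\<exists>n\<in>N. tpow G x (u \<otimes> v) r = tpow G x u r \<otimes> tpow G x v r \<otimes> n"
proof (induction r)
  case 0
  interpret N: normal N G by fact
  show ?case using N.one_closed by (intro bexI[of _ \<one>]) simp_all
next
  case (Suc r)
  interpret A: normal A G by fact
  interpret N: normal N G by fact
  define a where "a = tpow G x u r"
  define b where "b = tpow G x v r"
  obtain n where n: "n \<in> N" and eq: "tpow G x (u \<otimes> v) r = a \<otimes> b \<otimes> n"
    using Suc by (auto simp: a_def b_def)
  have aA: "a \<in> A" "b \<in> A" using tpow_in_normal[OF A x] u v by (simp_all add: a_def b_def)
  define a' where "a' = x \<otimes> a \<otimes> inv x"
  define b' where "b' = x \<otimes> b \<otimes> inv x"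
  define n' where "n' = x \<otimes> n \<otimes> inv x"
  have A': "a' \<in> A" "b' \<in> A" and n': "n' \<in> N"
    using A.inv_op_closed2 N.inv_op_closed2 x aA n by (simp_all add: a'_def b'_def n'_def)
  have c: "a \<in> carrier G" "b \<in> carrier G" "n \<in> carrier G" "a' \<in> carrier G" "b' \<in> carrier G"
    "n' \<in> carrier G" "u \<in> carrier G" "v \<in> carrier G"
    using aA A' n n' u v by auto
  define k where "k = comm G (inv v) (inv a')"
  have kN: "k \<in> N" using comm_inv_in_derived[OF A v A'(1)] AN by (auto simp: k_def)
  have kc: "k \<in> carrier G" using kN by simp
  have com: "v \<otimes> a' = a' \<otimes> v \<otimes> k" unfolding k_def by (rule commute_modulo) (use c in auto)
  have "tpow G x (u \<otimes> v) (Suc r) = u \<otimes> v \<otimes> (x \<otimes> (a \<otimes> b \<otimes> n) \<otimes> inv x)" by (simp add: eq)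
  also have "\<dots> = u \<otimes> (v \<otimes> a') \<otimes> b' \<otimes> n'"
    using c x by (simp add: a'_def b'_def n'_def m_assoc)
  also have "\<dots> = u \<otimes> (a' \<otimes> v \<otimes> k) \<otimes> b' \<otimes> n'" by (simp only: com)
  also have "\<dots> = (u \<otimes> a') \<otimes> (v \<otimes> b') \<otimes> ((inv b' \<otimes> k \<otimes> b') \<otimes> n')"
    using c kc by (simp add: m_assoc)
  finally have "tpow G x (u \<otimes> v) (Suc r)
      = tpow G x u (Suc r) \<otimes> tpow G x v (Suc r) \<otimes> ((inv b' \<otimes> k \<otimes> b') \<otimes> n')"
    by (simp add: a'_def b'_def a_def b_def)
  moreover have "(inv b' \<otimes> k \<otimes> b') \<otimes> n' \<in> N"
    using N.inv_op_closed1[OF c(5) kN] n' by simp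
  ultimately show ?case by blast
qed

lemma comm_hom_modulo:
  assumes A: "A \<lhd> G" and AN: "derived G A \<subseteq> N"
    and x: "x \<in> carrier G" and a: "a \<in> A" and b: "b \<in> A"
  shows "\<exists>n\<in>N. comm G x (a \<otimes> b) = comm G x a \<otimes> comm G x b \<otimes> n"
proof -
  interpret A: normal A G by fact
  define e where "e = comm G x b"
  have eA: "e \<in> A" using comm_in_normal[OF A x b] by (simp add: e_def)
  have c: "a \<in> carrier G" "b \<in> carrier G" "e \<in> carrier G" using a b eA by auto
  have "comm G x (a \<otimes> b) = x \<otimes> a \<otimes> inv x \<otimes> (e \<otimes> inv a)"
    using c(1,2) x by (simp add: e_def comm_def word_simps)
  also have "e \<otimes> inv a = inv a \<otimes> e \<otimes> comm G (inv e) (inv (inv a))"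
    by (rule commute_modulo) (use c in auto)
  also have "x \<otimes> a \<otimes> inv x \<otimes> (inv a \<otimes> e \<otimes> comm G (inv e) (inv (inv a)))
      = comm G x a \<otimes> comm G x b \<otimes> comm G (inv e) (inv (inv a))"
    using c x by (simp add: e_def [symmetric] comm_def [of G x a] m_assoc)
  finally have "comm G x (a \<otimes> b) = comm G x a \<otimes> comm G x b \<otimes> comm G (inv e) (inv (inv a))" .
  moreover have "comm G (inv e) (inv (inv a)) \<in> N"
    using comm_inv_in_derived[OF A eA, of "inv a"] a AN by auto
  ultimately show ?thesis by blast
qed

text \<open>On the abelian section \<open>A/N\<close> this is the factorization
  \<open>x^r - 1 = (x - 1)(1 + x + ... + x^(r-1))\<close>. It links commutators with
  \<open>x^r\<close> to the image of the twisted power.\<close>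

lemma comm_pow_modulo:
  assumes A: "A \<lhd> G" and AN: "derived G A \<subseteq> N" "subgroup N G"
    and x: "x \<in> carrier G" and u: "u \<in> A"
  shows "\<exists>n\<in>N. comm G (x [^] (r::nat)) u = comm G x (tpow G x u r) \<otimes> n"
proof -
  interpret A: normal A G by fact
  define t where "t = tpow G x u r"
  define w where "w = x [^] r \<otimes> u \<otimes> inv (x [^] r)"
  have t: "t \<in> A" using tpow_in_normal[OF A x u] by (simp add: t_def)
  have w: "w \<in> A" using A.inv_op_closed2[of "x [^] r"] x u by (simp add: w_def)
  have c: "t \<in> carrier G" "w \<in> carrier G" "u \<in> carrier G" using t w u by auto
  have "u \<otimes> (x \<otimes> t \<otimes> inv x) = t \<otimes> w"
    using tpow_Suc_right[OF x c(3), of r] by (simp add: t_def w_def)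
  then have "x \<otimes> t \<otimes> inv x = inv u \<otimes> (t \<otimes> w)"
    using c x by (metis cancel_left(1) inv_closed m_closed)
  then have 1: "comm G x t = inv u \<otimes> (t \<otimes> w) \<otimes> inv t" by (simp add: comm_def)
  have 2: "comm G (x [^] r) u = w \<otimes> inv u" by (simp add: comm_def w_def)
  have "comm G (x [^] r) u = comm G x t \<otimes> (comm G t (inv w) \<otimes> comm G (inv w) u)"
    unfolding 1 2 using c by (simp add: comm_def word_simps)
  moreover have "comm G t (inv w) \<otimes> comm G (inv w) u \<in> N"
  proof -
    have "comm G t (inv w) \<in> N" "comm G (inv w) u \<in> N"
      using comm_in_derived[of _ A] t w u AN A.m_inv_closed by blast+
    then show ?thesis using AN subgroup.m_closed by metis
  qed
  ultimately show ?thesis unfolding t_def by blast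
qed

end

text \<open>Artin's argument in multiplicative notation: \<open>F i\<close> is the i-th character,
  with endomorphisms as values, and \<open>T i a\<close> is its coefficient. Each round removes one
  index. Index 0 is never removed, and because \<open>F 0\<close> is trivial its coefficient just
  collects the factors \<open>1 - F k (ws k)\<close>.\<close>

lemma (in comm_group) character_elimination:
  fixes F :: "nat \<Rightarrow> 'w \<Rightarrow> 'a \<Rightarrow> 'a" and T :: "nat \<Rightarrow> 'a \<Rightarrow> 'a" and f :: "'w \<Rightarrow> 'w \<Rightarrow> 'w"
  assumes F: "\<And>i w. w \<in> W \<Longrightarrow> F i w \<in> hom G G"
    and T: "\<And>i a. a \<in> carrier G \<Longrightarrow> T i a \<in> carrier G"
    and closed: "\<And>v w. v \<in> W \<Longrightarrow> w \<in> W \<Longrightarrow> f v w \<in> W"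
    and mult: "\<And>i v w a. v \<in> W \<Longrightarrow> w \<in> W \<Longrightarrow> a \<in> carrier G \<Longrightarrow> F i (f v w) a = F i v (F i w a)"
    and commute: "\<And>i j v w a. v \<in> W \<Longrightarrow> w \<in> W \<Longrightarrow> a \<in> carrier G \<Longrightarrow> F i v (F j w a) = F j w (F i v a)"
    and F0: "\<And>w a. w \<in> W \<Longrightarrow> a \<in> carrier G \<Longrightarrow> F 0 w a = a"
    and T0: "\<And>a. a \<in> carrier G \<Longrightarrow> T 0 a = a"
    and total: "\<And>w a. w \<in> W \<Longrightarrow> a \<in> carrier G \<Longrightarrow> (\<Otimes>i\<in>{..<m}. F i w (T i a)) = \<one>"
    and m: "m > 0" and ws: "\<And>j. j \<in> {1..<m} \<Longrightarrow> ws j \<in> W" and W: "W \<noteq> {}"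
    and a: "a \<in> carrier G"
    and e0: "e 0 = a"
    and eS: "\<And>k. Suc k < m \<Longrightarrow> e (Suc k) = e k \<otimes> inv (F (Suc k) (ws (Suc k)) (e k))"
  shows "e (m - 1) = \<one>"
proof -
  \<comment> \<open>\<open>E i k\<close> is the coefficient of the i-th character after
    \<open>k\<close> rounds. For \<open>i = 0\<close> the recursion is that of \<open>e\<close>; for
    \<open>i = Suc k\<close> the coefficient becomes trivial in passing from \<open>k\<close> to
    \<open>Suc k\<close>.\<close>
  define E where "E i = rec_nat (T i a) (\<lambda>k y. F i (ws (Suc k)) y \<otimes> inv (F (Suc k) (ws (Suc k)) y))" for i
  have E_0: "E i 0 = T i a" for i by (simp add: E_def)
  have E_Suc: "E i (Suc k) = F i (ws (Suc k)) (E i k) \<otimes> inv (F (Suc k) (ws (Suc k)) (E i k))" for i k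
    by (simp add: E_def)
  have Fc: "F i w b \<in> carrier G" if "w \<in> W" "b \<in> carrier G" for i w b
    using hom_in_carrier[OF F[OF that(1)] that(2)] .
  have Fm: "F i w (b \<otimes> d) = F i w b \<otimes> F i w d" if "w \<in> W" "b \<in> carrier G" "d \<in> carrier G" for i w b d
    using hom_mult[OF F[OF that(1)] that(2,3)] .
  have Fhom: "group_hom G G (F i w)" if "w \<in> W" for i w
    using F[OF that] by (simp add: group_hom_def group_hom_axioms_def)
  have Finv: "F i w (inv b) = inv (F i w b)" if "w \<in> W" "b \<in> carrier G" for i w b
    using group_hom.hom_inv[OF Fhom[OF that(1)] that(2)] .
  have Fone: "F i w \<one> = \<one>" if "w \<in> W" for i w
    using group_hom.hom_one[OF Fhom[OF that]] .
  have Ec: "E i k \<in> carrier G" if "k < m" for i k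
    using that
  proof (induction k)
    case 0 then show ?case using T a by (simp add: E_0)
  next
    case (Suc k) then show ?case using Fc ws[of "Suc k"] by (simp add: E_Suc)
  qed
  have Fprod: "F j w (\<Otimes>i\<in>I. y i) = (\<Otimes>i\<in>I. F j w (y i))"
    if "finite I" "w \<in> W" "\<And>i. y i \<in> carrier G" for j w y and I :: "nat set"
    using that(1)
  proof (induction I rule: finite_induct)
    case empty then show ?case using Fone that by simp
  next
    case (insert i I)
    then show ?case using that Fc Fm by (simp add: finprod_insert Pi_iff)
  qed
  have inv_prod: "inv (\<Otimes>i\<in>I. y i) = (\<Otimes>i\<in>I. inv (y i))"
    if "finite I" "\<And>i. y i \<in> carrier G" for y and I :: "nat set"
    using that(1)
  proof (induction I rule: finite_induct)
    case empty then show ?case by simp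
  next
    case (insert i I)
    then show ?case using that by (simp add: finprod_insert Pi_iff inv_mult)
  qed
  have claim: "(\<Otimes>i\<in>{..<m} - {1..k}. F i w (E i k)) = \<one>" if "k < m" "w \<in> W" for k w
    using that
  proof (induction k arbitrary: w)
    case 0 then show ?case using total[OF 0(2) a] by (simp add: E_0)
  next
    case (Suc k)
    define w' where "w' = ws (Suc k)"
    define I where "I = {..<m} - {1..k}"
    define J where "J = {..<m} - {1..Suc k}"
    have w': "w' \<in> W" using ws[of "Suc k"] Suc.prems by (simp add: w'_def)
    have w: "w \<in> W" using Suc.prems by simp
    have km: "k < m" using Suc.prems by simp
    note Ek = Ec[OF km]
    have I: "I = insert (Suc k) J" "Suc k \<notin> J" "finite J" "finite I"
      using Suc.prems by (auto simp: I_def J_def)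
    \<comment> \<open>Two consequences of the relation at stage \<open>k\<close>: its instance at
      \<open>f w w'\<close>, and the inverse of the image under \<open>F (Suc k) w'\<close> of its
      instance at \<open>w\<close>. Their product is the relation in which index
      \<open>Suc k\<close> has dropped out.\<close>
    have 1: "(\<Otimes>i\<in>I. F i w (F i w' (E i k))) = \<one>"
    proof -
      have "(\<Otimes>i\<in>I. F i (f w w') (E i k)) = \<one>"
        using Suc.IH[OF km closed[OF w w']] by (simp add: I_def)
      moreover have "F i (f w w') (E i k) = F i w (F i w' (E i k))" for i
        using mult[OF w w' Ek] .
      ultimately show ?thesis by simp
    qed
    have 2: "(\<Otimes>i\<in>I. F i w (inv (F (Suc k) w' (E i k)))) = \<one>"
    proof -
      have "(\<Otimes>i\<in>I. F i w (E i k)) = \<one>" using Suc.IH[OF km w] by (simp add: I_def)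
      then have "inv (F (Suc k) w' (\<Otimes>i\<in>I. F i w (E i k))) = \<one>" using Fone[OF w'] by simp
      then have "inv (\<Otimes>i\<in>I. F (Suc k) w' (F i w (E i k))) = \<one>"
        using Fprod[OF I(4) w', of "\<lambda>i. F i w (E i k)"] Fc[OF w Ek] by simp
      moreover have "F (Suc k) w' (F i w (E i k)) = F i w (F (Suc k) w' (E i k))" for i
        using commute[OF w' w Ek] .
      ultimately have "inv (\<Otimes>i\<in>I. F i w (F (Suc k) w' (E i k))) = \<one>" by simp
      then have "(\<Otimes>i\<in>I. inv (F i w (F (Suc k) w' (E i k)))) = \<one>"
        using inv_prod[OF I(4), of "\<lambda>i. F i w (F (Suc k) w' (E i k))"] Fc[OF w Fc[OF w' Ek]] by simp
      then show ?thesis using Finv[OF w Fc[OF w' Ek]] by simp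
    qed
    have "(\<Otimes>i\<in>I. F i w (E i (Suc k))) = (\<Otimes>i\<in>I. F i w (F i w' (E i k)) \<otimes> F i w (inv (F (Suc k) w' (E i k))))"
      using Fm[OF w] Fc[OF w' Ek] by (simp add: E_Suc w'_def)
    also have "\<dots> = (\<Otimes>i\<in>I. F i w (F i w' (E i k))) \<otimes> (\<Otimes>i\<in>I. F i w (inv (F (Suc k) w' (E i k))))"
      by (rule finprod_multf) (use Fc[OF w] Fc[OF w' Ek] in auto)
    also have "\<dots> = \<one>" using 1 2 by simp
    finally have 3: "(\<Otimes>i\<in>I. F i w (E i (Suc k))) = \<one>" .
    have "E (Suc k) (Suc k) = \<one>" using Fc[OF w' Ek] by (simp add: E_Suc w'_def)
    then have "F (Suc k) w (E (Suc k) (Suc k)) = \<one>" using Fone[OF w] by simp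
    moreover have "(\<Otimes>i\<in>I. F i w (E i (Suc k)))
        = F (Suc k) w (E (Suc k) (Suc k)) \<otimes> (\<Otimes>i\<in>J. F i w (E i (Suc k)))"
      unfolding I(1) using I(2,3) Fc[OF w Ec[OF Suc.prems(1)]] by (intro finprod_insert) auto
    ultimately show ?case
      using 3 Fc[OF w Ec[OF Suc.prems(1)]] by (simp add: J_def)
  qed
  obtain w where w: "w \<in> W" using W by blast
  have I0: "{..<m} - {1..m - 1} = {0}" using m by auto
  have E0: "E 0 (m - 1) \<in> carrier G" using Ec[of "m - 1"] m by simp
  have "(\<Otimes>i\<in>{0}. F i w (E i (m - 1))) = \<one>"
    using claim[of "m - 1" w] w m I0 by simp
  moreover have "(\<Otimes>i\<in>{0}. F i w (E i (m - 1))) = F 0 w (E 0 (m - 1)) \<otimes> (\<Otimes>i\<in>{}. F i w (E i (m - 1)))"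
    by (rule finprod_insert) (use Fc[OF w E0] in auto)
  ultimately have "E 0 (m - 1) = \<one>" using F0[OF w E0] E0 by simp
  moreover have "E 0 k = e k" if "k < m" for k
    using that
  proof (induction k)
    case 0 then show ?case using T0 a by (simp add: E_0 e0)
  next
    case (Suc k)
    then have "ws (Suc k) \<in> W" "E 0 k \<in> carrier G" using ws[of "Suc k"] Ec[where i = 0 and k = k] by simp_all
    then have "F 0 (ws (Suc k)) (E 0 k) = E 0 k" by (rule F0)
    then show ?case using Suc eS[of k] by (simp add: E_Suc)
  qed
  ultimately show ?thesis using m by simp
qed

section \<open>Three steps of the derived series of a finite group\<close>

text \<open>In additive notation on an abelian normal subgroup, \<open>comm G a w\<close> is
  \<open>(1 - w) a\<close>; the chain applies the factors \<open>1 - ws 1\<close>, ...,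
  \<open>1 - ws k\<close> in turn.\<close>

primrec comm_chain :: "('a, 'b) monoid_scheme \<Rightarrow> (nat \<Rightarrow> 'a) \<Rightarrow> nat \<Rightarrow> 'a \<Rightarrow> 'a" where
  "comm_chain G ws 0 a = a"
| "comm_chain G ws (Suc k) a = comm G (comm_chain G ws k a) (ws (Suc k))"

text \<open>The finite group \<open>G/U3\<close> in isolation: triviality of
  \<open>derived G U2\<close> makes \<open>U2\<close> the module \<open>M\<close> of the overview,
  and \<open>x\<close> stands for the image of the base point of the torsion coset.\<close>

locale derived_tower = group G for G (structure) +
  fixes U0 U1 U2 :: "'a set" and x :: 'a
  assumes fin: "finite (carrier G)"
    and U0: "U0 \<lhd> G" and U1_def: "U1 = derived G U0" and U2_def: "U2 = derived G U1"
    and U3: "derived G U2 = {\<one>}"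
    and x: "x \<in> carrier G"
begin

lemma U1: "U1 \<lhd> G" unfolding U1_def by (rule derived_is_normal[OF U0])
lemma U2: "U2 \<lhd> G" unfolding U2_def by (rule derived_is_normal[OF U1])

sublocale U0: normal U0 G by (rule U0)
sublocale U1: normal U1 G by (rule U1)
sublocale U2: normal U2 G by (rule U2)

lemma U1_subset: "U1 \<subseteq> U0"
  unfolding U1_def by (rule derived_incl[OF order_refl U0.subgroup_axioms])
lemma U2_subset: "U2 \<subseteq> U1"
  unfolding U2_def by (rule derived_incl[OF order_refl U1.subgroup_axioms])

lemma comm_U2: "a \<in> U2 \<Longrightarrow> b \<in> U2 \<Longrightarrow> comm G a b = \<one>"
  using comm_in_derived[of a U2 b] U3 by blast

lemma U2_commute: "a \<in> U2 \<Longrightarrow> b \<in> U2 \<Longrightarrow> a \<otimes> b = b \<otimes> a"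
  using comm_mult[of a b] comm_U2[of a b] by (metis U2.mem_carrier inv_solve_right' l_one m_closed)

text \<open>The full preimage in \<open>U1\<close> of the image of \<open>\<psi>\<close> on
  \<open>U1/U2\<close>, so that its order and index can be compared with those of
  \<open>U2\<close>.\<close>

definition Q :: "nat \<Rightarrow> 'a set" where
  "Q r = generate G ((\<lambda>u. tpow G x u r) ` U1 \<union> U2)"

lemma tpow_U1: "u \<in> U1 \<Longrightarrow> tpow G x u r \<in> U1"
  by (rule tpow_in_normal[OF U1 x])

lemma Q_gens: "(\<lambda>u. tpow G x u r) ` U1 \<union> U2 \<subseteq> U1"
  using tpow_U1 U2_subset by blast

lemma Q_subgroup: "subgroup (Q r) G"
  unfolding Q_def using Q_gens U1.subset by (intro generate_is_subgroup) blast

lemma Q_subset: "Q r \<subseteq> U1"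
  unfolding Q_def by (rule generate_subgroup_incl[OF Q_gens U1.subgroup_axioms])

lemma U2_subset_Q: "U2 \<subseteq> Q r"
  unfolding Q_def by (auto intro: generate.incl)

lemma tpow_in_Q: "u \<in> U1 \<Longrightarrow> tpow G x u r \<in> Q r"
  unfolding Q_def by (auto intro: generate.incl)

text \<open>The two summands have two sources. Up to \<open>U2\<close>, each \<open>[x^r, u]\<close>
  is some \<open>[x, q]\<close> with \<open>q\<close> in \<open>Q r\<close>; conjugating by
  \<open>gs\<close> passes to generators of a group containing \<open>U0\<close>, so
  \<open>card gs * card Y\<close> elements account for all of \<open>[U0, U1]\<close>. Modulo that
  subgroup \<open>U1\<close> is generated by the commutators of elements of
  \<open>V\<close>.\<close>

lemma rank_U1_bound:
  assumes gs: "finite gs" "gs \<subseteq> carrier G"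
    and U0gs: "U0 \<subseteq> generate G ((\<lambda>g. g \<otimes> x [^] r \<otimes> inv g) ` gs)"
    and V: "finite V" "V \<subseteq> carrier G" "generate G V = U0"
    and Y: "finite Y" "Y \<subseteq> Q r" "Q r = generate G (Y \<union> U2)"
  shows "\<exists>Z. finite Z \<and> Z \<subseteq> U1 \<and> U1 = generate G (Z \<union> U2) \<and>
           card Z \<le> card V * card V + card gs * card Y"
proof -
  define W where "W = (\<lambda>(g, q). g \<otimes> comm G x q \<otimes> inv g) ` (gs \<times> Y)"
  have YU1: "Y \<subseteq> U1" using Y(2) Q_subset by blast
  have finW: "finite W" unfolding W_def using gs Y by simp
  have cardW: "card W \<le> card gs * card Y"
    unfolding W_def card_cartesian_product [symmetric] by (rule card_image_le) (use gs Y in simp)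
  have WU1: "W \<subseteq> U1"
  proof -
    have "g \<otimes> comm G x q \<otimes> inv g \<in> U1" if "g \<in> gs" "q \<in> Y" for g q
      using that gs YU1 comm_in_normal(1)[OF U1 x, of q] by (intro U1.inv_op_closed2) auto
    then show ?thesis unfolding W_def by auto
  qed
  let ?C = "generate G (W \<union> U2)"
  have WU2: "W \<union> U2 \<subseteq> U1" using WU1 U2_subset by blast
  then have WU2c: "W \<union> U2 \<subseteq> carrier G" using U1.subset by blast
  have C: "subgroup ?C G" by (rule generate_is_subgroup[OF WU2c])
  have CU1: "?C \<subseteq> U1" by (rule generate_subgroup_incl[OF WU2 U1.subgroup_axioms])
  \<comment> \<open>The elements that act trivially on \<open>U1\<close> modulo \<open>?C\<close>.
    This is a group, so it contains \<open>U0\<close> as soon as it contains the chosen conjugates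
    of \<open>x^r\<close>.\<close>
  let ?T = "{h \<in> carrier G. \<forall>u\<in>U1. comm G h u \<in> ?C}"
  have T: "subgroup ?T G" by (rule act_trivially_subgroup[OF U1 C])
  let ?f = "comm G x"
  let ?R = "generate G (?f ` Y \<union> U2)"
  have fU1: "?f a \<in> U1" if "a \<in> U1" for a using comm_in_normal(1)[OF U1 x that] .
  have fY: "?f ` Y \<union> U2 \<subseteq> carrier G" using YU1 fU1 U1.subset U2.subset by blast
  have R: "subgroup ?R G" by (rule generate_is_subgroup[OF fY])
  have derU1: "derived G U1 \<subseteq> U2" by (simp add: U2_def)
  have fQ: "?f ` Q r \<subseteq> ?R"
  proof -
    have "?f ` generate G (Y \<union> U2) \<subseteq> generate G (?f ` (Y \<union> U2) \<union> U2)"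
    proof (rule generate_image_modulo[OF U2 U1.subgroup_axioms])
      show "Y \<union> U2 \<subseteq> U1" using YU1 U2_subset by blast
      show "?f a \<in> carrier G" if "a \<in> U1" for a using fU1[OF that] by simp
      show "\<exists>n\<in>U2. ?f (a \<otimes> b) = ?f a \<otimes> ?f b \<otimes> n" if "a \<in> U1" "b \<in> U1" for a b
        by (rule comm_hom_modulo[OF U1 derU1 x that])
    qed
    moreover have "?f ` (Y \<union> U2) \<union> U2 = ?f ` Y \<union> U2"
      using comm_in_normal(1)[OF U2 x] by auto
    ultimately show ?thesis using Y(3) by simp
  qed
  have conj: "(\<lambda>b. g \<otimes> b \<otimes> inv g) ` ?R \<subseteq> ?C" if g: "g \<in> gs" for g
  proof -
    have gc: "g \<in> carrier G" using g gs by auto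
    let ?h = "\<lambda>b. g \<otimes> b \<otimes> inv g"
    have "?h ` ?R \<subseteq> generate G (?h ` (?f ` Y \<union> U2) \<union> U2)"
    proof (rule generate_image_modulo[OF U2 subgroup_self fY])
      show "\<exists>n\<in>U2. ?h (a \<otimes> b) = ?h a \<otimes> ?h b \<otimes> n" if "a \<in> carrier G" "b \<in> carrier G" for a b
        using that gc U2.one_closed by (intro bexI[of _ \<one>]) (simp_all add: m_assoc)
    qed (use gc in simp)
    also have "\<dots> \<subseteq> ?C"
    proof (rule mono_generate)
      have "?h b \<in> U2" if "b \<in> U2" for b using U2.inv_op_closed2[OF gc that] .
      then show "?h ` (?f ` Y \<union> U2) \<union> U2 \<subseteq> W \<union> U2" unfolding W_def using g by auto
    qed
    finally show ?thesis .
  qed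
  have gsT: "(\<lambda>g. g \<otimes> x [^] r \<otimes> inv g) ` gs \<subseteq> ?T"
  proof
    fix h assume "h \<in> (\<lambda>g. g \<otimes> x [^] r \<otimes> inv g) ` gs"
    then obtain g where g: "g \<in> gs" and h: "h = g \<otimes> x [^] r \<otimes> inv g" by auto
    have gc: "g \<in> carrier G" using g gs by auto
    have "comm G h u \<in> ?C" if u: "u \<in> U1" for u
    proof -
      define v where "v = inv g \<otimes> u \<otimes> g"
      have v: "v \<in> U1" unfolding v_def by (rule U1.inv_op_closed1[OF gc u])
      have uc: "u \<in> carrier G" using u by simp
      \<comment> \<open>Conjugating back by \<open>g\<close> reduces the claim to \<open>x^r\<close>
        itself, where the factorization of \<open>x^r - 1\<close> applies.\<close>
      have eq: "comm G h u = g \<otimes> comm G (x [^] r) v \<otimes> inv g"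
        unfolding h v_def comm_def using gc uc x by (simp add: word_simps)
      obtain n where n: "n \<in> U2" "comm G (x [^] r) v = ?f (tpow G x v r) \<otimes> n"
        using comm_pow_modulo[OF U1 derU1 U2.subgroup_axioms x v, of r] by auto
      have "?f (tpow G x v r) \<in> ?R" using fQ tpow_in_Q[OF v] by blast
      moreover have "n \<in> ?R" using n(1) by (simp add: generate.incl)
      ultimately have "comm G (x [^] r) v \<in> ?R" unfolding n(2) by (rule subgroup.m_closed[OF R])
      then show ?thesis unfolding eq using conj[OF g] by blast
    qed
    moreover have "h \<in> carrier G" using gc x h by simp
    ultimately show "h \<in> ?T" by blast
  qed
  have U0T: "U0 \<subseteq> ?T" using U0gs generate_subgroup_incl[OF gsT T] by (rule subset_trans)
  let ?W = "(\<lambda>(v, w). comm G v w) ` (V \<times> V)"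
  have VU0: "V \<subseteq> U0" using V(3) generate.incl[of _ V G] by blast
  have WU1': "?W \<subseteq> U1" unfolding U1_def by (auto intro!: comm_in_derived subsetD[OF VU0])
  have "derived G (generate G V) = generate G (?W \<union> ?C)"
  proof (rule derived_generators_over[OF V(2) C])
    show "?C \<subseteq> derived G (generate G V)" using CU1 V(3) U1_def by simp
    show "comm G h u \<in> ?C" if "h \<in> generate G V" "u \<in> derived G (generate G V)" for h u
      using that U0T V(3) U1_def by blast
  qed
  also have "derived G (generate G V) = U1" using V(3) U1_def by simp
  also have "generate G (?W \<union> ?C) = generate G (?C \<union> ?W)" by (simp add: Un_commute)
  also have "\<dots> = generate G (W \<union> U2 \<union> ?W)"
    by (rule generate_union_subgroup[OF WU2c]) (use WU1' U1.subset in blast)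
  also have "W \<union> U2 \<union> ?W = (?W \<union> W) \<union> U2" by blast
  finally have "U1 = generate G ((?W \<union> W) \<union> U2)" .
  moreover have "card (?W \<union> W) \<le> card V * card V + card gs * card Y"
  proof -
    have "card ?W \<le> card V * card V"
      unfolding card_cartesian_product [symmetric] by (rule card_image_le) (use V in simp)
    then show ?thesis using card_Un_le[of ?W W] cardW by linarith
  qed
  ultimately show ?thesis using WU1 WU1' finW V(1) by (intro exI[of _ "?W \<union> W"]) auto
qed

lemma U2_comm_group: "comm_group (G\<lparr>carrier := U2\<rparr>)"
proof -
  interpret M: group "G\<lparr>carrier := U2\<rparr>" by (rule subgroup_imp_group[OF U2.subgroup_axioms])
  show ?thesis by (rule M.group_comm_groupI) (simp add: U2_commute)
qed

lemma tpow_eq_finprod: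
  assumes g: "g \<in> carrier G" and a: "a \<in> U2"
  shows "tpow G g a m = finprod (G\<lparr>carrier := U2\<rparr>) (\<lambda>i. g [^] i \<otimes> a \<otimes> inv (g [^] i)) {..<m}"
proof -
  interpret M: comm_group "G\<lparr>carrier := U2\<rparr>" by (rule U2_comm_group)
  have c: "g [^] i \<otimes> a \<otimes> inv (g [^] i) \<in> U2" for i :: nat
    using U2.inv_op_closed2[of "g [^] i" a] g a by simp
  show ?thesis
  proof (induction m)
    case 0 then show ?case by simp
  next
    case (Suc m)
    have "tpow G g a (Suc m) = tpow G g a m \<otimes> (g [^] m \<otimes> a \<otimes> inv (g [^] m))"
      by (rule tpow_Suc_right) (use g a in auto)
    also have "\<dots> = (g [^] m \<otimes> a \<otimes> inv (g [^] m)) \<otimes> tpow G g a m"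
      by (rule U2_commute) (use c tpow_in_normal[OF U2 g a] in auto)
    finally show ?case using Suc c by (simp add: lessThan_Suc del: tpow.simps)
  qed
qed

lemma comm_chain_in_U2:
  assumes "a \<in> U2" "\<And>j. j \<in> {1..k} \<Longrightarrow> ws j \<in> carrier G"
  shows "comm_chain G ws k a \<in> U2"
  using assms by (induction k) (auto intro: comm_in_normal(2)[OF U2])

text \<open>\<open>u v\<close> and \<open>v u\<close> differ by an element of \<open>U2\<close>,
  which acts trivially on the abelian group \<open>U2\<close>.\<close>

lemma U1_act_U2:
  assumes "u \<in> U1" "v \<in> U1" "a \<in> U2"
  shows "u \<otimes> (v \<otimes> a \<otimes> inv v) \<otimes> inv u = v \<otimes> (u \<otimes> a \<otimes> inv u) \<otimes> inv v"
proof -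
  define k where "k = comm G (inv u) (inv v)"
  define b where "b = u \<otimes> v \<otimes> a \<otimes> inv (u \<otimes> v)"
  have c: "u \<in> carrier G" "v \<in> carrier G" "a \<in> carrier G" using assms by auto
  have k: "k \<in> U2" unfolding k_def U2_def by (rule comm_inv_in_derived[OF U1 assms(1,2)])
  have kc: "k \<in> carrier G" using k by simp
  have uv: "u \<otimes> v = v \<otimes> u \<otimes> k" unfolding k_def by (rule commute_modulo) (use c in auto)
  have ka: "k \<otimes> a \<otimes> inv k = a"
    using U2_commute[OF k assms(3)] c kc by (simp add: m_assoc)
  have "u \<otimes> (v \<otimes> a \<otimes> inv v) \<otimes> inv u = (u \<otimes> v) \<otimes> a \<otimes> inv (u \<otimes> v)"
    using c by (simp add: word_simps)
  also have "\<dots> = (v \<otimes> u \<otimes> k) \<otimes> a \<otimes> inv (v \<otimes> u \<otimes> k)" by (simp only: uv)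
  also have "\<dots> = v \<otimes> (u \<otimes> (k \<otimes> a \<otimes> inv k) \<otimes> inv u) \<otimes> inv v"
    using c kc by (simp add: word_simps)
  finally show ?thesis unfolding ka .
qed

text \<open>Independence of characters for the action of \<open>U1/U2\<close> on \<open>U2\<close>.
  The i-th character at \<open>w\<close> is conjugation by \<open>tpow G x w i\<close>,
  multiplicative in \<open>w\<close> because the twisted power is additive modulo \<open>U2\<close>;
  its coefficient is conjugation by \<open>x^i\<close>.\<close>

lemma comm_chain_trivial:
  assumes pow: "\<And>z. z \<in> U0 \<Longrightarrow> (z \<otimes> x) [^] m = \<one>" and m: "(m::nat) > 0"
    and us: "\<And>j. j \<in> {1..<m} \<Longrightarrow> us j \<in> U1"
    and ws: "\<And>j. j \<in> {1..<m} \<Longrightarrow> ws j = tpow G x (us j) j"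
    and a: "a \<in> U2"
  shows "comm_chain G ws (m - 1) a = \<one>"
proof -
  let ?M = "G\<lparr>carrier := U2\<rparr>"
  interpret M: comm_group ?M by (rule U2_comm_group)
  let ?F = "\<lambda>i w b. tpow G x w i \<otimes> b \<otimes> inv (tpow G x w i)"
  let ?T = "\<lambda>i b. x [^] (i::nat) \<otimes> b \<otimes> inv (x [^] i)"
  have wsU1: "ws j \<in> U1" if "j \<in> {1..<m}" for j using tpow_U1[OF us[OF that]] ws[OF that] by simp
  have Fc: "?F i w b \<in> U2" if "w \<in> U1" "b \<in> U2" for i w b
    by (rule U2.inv_op_closed2[OF U1.mem_carrier[OF tpow_U1[OF that(1)]] that(2)])
  have "comm_chain G ws (m - 1) a = \<one>\<^bsub>?M\<^esub>"
  proof (rule M.character_elimination[where F = ?F and T = ?T and W = U1 and f = "(\<otimes>)" and ws = us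
        and m = m and a = a and e = "\<lambda>k. comm_chain G ws k a"])
    show "?F i w \<in> hom ?M ?M" if w: "w \<in> U1" for i w
    proof (rule homI)
      show "?F i w b \<in> carrier ?M" if "b \<in> carrier ?M" for b using Fc[OF w] that by simp
      show "?F i w (b \<otimes>\<^bsub>?M\<^esub> d) = ?F i w b \<otimes>\<^bsub>?M\<^esub> ?F i w d" if "b \<in> carrier ?M" "d \<in> carrier ?M" for b d
      proof -
        have "tpow G x w i \<in> carrier G" "b \<in> carrier G" "d \<in> carrier G"
          using that tpow_U1[OF w] by auto
        then show ?thesis by (simp add: m_assoc)
      qed
    qed
    show "?T i b \<in> carrier ?M" if "b \<in> carrier ?M" for i b
      using that U2.inv_op_closed2[of "x [^] i" b] x by simp
    show "v \<otimes> w \<in> U1" if "v \<in> U1" "w \<in> U1" for v w using that by simp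
    show "?F i (v \<otimes> w) b = ?F i v (?F i w b)" if v: "v \<in> U1" and w: "w \<in> U1" and b: "b \<in> carrier ?M" for i v w b
    proof -
      obtain n where n: "n \<in> U2" and eq: "tpow G x (v \<otimes> w) i = tpow G x v i \<otimes> tpow G x w i \<otimes> n"
        using tpow_hom_modulo[OF U1 U2 _ x v w, of i] by (auto simp: U2_def)
      have bU2: "b \<in> U2" using b by simp
      have c: "n \<in> carrier G" "b \<in> carrier G" "tpow G x v i \<in> carrier G" "tpow G x w i \<in> carrier G"
        using n bU2 tpow_U1 v w by auto
      have "n \<otimes> b \<otimes> inv n = b" using U2_commute[OF n bU2] c by (simp add: m_assoc)
      moreover have "?F i (v \<otimes> w) b
          = tpow G x v i \<otimes> (tpow G x w i \<otimes> (n \<otimes> b \<otimes> inv n) \<otimes> inv (tpow G x w i)) \<otimes> inv (tpow G x v i)"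
        unfolding eq using c by (simp add: word_simps)
      ultimately show ?thesis by simp
    qed
    show "?F i v (?F j w b) = ?F j w (?F i v b)" if "v \<in> U1" "w \<in> U1" "b \<in> carrier ?M" for i j v w b
      using U1_act_U2[OF tpow_U1 tpow_U1] that by simp
    show "?F 0 w b = b" if "w \<in> U1" "b \<in> carrier ?M" for w b using that by simp
    show "?T 0 b = b" if "b \<in> carrier ?M" for b using that by simp
    \<comment> \<open>Both \<open>g = w x\<close> and \<open>b g\<close> lie in the coset
      \<open>U0 x\<close>, so both have trivial m-th power. Comparing the two powers leaves
      \<open>tpow G g b m = \<one>\<close>: the operator \<open>1 + g + ... + g^(m-1)\<close> kills
      \<open>b\<close>.\<close>
    show "finprod ?M (\<lambda>i. ?F i w (?T i b)) {..<m} = \<one>\<^bsub>?M\<^esub>" if w: "w \<in> U1" and b: "b \<in> carrier ?M" for w b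
    proof -
      define g where "g = w \<otimes> x"
      have bU2: "b \<in> U2" and wc: "w \<in> carrier G" and bc: "b \<in> carrier G" using w b by auto
      have gc: "g \<in> carrier G" using wc x by (simp add: g_def)
      have "?F i w (?T i b) = g [^] i \<otimes> b \<otimes> inv (g [^] i)" for i
        unfolding g_def mult_pow_eq_tpow[OF x wc] using wc bc x by (simp add: word_simps)
      then have eq: "finprod ?M (\<lambda>i. ?F i w (?T i b)) {..<m} = tpow G g b m"
        using tpow_eq_finprod[OF gc bU2] by simp
      have gm: "g [^] m = \<one>" unfolding g_def by (rule pow) (use w U1_subset in blast)
      have "b \<otimes> w \<in> U0" using bU2 w U2_subset U1_subset by blast
      then have "(b \<otimes> w \<otimes> x) [^] m = \<one>" by (rule pow)
      then have "(b \<otimes> g) [^] m = \<one>" using wc bc x by (simp add: g_def m_assoc)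
      then have "tpow G g b m = \<one>" using mult_pow_eq_tpow[OF gc bc, of m] gm gc bc by simp
      then show ?thesis using eq by simp
    qed
    show "m > 0" by (rule m)
    show "us j \<in> U1" if "j \<in> {1..<m}" for j using us[OF that] .
    show "U1 \<noteq> {}" using U1.one_closed by blast
    show "a \<in> carrier ?M" using a by simp
    show "comm_chain G ws 0 a = a" by simp
    show "comm_chain G ws (Suc k) a = comm_chain G ws k a \<otimes>\<^bsub>?M\<^esub> inv\<^bsub>?M\<^esub> (?F (Suc k) (us (Suc k)) (comm_chain G ws k a))"
      if k: "Suc k < m" for k
    proof -
      define b where "b = comm_chain G ws k a"
      define t where "t = tpow G x (us (Suc k)) (Suc k)"
      have wst: "ws (Suc k) = t" using ws[of "Suc k"] k by (simp add: t_def)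
      have t: "t \<in> U1" unfolding t_def by (rule tpow_U1) (use us k in auto)
      have "ws j \<in> carrier G" if "j \<in> {1..k}" for j using wsU1[of j] that k by auto
      then have b: "b \<in> U2" unfolding b_def by (rule comm_chain_in_U2[OF a])
      have c: "b \<in> carrier G" "t \<in> carrier G" using b t by auto
      have "t \<otimes> b \<otimes> inv t \<in> U2" using U2.inv_op_closed2[OF c(2) b] .
      then have "inv\<^bsub>?M\<^esub> (t \<otimes> b \<otimes> inv t) = inv (t \<otimes> b \<otimes> inv t)"
        using m_inv_consistent[OF U2.subgroup_axioms] by simp
      moreover have "comm G b t = b \<otimes> inv (t \<otimes> b \<otimes> inv t)"
        using c by (simp add: comm_def word_simps)
      ultimately show ?thesis by (simp add: wst b_def [symmetric] t_def [symmetric] del: tpow.simps)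
    qed
  qed
  then show ?thesis by simp
qed

end

section \<open>Counting generators of the module \<open>U2\<close>\<close>

context derived_tower
begin

lemma comm_hom_U2:
  assumes w: "w \<in> carrier G" and a: "a \<in> U2" and b: "b \<in> U2"
  shows "comm G (a \<otimes> b) w = comm G a w \<otimes> comm G b w"
proof -
  have c: "a \<in> carrier G" "b \<in> carrier G" using a b by auto
  define e where "e = comm G b w"
  have e: "e \<in> U2" unfolding e_def by (rule comm_in_normal(2)[OF U2 w b])
  have f: "comm G a w \<in> U2" by (rule comm_in_normal(2)[OF U2 w a])
  have "comm G (a \<otimes> b) w = (a \<otimes> e \<otimes> inv a) \<otimes> comm G a w"
    unfolding e_def using c w by (simp add: comm_def word_simps)
  also have "a \<otimes> e \<otimes> inv a = e" using U2_commute[OF a e] c e by (simp add: m_assoc)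
  also have "e \<otimes> comm G a w = comm G a w \<otimes> e" by (rule U2_commute[OF e f])
  finally show ?thesis by (simp add: e_def)
qed

text \<open>Suppose \<open>F\<close> and the chains of length \<open>k\<close> generate
  \<open>U2\<close>. Inserting this into the groups \<open>(1 - w) U2\<close>, with \<open>w\<close>
  in \<open>Z (Suc k)\<close>, replaces these chains by chains of length \<open>Suc k\<close> and
  adds the elements \<open>(1 - w) F\<close> to \<open>Y (Suc k)\<close>. As there are at most
  \<open>n\<close> such \<open>w\<close>, each step costs a factor \<open>n + 1\<close>.\<close>

lemma comm_chain_generators:
  assumes "\<And>j. j \<in> {1..k} \<Longrightarrow> finite (Y j) \<and> Y j \<subseteq> U2 \<and> card (Y j) \<le> \<kappa> \<and>
      U2 = generate G (Y j \<union> (\<Union>w\<in>Z j. (\<lambda>a. comm G a w) ` U2))"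
    and "\<And>j. j \<in> {1..k} \<Longrightarrow> finite (Z j) \<and> Z j \<subseteq> carrier G \<and> card (Z j) \<le> n"
  shows "\<exists>F. finite F \<and> F \<subseteq> U2 \<and> card F \<le> \<kappa> * (n + 1) ^ k \<and>
    U2 \<subseteq> generate G (F \<union> {comm_chain G ws k a |ws a. a \<in> U2 \<and> (\<forall>j\<in>{1..k}. ws j \<in> Z j)})"
  using assms
proof (induction k)
  case 0
  have "U2 \<subseteq> generate G ({} \<union> {comm_chain G ws 0 a |ws a. a \<in> U2 \<and> (\<forall>j\<in>{1..0}. ws j \<in> Z j)})"
    by (auto intro!: generate.incl)
  then show ?case by (intro exI[of _ "{}"]) simp
next
  case (Suc k)
  define N where "N k = {comm_chain G ws k a |ws a. a \<in> U2 \<and> (\<forall>j\<in>{1..k}. ws j \<in> Z j)}" for k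
  obtain F where F: "finite F" "F \<subseteq> U2" "card F \<le> \<kappa> * (n + 1) ^ k" "U2 \<subseteq> generate G (F \<union> N k)"
    using Suc.IH Suc.prems unfolding N_def by auto
  let ?Y = "Y (Suc k)" and ?Z = "Z (Suc k)"
  have Y: "finite ?Y" "?Y \<subseteq> U2" "card ?Y \<le> \<kappa>"
    and U2Y: "U2 = generate G (?Y \<union> (\<Union>w\<in>?Z. (\<lambda>a. comm G a w) ` U2))"
    and Z: "finite ?Z" "?Z \<subseteq> carrier G" "card ?Z \<le> n"
    using Suc.prems(1)[of "Suc k"] Suc.prems(2)[of "Suc k"] by auto
  define F' where "F' = ?Y \<union> (\<Union>w\<in>?Z. (\<lambda>a. comm G a w) ` F)"
  have F'U2: "F' \<subseteq> U2" unfolding F'_def using Y F Z by (auto intro!: comm_in_normal(2)[OF U2])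
  have finF': "finite F'" unfolding F'_def using Y F Z by simp
  have NU2: "N k \<subseteq> U2"
  proof -
    have "ws j \<in> carrier G" if "\<forall>j\<in>{1..k}. ws j \<in> Z j" "j \<in> {1..k}" for ws :: "nat \<Rightarrow> 'a" and j
      using Suc.prems(2)[of j] that by auto
    then show ?thesis unfolding N_def by (auto intro!: comm_chain_in_U2)
  qed
  have NSuc: "(\<lambda>a. comm G a w) ` N k \<subseteq> N (Suc k)" if w: "w \<in> ?Z" for w
  proof
    fix b assume "b \<in> (\<lambda>a. comm G a w) ` N k"
    then obtain ws a where a: "a \<in> U2" "\<forall>j\<in>{1..k}. ws j \<in> Z j" and b: "b = comm G (comm_chain G ws k a) w"
      unfolding N_def by auto
    \<comment> \<open>A chain of length \<open>k\<close> does not read slot \<open>Suc k\<close>, so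
      filling this slot lengthens the chain and leaves its beginning as it was.\<close>
    define ws' where "ws' = ws(Suc k := w)"
    have same: "comm_chain G ws' i a = comm_chain G ws i a" if "i \<le> k" for i
      using that by (induction i) (auto simp: ws'_def)
    have "b = comm_chain G ws' (Suc k) a" using same[of k] b by (simp add: ws'_def)
    moreover have "\<forall>j\<in>{1..Suc k}. ws' j \<in> Z j" using a(2) w by (auto simp: ws'_def le_Suc_eq)
    ultimately show "b \<in> N (Suc k)" unfolding N_def using a(1) by blast
  qed
  let ?H = "generate G (F' \<union> N (Suc k))"
  have NSU2: "N (Suc k) \<subseteq> U2"
  proof -
    have "ws j \<in> carrier G" if "\<forall>j\<in>{1..Suc k}. ws j \<in> Z j" "j \<in> {1..Suc k}" for ws :: "nat \<Rightarrow> 'a" and j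
      using Suc.prems(2)[of j] that by auto
    then show ?thesis unfolding N_def by (auto intro!: comm_chain_in_U2 simp del: comm_chain.simps)
  qed
  have Hc: "F' \<union> N (Suc k) \<subseteq> carrier G" using F'U2 NSU2 U2.subset by blast
  have H: "subgroup ?H G" by (rule generate_is_subgroup[OF Hc])
  have "(\<lambda>a. comm G a w) ` U2 \<subseteq> ?H" if w: "w \<in> ?Z" for w
  proof -
    let ?d = "\<lambda>a. comm G a w"
    have wc: "w \<in> carrier G" using w Z by auto
    have "?d ` U2 \<subseteq> ?d ` generate G (F \<union> N k)" using F(4) by (rule image_mono)
    also have "\<dots> \<subseteq> generate G (?d ` (F \<union> N k) \<union> {\<one>})"
    proof (rule generate_image_modulo[OF one_is_normal U2.subgroup_axioms])
      show "F \<union> N k \<subseteq> U2" using F NU2 by blast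
      show "?d a \<in> carrier G" if "a \<in> U2" for a using that wc by simp
      show "\<exists>m\<in>{\<one>}. ?d (a \<otimes> b) = ?d a \<otimes> ?d b \<otimes> m" if "a \<in> U2" "b \<in> U2" for a b
        using comm_hom_U2[OF wc that] that wc by simp
    qed
    also have "\<dots> \<subseteq> ?H"
    proof (rule generate_subgroup_incl[OF _ H])
      have "?d ` F \<subseteq> F'" unfolding F'_def using w by blast
      then have "?d ` (F \<union> N k) \<subseteq> F' \<union> N (Suc k)" using NSuc[OF w] by blast
      moreover have "F' \<union> N (Suc k) \<subseteq> ?H" by (auto intro: generate.incl)
      ultimately show "?d ` (F \<union> N k) \<union> {\<one>} \<subseteq> ?H" using subgroup.one_closed[OF H] by blast
    qed
    finally show ?thesis .
  qed
  moreover have "?Y \<subseteq> ?H" unfolding F'_def by (auto intro: generate.incl)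
  ultimately have "generate G (?Y \<union> (\<Union>w\<in>?Z. (\<lambda>a. comm G a w) ` U2)) \<subseteq> ?H"
    by (intro generate_subgroup_incl[OF _ H]) blast
  then have "U2 \<subseteq> ?H" using U2Y by simp
  moreover have "card F' \<le> \<kappa> * (n + 1) ^ Suc k"
  proof -
    have "card (\<Union>w\<in>?Z. (\<lambda>a. comm G a w) ` F) \<le> (\<Sum>w\<in>?Z. card ((\<lambda>a. comm G a w) ` F))"
      by (rule card_UN_le[OF Z(1)])
    also have "\<dots> \<le> (\<Sum>w\<in>?Z. card F)" by (rule sum_mono) (rule card_image_le[OF F(1)])
    also have "\<dots> \<le> n * card F" using Z(3) by simp
    also have "\<dots> \<le> n * (\<kappa> * (n + 1) ^ k)" by (rule mult_le_mono2[OF F(3)])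
    finally have "card F' \<le> \<kappa> + n * (\<kappa> * (n + 1) ^ k)"
      unfolding F'_def using card_Un_le[of ?Y "\<Union>w\<in>?Z. (\<lambda>a. comm G a w) ` F"] Y(3) by linarith
    also have "\<dots> \<le> \<kappa> * (n + 1) ^ k + n * (\<kappa> * (n + 1) ^ k)" by simp
    also have "\<dots> = \<kappa> * (n + 1) ^ Suc k" by (simp add: algebra_simps)
    finally show ?thesis .
  qed
  ultimately show ?case using F'U2 finF' unfolding N_def by (intro exI[of _ F']) (simp del: comm_chain.simps)
qed

text \<open>\<open>U2\<close> is generated by the \<open>U1\<close>-conjugates of the commutators of generators of \<open>U1\<close>; modulo \<open>D\<close>
  only the conjugates by representatives of the cosets of \<open>R\<close> matter.\<close>

lemma coinvariants_generators:
  assumes E: "finite E" "E \<subseteq> carrier G" "generate G E = U1"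
    and R: "subgroup R G" "R \<subseteq> U1"
    and D: "subgroup D G" "D \<subseteq> U2" "\<And>u \<delta>. u \<in> U1 \<Longrightarrow> \<delta> \<in> D \<Longrightarrow> u \<otimes> \<delta> \<otimes> inv u \<in> D"
    and RD: "\<And>q \<mu>. q \<in> R \<Longrightarrow> \<mu> \<in> U2 \<Longrightarrow> comm G q \<mu> \<in> D"
  shows "\<exists>Y. finite Y \<and> card Y \<le> card (rcosets R) * (card E)^2 \<and> Y \<subseteq> U2 \<and> U2 = generate G (Y \<union> D)"
proof -
  let ?cos = "\<lambda>u. R #> u"
  have Rc: "R \<subseteq> carrier G" using subgroup.subset[OF R(1)] .
  have fin_cos: "finite (rcosets R)"
    using finite_subset[OF rcosets_subset_PowG[OF R(1)]] fin by simp
  \<comment> \<open>The representatives are taken in \<open>U1\<close>, but their number is bounded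
    by the index of \<open>R\<close> in all of \<open>G\<close>, which is the quantity to be
    compared with the index of \<open>U2\<close>.\<close>
  obtain L where L: "L \<subseteq> U1" "inj_on ?cos L" "?cos ` U1 = ?cos ` L"
    using subset_image_inj[of "?cos ` U1" ?cos U1] by auto
  have Lr: "?cos ` L \<subseteq> rcosets R" unfolding RCOSETS_def using L(1) U1.subset by blast
  have finL: "finite L" using finite_subset[OF L(1)] finite_subset[OF U1.subset fin] by blast
  have cardL: "card L \<le> card (rcosets R)" by (rule card_inj_on_le[OF L(2) Lr fin_cos])
  have rep: "\<exists>q\<in>R. \<exists>r\<in>L. u = q \<otimes> r" if u: "u \<in> U1" for u
  proof -
    obtain r where r: "r \<in> L" "?cos u = ?cos r" using L(3) u by blast
    have "u \<in> ?cos r" using rcos_self[OF _ R(1), of u] u r(2) by simp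
    then show ?thesis using r(1) by (auto simp: r_coset_def)
  qed
  define f where "f = (\<lambda>(r, e, e'). inv r \<otimes> comm G e e' \<otimes> r)"
  define Y where "Y = f ` (L \<times> E \<times> E)"
  have finY: "finite Y" unfolding Y_def using finL E(1) by simp
  have "card Y \<le> card (L \<times> E \<times> E)" unfolding Y_def by (rule card_image_le) (use finL E(1) in simp)
  also have "\<dots> \<le> card (rcosets R) * (card E)^2"
    using cardL by (simp add: card_cartesian_product power2_eq_square)
  finally have cardY: "card Y \<le> card (rcosets R) * (card E)^2" .
  have EU1: "e \<in> U1" if "e \<in> E" for e using generate.incl[OF that, of G] E(3) by simp
  have c: "comm G e e' \<in> U2" if "e \<in> E" "e' \<in> E" for e e'
    unfolding U2_def using EU1 that by (intro comm_in_derived) auto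
  have YU2: "Y \<subseteq> U2"
    unfolding Y_def f_def using c L(1) U1.subset by (auto intro!: U2.inv_op_closed1)
  have YDU2: "Y \<union> D \<subseteq> U2" using YU2 D(2) by blast
  then have YDc: "Y \<union> D \<subseteq> carrier G" using U2.subset by blast
  let ?D = "generate G (Y \<union> D)"
  interpret D': subgroup ?D G by (rule generate_is_subgroup[OF YDc])
  have DD: "D \<subseteq> ?D" "Y \<subseteq> ?D" using generate.incl[of _ "Y \<union> D" G] by auto
  have norm: "u \<otimes> \<delta> \<otimes> inv u \<in> ?D" if u: "u \<in> U1" and \<delta>: "\<delta> \<in> ?D" for u \<delta>
  proof -
    let ?h = "\<lambda>b. u \<otimes> b \<otimes> inv u"
    have uc: "u \<in> carrier G" using u by simp
    have "?h ` ?D \<subseteq> generate G (?h ` (Y \<union> D) \<union> {\<one>})"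
      by (rule generate_image_modulo[OF one_is_normal subgroup_self YDc]) (use uc in \<open>simp_all add: m_assoc\<close>)
    also have "\<dots> \<subseteq> ?D"
    proof (rule generate_subgroup_incl[OF _ D'.subgroup_axioms])
      have "?h y \<in> ?D" if "y \<in> Y" for y
      proof -
        obtain r e e' where y: "r \<in> L" "e \<in> E" "e' \<in> E" "y = inv r \<otimes> comm G e e' \<otimes> r"
          using \<open>y \<in> Y\<close> unfolding Y_def f_def by auto
        define k where "k = comm G e e'"
        have kU2: "k \<in> U2" unfolding k_def by (rule c[OF y(2,3)])
        have rU1: "r \<in> U1" using y(1) L(1) by blast
        then have "r \<otimes> inv u \<in> U1" using u by simp
        \<comment> \<open>Conjugation by \<open>u\<close> turns the representative \<open>r\<close>
          into \<open>r u^-1 = q t\<close>. As \<open>q\<close> acts trivially modulo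
          \<open>D\<close>, what remains is conjugation by the representative \<open>t\<close>, and
          the result is in \<open>Y\<close> again.\<close>
        then obtain q t where q: "q \<in> R" and t: "t \<in> L" and qt: "r \<otimes> inv u = q \<otimes> t" using rep by blast
        have tU1: "t \<in> U1" using t L(1) by blast
        have cc: "r \<in> carrier G" "q \<in> carrier G" "t \<in> carrier G" "k \<in> carrier G"
          using rU1 tU1 q Rc kU2 by auto
        have \<delta>: "comm G (inv q) k \<in> D" by (rule RD[OF subgroup.m_inv_closed[OF R(1) q] kU2])
        have "?h y = inv (r \<otimes> inv u) \<otimes> k \<otimes> (r \<otimes> inv u)"
          unfolding y(4) k_def [symmetric] using cc uc by (simp add: word_simps)
        also have "\<dots> = (inv t \<otimes> comm G (inv q) k \<otimes> inv (inv t)) \<otimes> (inv t \<otimes> k \<otimes> t)"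
          unfolding qt comm_def using cc by (simp add: word_simps)
        finally have "?h y = (inv t \<otimes> comm G (inv q) k \<otimes> inv (inv t)) \<otimes> (inv t \<otimes> k \<otimes> t)" .
        moreover have "inv t \<otimes> comm G (inv q) k \<otimes> inv (inv t) \<in> ?D"
          using D(3)[OF U1.m_inv_closed[OF tU1] \<delta>] DD(1) by blast
        moreover have "inv t \<otimes> k \<otimes> t \<in> Y" unfolding Y_def f_def k_def using t y(2,3) by force
        ultimately show ?thesis using DD(2) D'.m_closed by (metis subsetD)
      qed
      moreover have "?h b \<in> ?D" if "b \<in> D" for b using D(3)[OF u that] DD(1) by blast
      ultimately show "?h ` (Y \<union> D) \<union> {\<one>} \<subseteq> ?D" using D'.one_closed by auto
    qed
    finally show ?thesis using \<delta> by blast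
  qed
  have "derived G (generate G E) \<subseteq> ?D"
  proof (rule derived_generate_subset[OF E(2) D'.subgroup_axioms])
    show "u \<otimes> \<delta> \<otimes> inv u \<in> ?D" if "u \<in> generate G E" "\<delta> \<in> ?D" for u \<delta>
      using norm that E(3) by simp
    show "comm G e e' \<in> ?D" if e: "e \<in> E" "e' \<in> E" for e e'
    proof -
      \<comment> \<open>Since \<open>\<one>\<close> need not be among the representatives,
        \<open>[e, e']\<close> is recovered from one of its conjugates in \<open>Y\<close>.\<close>
      obtain r where r: "r \<in> L" using L(3) U1.one_closed by blast
      then have rU1: "r \<in> U1" using L(1) by blast
      have "inv r \<otimes> comm G e e' \<otimes> r \<in> Y" unfolding Y_def f_def using r e by force
      then have "r \<otimes> (inv r \<otimes> comm G e e' \<otimes> r) \<otimes> inv r \<in> ?D" using norm[OF rU1] DD(2) by blast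
      then show ?thesis using rU1 c[OF e] by (simp add: m_assoc)
    qed
  qed
  then have "U2 = ?D"
    using generate_subgroup_incl[OF YDU2 U2.subgroup_axioms] E(3) by (auto simp: U2_def)
  then show ?thesis using finY cardY YU2 by blast
qed

lemma index_Q:
  assumes "2 ^ s * card U2 \<le> card (Q r)"
  shows "card (rcosets (Q r)) * 2 ^ s \<le> card (rcosets U2)"
proof -
  have 1: "card (rcosets (Q r)) * card (Q r) = order G" by (rule lagrange[OF Q_subgroup])
  have 2: "card (rcosets U2) * card U2 = order G" by (rule lagrange[OF U2.subgroup_axioms])
  have pos: "card U2 > 0"
    using U2.one_closed fin U2.subset by (metis card_gt_0_iff empty_iff finite_subset)
  have "card (rcosets (Q r)) * 2 ^ s * card U2 \<le> card (rcosets (Q r)) * card (Q r)"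
    using assms by (simp add: mult.assoc)
  also have "\<dots> = card (rcosets U2) * card U2" using 1 2 by simp
  finally show ?thesis using pos by simp
qed

text \<open>The number \<open>s\<close> mediates between the inequalities. One \<open>Q r\<close> is
  generated over \<open>U2\<close> by \<open>s\<close> elements, which bounds the rank of
  \<open>U1/U2\<close> from above; and every \<open>Q j\<close> has index at most
  \<open>h / 2^s\<close>, which bounds the rank of \<open>U2\<close>. The assumptions
  \<open>R1\<close> and \<open>R2\<close> supply the lower bounds.\<close>

lemma rank_inequalities:
  assumes S: "finite S" "S \<subseteq> carrier G" "generate G S = carrier G" "card S \<le> d"
    and m: "1 < m" and pow: "\<And>z. z \<in> U0 \<Longrightarrow> (z \<otimes> x) [^] m = \<one>"
    and conj: "\<And>r. 0 < r \<Longrightarrow> r < m \<Longrightarrow> \<exists>gs. finite gs \<and> gs \<subseteq> carrier G \<and> card gs \<le> l \<and>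
        U0 \<subseteq> generate G ((\<lambda>g. g \<otimes> x [^] r \<otimes> inv g) ` gs)"
    and R1: "\<And>Z. finite Z \<Longrightarrow> Z \<subseteq> U1 \<Longrightarrow> U1 = generate G (Z \<union> U2) \<Longrightarrow> c * real (card (rcosets U1)) \<le> real (card Z)"
    and R2: "\<And>Z. finite Z \<Longrightarrow> Z \<subseteq> U2 \<Longrightarrow> U2 = generate G Z \<Longrightarrow> c * real (card (rcosets U2)) \<le> real (card Z)"
  defines "a \<equiv> card (rcosets U0)" and "b \<equiv> card (rcosets U1)" and "h \<equiv> card (rcosets U2)"
  shows "\<exists>s. c * real b \<le> real (d * a)^2 + real l * real s \<and>
    c * 2 ^ s \<le> real (d * b)^2 * (real (d * b) + 1) ^ (m - 1)"
proof -
  have finr: "finite (rcosets H)" if "subgroup H G" for H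
    using finite_subset[OF rcosets_subset_PowG[OF that]] fin by simp
  obtain V where V: "finite V" "V \<subseteq> U0" "generate G V = U0" "card V \<le> a * card S"
    using schreier_generators[OF S(1-3) U0.subgroup_axioms finr[OF U0.subgroup_axioms]] unfolding a_def by blast
  have Vd: "card V \<le> d * a" using le_trans[OF V(4) mult_le_mono2[OF S(4)]] by (simp only: mult.commute)
  have Vc: "V \<subseteq> carrier G" using V(2) U0.subset by blast
  obtain E1 where E1: "finite E1" "E1 \<subseteq> U1" "generate G E1 = U1" "card E1 \<le> b * card S"
    using schreier_generators[OF S(1-3) U1.subgroup_axioms finr[OF U1.subgroup_axioms]] unfolding b_def by blast
  define n where "n = d * b"
  have E1n: "card E1 \<le> n" unfolding n_def using le_trans[OF E1(4) mult_le_mono2[OF S(4)]] by (simp only: mult.commute)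
  have "\<exists>Y. finite Y \<and> Y \<subseteq> Q r \<and> Q r = generate G (Y \<union> U2) \<and> 2 ^ card Y * card U2 \<le> card (Q r)" for r
    by (rule small_generating_set_over[OF U2.subgroup_axioms Q_subgroup U2_subset_Q])
      (rule finite_subset[OF subgroup.subset[OF Q_subgroup] fin])
  then obtain Y where Y: "\<And>r. finite (Y r)" "\<And>r. Y r \<subseteq> Q r" "\<And>r. Q r = generate G (Y r \<union> U2)"
    "\<And>r. 2 ^ card (Y r) * card U2 \<le> card (Q r)" by metis
  define s where "s = Min ((\<lambda>r. card (Y r)) ` {1..<m})"
  have s_le: "s \<le> card (Y r)" if "r \<in> {1..<m}" for r
    unfolding s_def using that by (intro Min_le) auto
  have "s \<in> (\<lambda>r. card (Y r)) ` {1..<m}" unfolding s_def using m by (intro Min_in) auto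
  then obtain r where r: "r \<in> {1..<m}" "s = card (Y r)" by auto
  obtain gs where gs: "finite gs" "gs \<subseteq> carrier G" "card gs \<le> l"
    "U0 \<subseteq> generate G ((\<lambda>g. g \<otimes> x [^] r \<otimes> inv g) ` gs)"
    using conj[of r] r by auto
  obtain Z1 where Z1: "finite Z1" "Z1 \<subseteq> U1" "U1 = generate G (Z1 \<union> U2)"
    "card Z1 \<le> card V * card V + card gs * card (Y r)"
    using rank_U1_bound[OF gs(1,2,4) V(1) Vc V(3) Y(1-3)] by blast
  have "card Z1 \<le> (d * a)^2 + l * s"
    unfolding r(2) power2_eq_square
    by (rule le_trans[OF Z1(4) add_le_mono[OF mult_le_mono[OF Vd Vd] mult_le_mono1[OF gs(3)]]])
  then have "real (card Z1) \<le> real ((d * a)^2 + l * s)" by (rule of_nat_mono)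
  then have ineq1: "c * real b \<le> real (d * a)^2 + real l * real s"
    using R1[OF Z1(1-3)] unfolding b_def by simp
  define Z where "Z j = (\<lambda>u. tpow G x u j) ` E1" for j
  have Z: "finite (Z j)" "Z j \<subseteq> U1" "card (Z j) \<le> n" for j
  proof -
    show "finite (Z j)" unfolding Z_def using E1 by simp
    show "Z j \<subseteq> U1" unfolding Z_def using tpow_U1 E1(2) by blast
    show "card (Z j) \<le> n" unfolding Z_def using card_image_le[OF E1(1)] E1n order_trans by blast
  qed
  have Zc: "Z j \<subseteq> carrier G" for j using Z(2) U1.subset by blast
  have QZ: "Q j = generate G (Z j \<union> U2)" for j
  proof
    have "(\<lambda>u. tpow G x u j) ` generate G E1 \<subseteq> generate G (Z j \<union> U2)"
      unfolding Z_def
    proof (rule generate_image_modulo[OF U2 U1.subgroup_axioms E1(2)])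
      show "tpow G x u j \<in> carrier G" if "u \<in> U1" for u using tpow_U1[OF that] by simp
      show "\<exists>n\<in>U2. tpow G x (u \<otimes> v) j = tpow G x u j \<otimes> tpow G x v j \<otimes> n" if "u \<in> U1" "v \<in> U1" for u v
        by (rule tpow_hom_modulo[OF U1 U2 _ x that]) (simp add: U2_def)
    qed
    moreover have "U2 \<subseteq> generate G (Z j \<union> U2)" by (auto intro: generate.incl)
    moreover have "subgroup (generate G (Z j \<union> U2)) G"
      by (rule generate_is_subgroup) (use Zc U2.subset in blast)
    ultimately show "Q j \<subseteq> generate G (Z j \<union> U2)"
      unfolding Q_def using E1(3) by (intro generate_subgroup_incl) auto
    show "generate G (Z j \<union> U2) \<subseteq> Q j"
      by (rule generate_subgroup_incl[OF _ Q_subgroup])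
        (use tpow_in_Q E1(2) U2_subset_Q in \<open>auto simp: Z_def\<close>)
  qed
  \<comment> \<open>The index of \<open>Q j\<close>, an integer at most \<open>h / 2^s\<close>,
    times the number of pairs from the at most \<open>n\<close> generators of
    \<open>U1\<close>.\<close>
  define \<kappa> where "\<kappa> = h div 2 ^ s * n^2"
  have coinv: "\<exists>F. finite F \<and> F \<subseteq> U2 \<and> card F \<le> \<kappa> \<and>
      U2 = generate G (F \<union> (\<Union>w\<in>Z j. (\<lambda>a. comm G a w) ` U2))" if j: "j \<in> {1..<m}" for j
  proof -
    let ?B = "\<Union>w\<in>Z j. (\<lambda>a. comm G a w) ` U2"
    let ?D = "generate G ?B"
    have BU2: "?B \<subseteq> U2" using comm_in_normal(2)[OF U2] Zc by blast
    have D: "subgroup ?D G" by (rule generate_is_subgroup) (use BU2 U2.subset in blast)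
    have DU2: "?D \<subseteq> U2" by (rule generate_subgroup_incl[OF BU2 U2.subgroup_axioms])
    let ?T = "{h \<in> carrier G. \<forall>u\<in>U2. comm G h u \<in> ?D}"
    have T: "subgroup ?T G" by (rule act_trivially_subgroup[OF U2 D])
    have "Z j \<union> U2 \<subseteq> ?T"
    proof -
      have "comm G w u \<in> ?D" if "w \<in> Z j" "u \<in> U2" for w u
      proof -
        have "comm G u w \<in> ?B" using that by blast
        then have "comm G u w \<in> ?D" by (rule generate.incl)
        then have "inv (comm G u w) \<in> ?D" by (rule subgroup.m_inv_closed[OF D])
        moreover have "inv (comm G u w) = comm G w u"
          by (rule inv_comm_swap) (use that Zc in auto)
        ultimately show ?thesis by simp
      qed
      moreover have "comm G w u \<in> ?D" if "w \<in> U2" "u \<in> U2" for w u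
        using comm_U2[OF that] subgroup.one_closed[OF D] by simp
      ultimately show ?thesis using Zc U2.subset by blast
    qed
    then have QT: "Q j \<subseteq> ?T" unfolding QZ by (rule generate_subgroup_incl[OF _ T])
    have conj: "u \<otimes> \<delta> \<otimes> inv u \<in> ?D" if u: "u \<in> U1" and \<delta>: "\<delta> \<in> ?D" for u \<delta>
    proof -
      let ?h = "\<lambda>b. u \<otimes> b \<otimes> inv u"
      have uc: "u \<in> carrier G" using u by simp
      have Bc: "?B \<subseteq> carrier G" using BU2 U2.subset by blast
      have "?h ` ?D \<subseteq> generate G (?h ` ?B \<union> {\<one>})"
        by (rule generate_image_modulo[OF one_is_normal subgroup_self Bc]) (use uc in \<open>simp_all add: m_assoc\<close>)
      also have "\<dots> \<subseteq> ?D"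
      proof (rule generate_subgroup_incl[OF _ D])
        have "?h (comm G a w) \<in> ?D" if a: "a \<in> U2" and w: "w \<in> Z j" for a w
        proof -
          have wU1: "w \<in> U1" and wQ: "w \<in> Q j" using w Z(2) QZ[of j] by (auto intro: generate.incl)
          have cc: "a \<in> carrier G" "w \<in> carrier G" using a wU1 by auto
          \<comment> \<open>Since \<open>U1/U2\<close> is abelian and \<open>U2\<close> lies in
            \<open>Q j\<close>, conjugation by \<open>u\<close> keeps \<open>w\<close> inside
            \<open>Q j\<close>. This makes \<open>?D\<close> stable under \<open>U1\<close>.\<close>
          have "comm G u w \<in> Q j"
            using comm_in_derived[OF u wU1] U2_subset_Q by (auto simp: U2_def)
          then have "comm G u w \<otimes> w \<in> Q j" using wQ by (rule subgroup.m_closed[OF Q_subgroup])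
          then have "?h w \<in> Q j" using comm_mult[OF uc cc(2)] by simp
          then have "comm G (?h w) (?h a) \<in> ?D" using QT U2.inv_op_closed2[OF uc a] by blast
          then have "inv (comm G (?h w) (?h a)) \<in> ?D" by (rule subgroup.m_inv_closed[OF D])
          moreover have "inv (comm G (?h w) (?h a)) = ?h (comm G a w)"
            using uc cc by (simp add: comm_def word_simps)
          ultimately show ?thesis by simp
        qed
        then have "?h ` ?B \<subseteq> ?D" by blast
        then show "?h ` ?B \<union> {\<one>} \<subseteq> ?D" using subgroup.one_closed[OF D] by simp
      qed
      finally show ?thesis using \<delta> by blast
    qed
    have E1c: "E1 \<subseteq> carrier G" using E1(2) U1.subset by blast
    have QD: "comm G q \<mu> \<in> ?D" if "q \<in> Q j" "\<mu> \<in> U2" for q \<mu> using QT that by blast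
    obtain F where F: "finite F" "card F \<le> card (rcosets (Q j)) * (card E1)^2" "F \<subseteq> U2"
        "U2 = generate G (F \<union> ?D)"
      using coinvariants_generators[OF E1(1) E1c E1(3) Q_subgroup Q_subset D DU2 conj QD] by blast
    have "generate G (?D \<union> F) = generate G (?B \<union> F)"
      by (rule generate_union_subgroup) (use BU2 F(3) U2.subset in blast)+
    then have U2F: "U2 = generate G (F \<union> ?B)" using F(4) by (simp add: Un_commute)
    have "card (rcosets (Q j)) * 2 ^ s \<le> h"
    proof -
      have "(2::nat) ^ s \<le> 2 ^ card (Y j)" using s_le[OF j] by (intro power_increasing) auto
      then have "card (rcosets (Q j)) * 2 ^ s \<le> card (rcosets (Q j)) * 2 ^ card (Y j)" by simp
      also have "\<dots> \<le> h" unfolding h_def by (rule index_Q[OF Y(4)])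
      finally show ?thesis .
    qed
    then have "card (rcosets (Q j)) \<le> h div 2 ^ s" by (simp add: less_eq_div_iff_mult_less_eq)
    then have "card F \<le> \<kappa>"
      unfolding \<kappa>_def using F(2) E1n by (meson le_trans mult_le_mono power_mono zero_le)
    then show ?thesis using F(1,3) U2F by blast
  qed
  then have "\<forall>j. \<exists>F. j \<in> {1..<m} \<longrightarrow> finite F \<and> F \<subseteq> U2 \<and> card F \<le> \<kappa> \<and>
      U2 = generate G (F \<union> (\<Union>w\<in>Z j. (\<lambda>a. comm G a w) ` U2))" by blast
  then obtain Y2 where Y2: "\<And>j. j \<in> {1..<m} \<Longrightarrow> finite (Y2 j) \<and> Y2 j \<subseteq> U2 \<and> card (Y2 j) \<le> \<kappa> \<and>
      U2 = generate G (Y2 j \<union> (\<Union>w\<in>Z j. (\<lambda>a. comm G a w) ` U2))"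
    by (elim choice[elim_format] exE) blast
  let ?N = "{comm_chain G ws (m - 1) a |ws a. a \<in> U2 \<and> (\<forall>j\<in>{1..m - 1}. ws j \<in> Z j)}"
  have "\<exists>F. finite F \<and> F \<subseteq> U2 \<and> card F \<le> \<kappa> * (n + 1) ^ (m - 1) \<and> U2 \<subseteq> generate G (F \<union> ?N)"
  proof (rule comm_chain_generators)
    show "finite (Y2 j) \<and> Y2 j \<subseteq> U2 \<and> card (Y2 j) \<le> \<kappa> \<and>
      U2 = generate G (Y2 j \<union> (\<Union>w\<in>Z j. (\<lambda>a. comm G a w) ` U2))" if "j \<in> {1..m - 1}" for j
      by (rule Y2) (use that m in auto)
    show "finite (Z j) \<and> Z j \<subseteq> carrier G \<and> card (Z j) \<le> n" for j
      using Z Zc by blast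
  qed
  then obtain F where F: "finite F" "F \<subseteq> U2" "card F \<le> \<kappa> * (n + 1) ^ (m - 1)" "U2 \<subseteq> generate G (F \<union> ?N)"
    by blast
  \<comment> \<open>The entries in slot \<open>j\<close> are values of \<open>tpow\<close> at
    exponent \<open>j\<close>, so the torsion law kills every chain and \<open>F\<close> alone
    generates \<open>U2\<close>.\<close>
  have Nsub: "?N \<subseteq> {\<one>}"
  proof -
    have "comm_chain G ws (m - 1) a = \<one>" if a: "a \<in> U2" and ws: "\<forall>j\<in>{1..m - 1}. ws j \<in> Z j" for ws a
    proof -
      have "\<forall>j\<in>{1..<m}. \<exists>u. u \<in> U1 \<and> ws j = tpow G x u j"
      proof
        fix j assume "j \<in> {1..<m}"
        then have "j \<in> {1..m - 1}" by auto
        then have "ws j \<in> Z j" by (rule bspec[OF ws])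
        then obtain u where "u \<in> E1" "ws j = tpow G x u j" unfolding Z_def by (rule imageE)
        then show "\<exists>u. u \<in> U1 \<and> ws j = tpow G x u j" using E1(2) by (meson subsetD)
      qed
      then obtain us where us: "\<forall>j\<in>{1..<m}. us j \<in> U1 \<and> ws j = tpow G x (us j) j"
        by (rule bchoice[elim_format]) blast
      show ?thesis
        by (rule comm_chain_trivial[where us = us]) (use pow m us a in auto)
    qed
    then show ?thesis by blast
  qed
  have gF: "subgroup (generate G F) G" by (rule generate_is_subgroup) (use F(2) U2.subset in blast)
  have "?N \<subseteq> generate G F"
    by (rule subset_trans[OF Nsub]) (simp add: subgroup.one_closed[OF gF])
  moreover have "F \<subseteq> generate G F" by (rule subsetI) (rule generate.incl)
  ultimately have "F \<union> ?N \<subseteq> generate G F" by (rule Un_least[rotated])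
  then have "generate G (F \<union> ?N) \<subseteq> generate G F" by (rule generate_subgroup_incl[OF _ gF])
  with F(4) have "U2 \<subseteq> generate G F" by (rule subset_trans)
  then have "U2 = generate G F"
    using generate_subgroup_incl[OF F(2) U2.subgroup_axioms] by (rule subset_antisym)
  then have "c * real h \<le> real (card F)" unfolding h_def by (rule R2[OF F(1,2)])
  also have "\<dots> \<le> real (\<kappa> * (n + 1) ^ (m - 1))" by (rule of_nat_mono[OF F(3)])
  also have "\<dots> = real (h div 2 ^ s) * (real n ^ 2 * (real n + 1) ^ (m - 1))"
    by (simp add: \<kappa>_def add.commute)
  also have "\<dots> \<le> real h / 2 ^ s * (real n ^ 2 * (real n + 1) ^ (m - 1))"
    using of_nat_div_le_of_nat[of h "2 ^ s", where ?'a = real] by (intro mult_right_mono) simp_all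
  finally have "real h * (c * 2 ^ s) \<le> real h * (real n ^ 2 * (real n + 1) ^ (m - 1))"
    by (simp add: field_simps)
  \<comment> \<open>The index \<open>h\<close> occurs linearly on both sides and cancels, so the
    final inequality involves \<open>b\<close> alone.\<close>
  moreover have "0 < h"
    unfolding h_def using lagrange[OF U2.subgroup_axioms] fin order_gt_0_iff_finite by (metis mult_0 neq0_conv)
  ultimately have "c * 2 ^ s \<le> real n ^ 2 * (real n + 1) ^ (m - 1)" by simp
  then show ?thesis using ineq1 unfolding n_def by blast
qed

end

section \<open>Growth of the indices\<close>

text \<open>For positive \<open>k\<close> the sequence is the k-th power of \<open>n r^n\<close>,
  where \<open>r\<close> is the k-th root of \<open>q\<close>.\<close>

lemma power_times_geometric_tendsto_0:
  fixes q :: real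
  assumes q: "0 < q" "q < 1"
  shows "(\<lambda>n. real n ^ k * q ^ n) \<longlonglongrightarrow> 0"
proof (cases "k = 0")
  case True
  then show ?thesis using q by (simp add: LIMSEQ_realpow_zero)
next
  case False
  define r where "r = root k q"
  have r: "0 < r" "r < 1" "r ^ k = q" using q False by (simp_all add: r_def)
  have "(\<lambda>n. of_nat n * r ^ n) \<longlonglongrightarrow> 0" by (rule powser_times_n_limit_0) (use r in simp)
  then have "(\<lambda>n. (real n * r ^ n) ^ k) \<longlonglongrightarrow> 0 ^ k" using tendsto_power by fastforce
  moreover have "(\<lambda>n. (real n * r ^ n) ^ k) = (\<lambda>n. real n ^ k * q ^ n)"
    using r(3) by (metis power_commutes power_mult power_mult_distrib mult.commute)
  moreover have "0 ^ k = (0::real)" using False by (simp add: zero_power)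
  ultimately show ?thesis by simp
qed

text \<open>Two exponentials in a row: \<open>b\<close> is at least \<open>2^(c a)\<close>, so
  \<open>(d a)^2\<close> uses up at most half of \<open>c b\<close>; the other half forces
  \<open>s\<close> to be at least \<open>e b\<close>, and \<open>2^s\<close> then outgrows the
  polynomial in \<open>b\<close>. As \<open>K\<close> depends on \<open>c\<close>, \<open>d\<close>,
  \<open>l\<close>, \<open>m\<close> only, it can be fixed before the subgroups.\<close>

lemma rank_inequalities_contradictory:
  fixes c :: real and d l m :: nat
  assumes c: "c > 0"
  shows "\<exists>K. \<forall>a b s y :: nat. K \<le> a \<longrightarrow> c * real a \<le> real y \<longrightarrow> 2 ^ y * a \<le> b \<longrightarrow>
     c * real b \<le> real (d * a)^2 + real l * real s \<longrightarrow>
     \<not> c * 2 ^ s \<le> real (d * b)^2 * (real (d * b) + 1) ^ m"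
proof -
  \<comment> \<open>Half of \<open>c\<close> is reserved for absorbing \<open>(d a)^2\<close>;
    \<open>l + 1\<close> in place of \<open>l\<close> keeps the denominator positive.\<close>
  define e where "e = c / (2 * real (l + 1))"
  define q where "q = 2 powr (- e)"
  have e: "0 < e" using c by (simp add: e_def)
  have q: "0 < q" "q < 1" using e by (simp_all add: q_def powr_less_one)
  \<comment> \<open>For \<open>b \<ge> 1\<close> the right-hand side of the last inequality is at
    most \<open>C b^(m + 2)\<close>.\<close>
  define C where "C = real d ^ 2 * (real d + 1) ^ m"
  have "(\<lambda>n. C * (real n ^ (m + 2) * q ^ n)) \<longlonglongrightarrow> C * 0"
    by (intro tendsto_mult tendsto_const power_times_geometric_tendsto_0 q)
  then have "(\<lambda>n. C * (real n ^ (m + 2) * q ^ n)) \<longlonglongrightarrow> 0" by simp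
  then have "eventually (\<lambda>n. C * (real n ^ (m + 2) * q ^ n) < c) sequentially"
    using c by (rule order_tendstoD(2))
  then obtain K1 where K1: "\<And>n. K1 \<le> n \<Longrightarrow> C * (real n ^ (m + 2) * q ^ n) < c"
    by (auto simp: eventually_sequentially)
  define p where "p = 2 powr (- c)"
  have p: "0 < p" "p < 1" using c by (simp_all add: p_def powr_less_one)
  have "(\<lambda>n. real d ^ 2 * (real n ^ 2 * p ^ n)) \<longlonglongrightarrow> real d ^ 2 * 0"
    by (intro tendsto_mult tendsto_const power_times_geometric_tendsto_0 p)
  then have "(\<lambda>n. real d ^ 2 * (real n ^ 2 * p ^ n)) \<longlonglongrightarrow> 0" by simp
  then have "eventually (\<lambda>n. real d ^ 2 * (real n ^ 2 * p ^ n) < c / 2) sequentially"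
    by (rule order_tendstoD(2)) (use c in simp)
  then obtain K2 where K2: "\<And>n. K2 \<le> n \<Longrightarrow> real d ^ 2 * (real n ^ 2 * p ^ n) < c / 2"
    by (auto simp: eventually_sequentially)
  have "False" if a: "max 1 (max K1 K2) \<le> a" and y: "c * real a \<le> real y" and b: "2 ^ y * a \<le> b"
      and i1: "c * real b \<le> real (d * a)^2 + real l * real s"
      and i2: "c * 2 ^ s \<le> real (d * b)^2 * (real (d * b) + 1) ^ m"
    for a b s y :: nat
  proof -
    have a1: "1 \<le> a" "K1 \<le> a" "K2 \<le> a" using a by auto
    have "1 * a \<le> 2 ^ y * a" by (rule mult_le_mono1) simp
    then have ab: "a \<le> b" using b by linarith
    have b1: "1 \<le> b" "K1 \<le> b" using a1 ab by auto
    have "2 ^ y * 1 \<le> 2 ^ y * a" by (rule mult_le_mono2[OF a1(1)])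
    then have "(2::nat) ^ y \<le> b" using b by linarith
    then have "real (2 ^ y) \<le> real b" by (rule of_nat_mono)
    then have "2 powr real y \<le> real b" by (simp add: powr_realpow)
    moreover have "2 powr (c * real a) \<le> 2 powr real y" using y by simp
    ultimately have 2: "2 powr (c * real a) \<le> real b" by linarith
    have pa: "p ^ a = 2 powr (- (c * real a))"
      unfolding p_def using powr_realpow[of "2 powr - c" a] by (simp add: powr_powr)
    have "real (d * a)^2 \<le> c / 2 * real b"
    proof -
      have "real d ^ 2 * (real a ^ 2 * p ^ a) \<le> c / 2" using K2[OF a1(3)] by simp
      then have "real d ^ 2 * real a ^ 2 * (p ^ a * 2 powr (c * real a)) \<le> c / 2 * 2 powr (c * real a)"
        by (metis mult.assoc mult_right_mono powr_ge_zero)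
      moreover have "p ^ a * 2 powr (c * real a) = 1" unfolding pa by (simp add: powr_minus)
      moreover have "c / 2 * 2 powr (c * real a) \<le> c / 2 * real b" using 2 c by (intro mult_left_mono) auto
      ultimately show ?thesis by (simp add: power_mult_distrib)
    qed
    then have "c / 2 * real b \<le> real l * real s" using i1 by simp
    also have "\<dots> \<le> real (l + 1) * real s" by (intro mult_right_mono) auto
    finally have es: "e * real b \<le> real s" by (simp add: e_def field_simps)
    have qb: "q ^ b = 2 powr (- (e * real b))"
      unfolding q_def using powr_realpow[of "2 powr - e" b] by (simp add: powr_powr)
    have "2 powr (e * real b) \<le> 2 powr real s" using es by simp
    then have "2 powr (e * real b) * q ^ b \<le> 2 ^ s * q ^ b"
      using q by (intro mult_right_mono) (simp_all add: powr_realpow)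
    moreover have "2 powr (e * real b) * q ^ b = 1" unfolding qb by (simp add: powr_minus)
    ultimately have "1 \<le> 2 ^ s * q ^ b" by simp
    then have "c * 1 \<le> c * (2 ^ s * q ^ b)" using c by (intro mult_left_mono) auto
    also have "\<dots> = c * 2 ^ s * q ^ b" by simp
    also have "\<dots> \<le> real (d * b)^2 * (real (d * b) + 1) ^ m * q ^ b"
      by (rule mult_right_mono[OF i2]) (use q in simp)
    also have "\<dots> \<le> real (d * b)^2 * ((real d + 1) * real b) ^ m * q ^ b"
    proof -
      have "real (d * b) + 1 \<le> (real d + 1) * real b" using b1 by (simp add: algebra_simps)
      then have "(real (d * b) + 1) ^ m \<le> ((real d + 1) * real b) ^ m" by (intro power_mono) auto
      then show ?thesis using q by (intro mult_right_mono mult_left_mono) auto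
    qed
    also have "\<dots> = C * (real b ^ (m + 2) * q ^ b)"
      by (simp add: C_def power_mult_distrib power_add power2_eq_square mult_ac)
    finally show False using K1[OF b1(2)] by simp
  qed
  then show ?thesis by (intro exI[of _ "max 1 (max K1 K2)"]) blast
qed

section \<open>Profinite groups\<close>

locale profinite = group G for G (structure) +
  fixes T :: "'a topology"
  assumes profinite: "profinite_group G T"
begin

abbreviation open_normal :: "'a set \<Rightarrow> bool" where
  "open_normal U \<equiv> open_normal_subgroup G T U"

lemma topspace [simp]: "topspace T = carrier G"
  using profinite by (simp add: profinite_group_def)

lemma compact: "compact_space T"
  using profinite by (simp add: profinite_group_def)

lemma continuous_mult:
  assumes "continuous_map Z T f" "continuous_map Z T g"
  shows "continuous_map Z T (\<lambda>z. f z \<otimes> g z)"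
proof -
  have "continuous_map Z T ((\<lambda>(x, y). x \<otimes> y) \<circ> (\<lambda>z. (f z, g z)))"
    using profinite assms unfolding profinite_group_def
    by (intro continuous_map_compose[of _ "prod_topology T T"] continuous_map_pairedI) auto
  then show ?thesis by (simp add: o_def)
qed

lemma continuous_inv:
  assumes "continuous_map Z T f"
  shows "continuous_map Z T (\<lambda>z. inv (f z))"
proof -
  have "continuous_map Z T ((\<lambda>x. inv x) \<circ> f)"
    using profinite assms unfolding profinite_group_def by (intro continuous_map_compose[of _ T]) auto
  then show ?thesis by (simp add: o_def)
qed

lemma open_normal_normal: "open_normal U \<Longrightarrow> U \<lhd> G"
  by (simp add: open_normal_subgroup_def)

lemma open_normal_open: "open_normal U \<Longrightarrow> openin T U"
  by (simp add: open_normal_subgroup_def)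

lemma open_normal_carrier: "open_normal (carrier G)"
  using normal_self openin_topspace[of T] by (simp add: open_normal_subgroup_def)

lemma open_normal_Int: "open_normal U \<Longrightarrow> open_normal V \<Longrightarrow> open_normal (U \<inter> V)"
  by (simp add: open_normal_subgroup_def normal_subgroup_intersect openin_Int)

text \<open>In a compact Hausdorff space quasi-components agree with connected components, so points
  that form their own components are separated by clopen sets.\<close>

lemma clopen_separation:
  assumes g: "g \<in> carrier G" "g \<noteq> \<one>"
  shows "\<exists>C. openin T C \<and> closedin T C \<and> \<one> \<in> C \<and> g \<notin> C"
proof -
  have "quasi_component_of T \<one> = connected_component_of T \<one>"
    by (rule quasi_eq_connected_component_of) (use profinite in \<open>auto simp: profinite_group_def\<close>)
  moreover have "connected_component_of_set T \<one> = {\<one>}"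
    using profinite by (simp add: profinite_group_def)
  ultimately have "\<not> quasi_component_of T \<one> g" using g by auto
  then obtain C where C: "closedin T C" "openin T C" "(\<one> \<in> C) \<noteq> (g \<in> C)"
    using g unfolding quasi_component_of_def by auto
  show ?thesis
  proof (cases "\<one> \<in> C")
    case True then show ?thesis using C by blast
  next
    case False
    then show ?thesis using C g
      by (intro exI[of _ "carrier G - C"]) (metis DiffD2 DiffI one_closed openin_diff closedin_diff openin_topspace closedin_topspace topspace)
  qed
qed

text \<open>Projection along a compact factor is a closed map. Read for complements: a condition
  that is to hold for all \<open>h\<close> and all \<open>c\<close> in \<open>C\<close> defines an
  open set of \<open>g\<close>.\<close>

lemma closedin_projection:
  assumes f: "continuous_map (prod_topology T (prod_topology T T)) T f"
    and C: "openin T C" "closedin T C"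
  shows "closedin T {g \<in> carrier G. \<exists>h\<in>carrier G. \<exists>c\<in>C. f (g, (h, c)) \<notin> C}"
proof -
  let ?P = "prod_topology T (prod_topology T T)"
  have CG: "C \<subseteq> carrier G" using C(1) openin_subset by fastforce
  have "continuous_map ?P T (snd \<circ> snd)"
    by (rule continuous_map_compose[OF continuous_map_snd continuous_map_snd])
  then have "closedin ?P {p \<in> topspace ?P. (snd \<circ> snd) p \<in> C}"
    by (rule closedin_continuous_map_preimage[OF _ C(2)])
  moreover have "closedin T (carrier G - C)" using C(1) by (metis closedin_diff closedin_topspace topspace)
  then have "closedin ?P {p \<in> topspace ?P. f p \<in> carrier G - C}"
    by (rule closedin_continuous_map_preimage[OF f])
  ultimately have cl: "closedin ?P ({p \<in> topspace ?P. (snd \<circ> snd) p \<in> C} \<inter> {p \<in> topspace ?P. f p \<in> carrier G - C})"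
    (is "closedin ?P ?K") by (rule closedin_Int)
  have "compact_space (prod_topology T T)" using compact by (simp add: compact_space_prod_topology)
  then have "closed_map ?P T fst" by (rule closed_map_fst)
  then have "closedin T (fst ` ?K)" using cl by (auto simp: closed_map_def)
  moreover have "fst ` ?K = {g \<in> carrier G. \<exists>h\<in>carrier G. \<exists>c\<in>C. f (g, (h, c)) \<notin> C}" (is "_ = ?L")
  proof
    show "fst ` ?K \<subseteq> ?L" by force
    show "?L \<subseteq> fst ` ?K"
    proof
      fix g assume "g \<in> ?L"
      then obtain h c where hc: "g \<in> carrier G" "h \<in> carrier G" "c \<in> C" "f (g, (h, c)) \<notin> C" by blast
      have top: "(g, (h, c)) \<in> topspace ?P" using hc CG by auto
      then have "f (g, (h, c)) \<in> carrier G" using continuous_map_funspace[OF f] by (metis PiE topspace)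
      then have "(g, (h, c)) \<in> ?K" using top hc by simp
      then show "g \<in> fst ` ?K" by force
    qed
  qed
  ultimately show ?thesis by simp
qed

lemma open_normal_separation:
  assumes g: "g \<in> carrier G" "g \<noteq> \<one>"
  shows "\<exists>U. open_normal U \<and> g \<notin> U"
proof -
  obtain C where C: "openin T C" "closedin T C" "\<one> \<in> C" "g \<notin> C" using clopen_separation[OF g] by blast
  have CG: "c \<in> carrier G" if "c \<in> C" for c using that C(1) openin_subset by fastforce
  define f1 where "f1 p = fst (snd p) \<otimes> fst p \<otimes> inv (fst (snd p)) \<otimes> snd (snd p)" for p
  define f2 where "f2 p = fst (snd p) \<otimes> inv (fst p) \<otimes> inv (fst (snd p)) \<otimes> snd (snd p)" for p
  let ?P = "prod_topology T (prod_topology T T)"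
  have p1: "continuous_map ?P T fst" by (rule continuous_map_fst)
  have p2: "continuous_map ?P T (\<lambda>p. fst (snd p))"
    using continuous_map_compose[OF continuous_map_snd continuous_map_fst] by (simp add: o_def)
  have p3: "continuous_map ?P T (\<lambda>p. snd (snd p))"
    using continuous_map_compose[OF continuous_map_snd continuous_map_snd] by (simp add: o_def)
  have c1: "continuous_map ?P T f1" unfolding f1_def by (intro continuous_mult continuous_inv p1 p2 p3)
  have c2: "continuous_map ?P T f2" unfolding f2_def by (intro continuous_mult continuous_inv p1 p2 p3)
  \<comment> \<open>The normal core of the stabilizer of the clopen set \<open>C\<close> under left
    translation. It avoids \<open>g\<close> because \<open>C\<close> contains \<open>\<one>\<close>
    and not \<open>g\<close>.\<close>
  define U where "U = {g \<in> carrier G. \<forall>h\<in>carrier G. \<forall>c\<in>C.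
      h \<otimes> g \<otimes> inv h \<otimes> c \<in> C \<and> h \<otimes> inv g \<otimes> inv h \<otimes> c \<in> C}"
  have "U = (carrier G - {g \<in> carrier G. \<exists>h\<in>carrier G. \<exists>c\<in>C. f1 (g, (h, c)) \<notin> C})
      - {g \<in> carrier G. \<exists>h\<in>carrier G. \<exists>c\<in>C. f2 (g, (h, c)) \<notin> C}"
    unfolding U_def f1_def f2_def by auto
  moreover have "openin T (carrier G)" using openin_topspace[of T] by simp
  ultimately have oU: "openin T U"
    using closedin_projection[OF c1 C(1,2)] closedin_projection[OF c2 C(1,2)] by (simp add: openin_diff)
  have sU: "subgroup U G"
  proof (rule subgroupI)
    show "U \<subseteq> carrier G" by (auto simp: U_def)
    have "\<one> \<in> U" unfolding U_def using CG by simp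
    then show "U \<noteq> {}" by blast
    show "inv a \<in> U" if "a \<in> U" for a using that by (simp add: U_def)
    show "a \<otimes> b \<in> U" if a: "a \<in> U" and b: "b \<in> U" for a b
    proof -
      have ab: "a \<in> carrier G" "b \<in> carrier G" using a b by (auto simp: U_def)
      have "h \<otimes> (a \<otimes> b) \<otimes> inv h \<otimes> c \<in> C \<and> h \<otimes> inv (a \<otimes> b) \<otimes> inv h \<otimes> c \<in> C"
        if h: "h \<in> carrier G" and c: "c \<in> C" for h c
      proof -
        have cc: "c \<in> carrier G" using CG c .
        have "h \<otimes> (a \<otimes> b) \<otimes> inv h \<otimes> c = h \<otimes> a \<otimes> inv h \<otimes> (h \<otimes> b \<otimes> inv h \<otimes> c)"
          using h cc ab by (simp add: m_assoc)
        moreover have "h \<otimes> inv (a \<otimes> b) \<otimes> inv h \<otimes> c = h \<otimes> inv b \<otimes> inv h \<otimes> (h \<otimes> inv a \<otimes> inv h \<otimes> c)"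
          using h cc ab by (simp add: word_simps)
        moreover have "h \<otimes> b \<otimes> inv h \<otimes> c \<in> C" "h \<otimes> inv a \<otimes> inv h \<otimes> c \<in> C"
          using a b h c by (auto simp: U_def)
        ultimately show ?thesis using a b h by (simp add: U_def)
      qed
      then show ?thesis unfolding U_def using ab by simp
    qed
  qed
  have nU: "U \<lhd> G"
  proof (rule normal_invI[OF sU])
    fix t a assume t: "t \<in> carrier G" and a: "a \<in> U"
    have ac: "a \<in> carrier G" using a by (simp add: U_def)
    have "h \<otimes> (t \<otimes> a \<otimes> inv t) \<otimes> inv h \<otimes> c \<in> C \<and> h \<otimes> inv (t \<otimes> a \<otimes> inv t) \<otimes> inv h \<otimes> c \<in> C"
      if h: "h \<in> carrier G" and c: "c \<in> C" for h c
    proof -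
      have cc: "c \<in> carrier G" using CG c .
      have "h \<otimes> (t \<otimes> a \<otimes> inv t) \<otimes> inv h \<otimes> c = (h \<otimes> t) \<otimes> a \<otimes> inv (h \<otimes> t) \<otimes> c"
        using h cc ac t by (simp add: word_simps)
      moreover have "h \<otimes> inv (t \<otimes> a \<otimes> inv t) \<otimes> inv h \<otimes> c = (h \<otimes> t) \<otimes> inv a \<otimes> inv (h \<otimes> t) \<otimes> c"
        using h cc ac t by (simp add: word_simps)
      moreover have "(h \<otimes> t) \<otimes> a \<otimes> inv (h \<otimes> t) \<otimes> c \<in> C \<and> (h \<otimes> t) \<otimes> inv a \<otimes> inv (h \<otimes> t) \<otimes> c \<in> C"
        using a h t c unfolding U_def by blast
      ultimately show ?thesis by simp
    qed
    then show "t \<otimes> a \<otimes> inv t \<in> U" unfolding U_def using t ac by simp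
  qed
  have "g \<notin> U"
  proof
    assume "g \<in> U"
    then have "\<one> \<otimes> g \<otimes> inv \<one> \<otimes> \<one> \<in> C" using C(3) one_closed unfolding U_def by blast
    then show False using C(4) g by simp
  qed
  then show ?thesis using oU nU by (auto simp: open_normal_subgroup_def)
qed

lemma open_normal_avoiding:
  assumes V: "open_normal V" and F: "finite F" "F \<subseteq> carrier G" "\<one> \<notin> F"
  shows "\<exists>U. open_normal U \<and> U \<subseteq> V \<and> U \<inter> F = {}"
  using F
proof (induction F rule: finite_induct)
  case empty then show ?case using V by blast
next
  case (insert g F)
  then obtain U where U: "open_normal U" "U \<subseteq> V" "U \<inter> F = {}" by auto
  obtain W where W: "open_normal W" "g \<notin> W" using open_normal_separation[of g] insert.prems by auto
  show ?case using U W open_normal_Int by (intro exI[of _ "U \<inter> W"]) auto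
qed

lemma coset_vimage:
  assumes U: "U \<subseteq> carrier G" and g: "g \<in> carrier G"
  shows "U #> g = {z \<in> topspace T. z \<otimes> inv g \<in> U}"
proof
  show "U #> g \<subseteq> {z \<in> topspace T. z \<otimes> inv g \<in> U}"
    using U g by (auto simp: r_coset_def m_assoc subset_iff)
  show "{z \<in> topspace T. z \<otimes> inv g \<in> U} \<subseteq> U #> g"
  proof
    fix z assume z: "z \<in> {z \<in> topspace T. z \<otimes> inv g \<in> U}"
    then have "z = (z \<otimes> inv g) \<otimes> g" using g by (simp add: m_assoc)
    then show "z \<in> U #> g" using z unfolding r_coset_def by blast
  qed
qed

lemma in_coset_iff:
  assumes "U \<subseteq> carrier G" "g \<in> carrier G" "z \<in> carrier G"
  shows "z \<in> U #> g \<longleftrightarrow> z \<otimes> inv g \<in> U"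
  using coset_vimage[OF assms(1,2)] assms(3) by simp

lemma continuous_translation: "g \<in> carrier G \<Longrightarrow> continuous_map T T (\<lambda>z. z \<otimes> inv g)"
  using continuous_mult[of T "\<lambda>z. z" "\<lambda>z. inv g"] by (simp add: id_def)

lemma open_coset:
  assumes "openin T U" "g \<in> carrier G" shows "openin T (U #> g)"
  using openin_continuous_map_preimage[OF continuous_translation[OF assms(2)] assms(1)]
    coset_vimage[OF _ assms(2)] openin_subset[OF assms(1)] by simp

lemma closed_coset:
  assumes "closedin T U" "g \<in> carrier G" shows "closedin T (U #> g)"
  using closedin_continuous_map_preimage[OF continuous_translation[OF assms(2)] assms(1)]
    coset_vimage[OF _ assms(2)] closedin_subset[OF assms(1)] by simp

lemma finite_index:
  assumes U: "open_normal U"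
  shows "finite (rcosets U)"
proof -
  interpret U: normal U G by (rule open_normal_normal[OF U])
  have "\<And>D. D \<in> rcosets U \<Longrightarrow> openin T D"
    unfolding RCOSETS_def using open_coset[OF open_normal_open[OF U]] by auto
  moreover have "topspace T \<subseteq> \<Union> (rcosets U)"
    using rcosets_part_G[OF U.subgroup_axioms] by simp
  ultimately obtain \<F> where F: "finite \<F>" "\<F> \<subseteq> rcosets U" "topspace T \<subseteq> \<Union>\<F>"
    using compact unfolding compact_space_alt by metis
  have "D \<in> \<F>" if D: "D \<in> rcosets U" for D
  proof -
    obtain z where z: "z \<in> D" using U.rcosets_non_empty[OF D] by blast
    then have "z \<in> topspace T" using D U.rcosets_carrier by auto
    then obtain E where E: "E \<in> \<F>" "z \<in> E" using F by blast
    then have "D = E" using rcos_disjoint[OF U.subgroup_axioms] D F(2) z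
      unfolding pairwise_def disjnt_def by blast
    then show ?thesis using E by simp
  qed
  then have "rcosets U \<subseteq> \<F>" by (rule subsetI)
  then show ?thesis using F(1) by (rule finite_subset)
qed

lemma closedin_open_normal:
  assumes U: "open_normal U"
  shows "closedin T U"
proof -
  interpret U: normal U G by (rule open_normal_normal[OF U])
  have "U \<in> rcosets U" by (rule U.subgroup_in_rcosets[OF is_group])
  then have "\<And>D. D \<in> rcosets U - {U} \<Longrightarrow> D \<inter> U = {}"
    using rcos_disjoint[OF U.subgroup_axioms] unfolding pairwise_def disjnt_def by blast
  then have "\<Union> (rcosets U - {U}) = topspace T - U"
    using rcosets_part_G[OF U.subgroup_axioms] by auto
  moreover have "openin T (\<Union> (rcosets U - {U}))"
    by (rule openin_Union) (use open_coset[OF open_normal_open[OF U]] in \<open>auto simp: RCOSETS_def\<close>)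
  ultimately show ?thesis using U.subset by (simp add: closedin_def)
qed

text \<open>Each point of the compact complement of \<open>N\<close> is separated from
  \<open>g\<close> by some open normal subgroup; finitely many of these suffice, and they are
  intersected.\<close>

lemma small_coset:
  assumes g: "g \<in> carrier G" and N: "openin T N" "g \<in> N"
  shows "\<exists>U. open_normal U \<and> U #> g \<subseteq> N"
proof -
  define K where "K = topspace T - N"
  have "closedin T K" unfolding K_def by (rule closedin_diff[OF closedin_topspace N(1)])
  then have K: "compactin T K" using compact closedin_compact_space by blast
  have "\<exists>U. open_normal U \<and> k \<otimes> inv g \<notin> U" if "k \<in> K" for k
  proof (rule open_normal_separation)
    have kc: "k \<in> carrier G" "k \<noteq> g" using that N by (auto simp: K_def)
    show "k \<otimes> inv g \<in> carrier G" using kc g by simp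
    show "k \<otimes> inv g \<noteq> \<one>" using kc g by (metis inv_equality inv_inv inv_closed)
  qed
  then obtain W where W: "\<And>k. k \<in> K \<Longrightarrow> open_normal (W k) \<and> k \<otimes> inv g \<notin> W k" by metis
  have WG: "W k \<subseteq> carrier G" if "k \<in> K" for k
    using openin_subset[OF open_normal_open] W[OF that] by fastforce
  define O1 where "O1 k = {z \<in> topspace T. z \<otimes> inv g \<in> topspace T - W k}" for k
  have opn: "openin T (O1 k)" if k: "k \<in> K" for k
  proof -
    have "openin T (topspace T - W k)"
      by (rule openin_diff[OF openin_topspace closedin_open_normal]) (use W k in blast)
    then show ?thesis unfolding O1_def
      by (rule openin_continuous_map_preimage[OF continuous_translation[OF g]])
  qed
  have cover: "K \<subseteq> \<Union> (O1 ` K)"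
  proof
    fix k assume k: "k \<in> K"
    then have "k \<in> carrier G" by (auto simp: K_def)
    then have "k \<in> O1 k" using W[OF k] g by (simp add: O1_def)
    then show "k \<in> \<Union> (O1 ` K)" using k by blast
  qed
  have "\<And>D. D \<in> O1 ` K \<Longrightarrow> openin T D" using opn by blast
  then obtain \<F> where F: "finite \<F>" "\<F> \<subseteq> O1 ` K" "K \<subseteq> \<Union>\<F>"
    using K cover unfolding compactin_def by metis
  obtain K0 where K0: "K0 \<subseteq> K" "finite K0" "\<F> = O1 ` K0" using finite_subset_image[OF F(1,2)] by blast
  have "\<exists>U. open_normal U \<and> (\<forall>k\<in>K0. U \<subseteq> W k)" using K0(2,1)
  proof (induction K0 rule: finite_induct)
    case empty then show ?case using open_normal_carrier by blast
  next
    case (insert k K0)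
    then obtain U where U: "open_normal U" "\<forall>k\<in>K0. U \<subseteq> W k" by blast
    have "open_normal (U \<inter> W k)" using open_normal_Int[OF U(1)] W insert.prems by simp
    then show ?case using U(2) by (intro exI[of _ "U \<inter> W k"]) auto
  qed
  then obtain U where U: "open_normal U" "\<forall>k\<in>K0. U \<subseteq> W k" by blast
  have UG: "U \<subseteq> carrier G" using openin_subset[OF open_normal_open[OF U(1)]] by simp
  have "U #> g \<subseteq> N"
  proof
    fix z assume "z \<in> U #> g"
    then have z: "z \<in> carrier G" "z \<otimes> inv g \<in> U" using coset_vimage[OF UG g] by auto
    show "z \<in> N"
    proof (rule ccontr)
      assume "z \<notin> N"
      then have "z \<in> K" using z by (simp add: K_def)
      then obtain k where "k \<in> K0" "z \<in> O1 k" using F(3) K0(3) by blast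
      then show False using U(2) z(2) by (auto simp: O1_def)
    qed
  qed
  then show ?thesis using U(1) by blast
qed

text \<open>Cosets of open normal subgroups form a neighbourhood base, so lying in a closure means
  being approximated modulo every open normal subgroup. This reduces many later closure arguments to
  algebra.\<close>

lemma closure_iff:
  assumes A: "A \<subseteq> carrier G" and g: "g \<in> carrier G"
  shows "g \<in> T closure_of A \<longleftrightarrow> (\<forall>U. open_normal U \<longrightarrow> (\<exists>a\<in>A. a \<otimes> inv g \<in> U))"
proof
  assume L: "g \<in> T closure_of A"
  show "\<forall>U. open_normal U \<longrightarrow> (\<exists>a\<in>A. a \<otimes> inv g \<in> U)"
  proof (intro allI impI)
    fix U assume U: "open_normal U"
    interpret U: normal U G by (rule open_normal_normal[OF U])
    have "g \<in> U #> g" by (rule rcos_self[OF g U.subgroup_axioms])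
    then obtain a where "a \<in> A" "a \<in> U #> g"
      using L open_coset[OF open_normal_open[OF U] g] unfolding in_closure_of by blast
    then show "\<exists>a\<in>A. a \<otimes> inv g \<in> U" using in_coset_iff[OF U.subset g] A by blast
  qed
next
  assume R: "\<forall>U. open_normal U \<longrightarrow> (\<exists>a\<in>A. a \<otimes> inv g \<in> U)"
  show "g \<in> T closure_of A"
    unfolding in_closure_of
  proof (intro conjI allI impI)
    show "g \<in> topspace T" using g by simp
    fix N assume "g \<in> N \<and> openin T N"
    then obtain U where U: "open_normal U" "U #> g \<subseteq> N" using small_coset[OF g] by blast
    interpret U: normal U G by (rule open_normal_normal[OF U(1)])
    obtain a where a: "a \<in> A" "a \<otimes> inv g \<in> U" using R U(1) by blast
    then have "a \<in> U #> g" using in_coset_iff[OF U.subset g] A by blast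
    then show "\<exists>y. y \<in> A \<and> y \<in> N" using a U(2) by blast
  qed
qed

lemma closure_carrier: "T closure_of A \<subseteq> carrier G"
  using closure_of_subset_topspace[of T A] by simp

lemma open_normal_closed: "open_normal U \<Longrightarrow> T closure_of U = U"
  by (rule closure_of_closedin[OF closedin_open_normal])

text \<open>Only the dense set \<open>\<Gamma>\<close> is known to normalize \<open>N\<close>. An
  arbitrary \<open>t\<close> is replaced by some \<open>\<gamma>\<close> congruent to it modulo
  \<open>U\<close>, and the errors stay in \<open>U\<close>.\<close>

lemma closure_normal:
  assumes N: "subgroup N G" and dense: "T closure_of \<Gamma> = carrier G" and \<Gamma>: "\<Gamma> \<subseteq> carrier G"
    and conj: "\<And>\<gamma> n. \<gamma> \<in> \<Gamma> \<Longrightarrow> n \<in> N \<Longrightarrow> \<gamma> \<otimes> n \<otimes> inv \<gamma> \<in> N"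
  shows "T closure_of N \<lhd> G"
proof -
  interpret N: subgroup N G by fact
  note cl = closure_iff[OF N.subset]
  have sub: "subgroup (T closure_of N) G"
  proof (rule subgroupI)
    show "T closure_of N \<subseteq> carrier G" by (rule closure_carrier)
    have "N \<subseteq> T closure_of N" by (rule closure_of_subset) (use N.subset in simp)
    then show "T closure_of N \<noteq> {}" using N.one_closed by blast
    show "inv g \<in> T closure_of N" if g: "g \<in> T closure_of N" for g
    proof -
      have gc: "g \<in> carrier G" using g closure_carrier by blast
      have "\<exists>a\<in>N. a \<otimes> inv (inv g) \<in> U" if U: "open_normal U" for U
      proof -
        interpret U: normal U G by (rule open_normal_normal[OF U])
        obtain a where a: "a \<in> N" "a \<otimes> inv g \<in> U" using g U cl[OF gc] by blast
        have "inv a \<otimes> inv (a \<otimes> inv g) \<otimes> a \<in> U" using a by (intro U.inv_op_closed1) auto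
        then have "inv a \<otimes> inv (inv g) \<in> U" using a gc by (simp add: word_simps)
        then show ?thesis using a by blast
      qed
      then show ?thesis using cl gc by simp
    qed
    show "g \<otimes> k \<in> T closure_of N" if g: "g \<in> T closure_of N" and k: "k \<in> T closure_of N" for g k
    proof -
      have gc: "g \<in> carrier G" "k \<in> carrier G" using g k closure_carrier by auto
      have "\<exists>a\<in>N. a \<otimes> inv (g \<otimes> k) \<in> U" if U: "open_normal U" for U
      proof -
        interpret U: normal U G by (rule open_normal_normal[OF U])
        obtain a where a: "a \<in> N" "a \<otimes> inv g \<in> U" using g U cl[OF gc(1)] by blast
        obtain b where b: "b \<in> N" "b \<otimes> inv k \<in> U" using k U cl[OF gc(2)] by blast
        have "a \<otimes> (b \<otimes> inv k) \<otimes> inv a \<in> U" using a b by (intro U.inv_op_closed2) auto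
        then have "(a \<otimes> (b \<otimes> inv k) \<otimes> inv a) \<otimes> (a \<otimes> inv g) \<in> U" using a(2) by (rule U.m_closed)
        moreover have "(a \<otimes> (b \<otimes> inv k) \<otimes> inv a) \<otimes> (a \<otimes> inv g) = (a \<otimes> b) \<otimes> inv (g \<otimes> k)"
          using a b gc by (simp add: word_simps)
        ultimately show ?thesis using a b by auto
      qed
      then show ?thesis using cl gc by simp
    qed
  qed
  show ?thesis
  proof (rule normal_invI[OF sub])
    fix t g assume t: "t \<in> carrier G" and g: "g \<in> T closure_of N"
    have gc: "g \<in> carrier G" using g closure_carrier by blast
    have "\<exists>a\<in>N. a \<otimes> inv (t \<otimes> g \<otimes> inv t) \<in> U" if U: "open_normal U" for U
    proof -
      interpret U: normal U G by (rule open_normal_normal[OF U])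
      obtain n where n: "n \<in> N" "n \<otimes> inv g \<in> U" using g U cl[OF gc] by blast
      obtain \<gamma> where \<gamma>: "\<gamma> \<in> \<Gamma>" "\<gamma> \<otimes> inv t \<in> U" using dense t U closure_iff[OF \<Gamma> t] by blast
      define u where "u = \<gamma> \<otimes> inv t"
      define w where "w = t \<otimes> n \<otimes> inv t"
      have c: "\<gamma> \<in> carrier G" "n \<in> carrier G" "u \<in> carrier G" "w \<in> carrier G"
        using \<gamma> \<Gamma> n t by (auto simp: u_def w_def)
      have "\<gamma> = u \<otimes> t" using c t by (simp add: u_def m_assoc)
      \<comment> \<open>With \<open>\<gamma> = u t\<close> the quotient becomes a product of
        \<open>u\<close>, a conjugate of \<open>inv u\<close> and a conjugate of
        \<open>n \<otimes> inv g\<close>, all in \<open>U\<close>.\<close>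
      then have "(\<gamma> \<otimes> n \<otimes> inv \<gamma>) \<otimes> inv (t \<otimes> g \<otimes> inv t)
          = u \<otimes> (w \<otimes> inv u \<otimes> inv w) \<otimes> (t \<otimes> (n \<otimes> inv g) \<otimes> inv t)"
        using c(2,3) t gc by (simp add: w_def word_simps)
      moreover have "u \<in> U" "w \<otimes> inv u \<otimes> inv w \<in> U" "t \<otimes> (n \<otimes> inv g) \<otimes> inv t \<in> U"
        using \<gamma> n c t by (auto simp: u_def [symmetric] intro!: U.inv_op_closed2)
      ultimately have "(\<gamma> \<otimes> n \<otimes> inv \<gamma>) \<otimes> inv (t \<otimes> g \<otimes> inv t) \<in> U" by simp
      then show ?thesis using conj[OF \<gamma>(1) n(1)] by blast
    qed
    then show "t \<otimes> g \<otimes> inv t \<in> T closure_of N" using cl t gc by simp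
  qed
qed

text \<open>Finitely many cosets of the closure of \<open>N\<close> cover the dense set
  \<open>\<Gamma>\<close>; being closed, they cover \<open>G\<close>. So the complement of the
  closure of \<open>N\<close> is a finite union of closed cosets.\<close>

lemma closure_open_normal:
  assumes N: "subgroup N G" and dense: "T closure_of \<Gamma> = carrier G" and \<Gamma>: "\<Gamma> \<subseteq> carrier G"
    and conj: "\<And>\<gamma> n. \<gamma> \<in> \<Gamma> \<Longrightarrow> n \<in> N \<Longrightarrow> \<gamma> \<otimes> n \<otimes> inv \<gamma> \<in> N"
    and R: "finite R" "R \<subseteq> carrier G" "\<Gamma> \<subseteq> (\<Union>r\<in>R. N #> r)"
  shows "open_normal (T closure_of N)"
proof -
  let ?N = "T closure_of N"
  have nN: "?N \<lhd> G" by (rule closure_normal[OF N dense \<Gamma> conj])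
  interpret N': normal ?N G by (rule nN)
  have cl: "closedin T ?N" by (rule closedin_closure_of)
  have sub: "N \<subseteq> ?N" by (rule closure_of_subset) (use subgroup.subset[OF N] in simp)
  have clU: "closedin T (\<Union>r\<in>R'. ?N #> r)" if "R' \<subseteq> R" for R'
    by (rule closedin_Union) (use that R closed_coset[OF cl] finite_subset[OF that R(1)] in auto)
  have "\<Gamma> \<subseteq> (\<Union>r\<in>R. ?N #> r)" using R(3) sub unfolding r_coset_def by blast
  then have "T closure_of \<Gamma> \<subseteq> (\<Union>r\<in>R. ?N #> r)" using clU by (intro closure_of_minimal) auto
  then have all: "carrier G \<subseteq> (\<Union>r\<in>R. ?N #> r)" using dense by simp
  let ?R = "{r \<in> R. r \<notin> ?N}"
  have "?N = topspace T - (\<Union>r\<in>?R. ?N #> r)"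
  proof
    show "?N \<subseteq> topspace T - (\<Union>r\<in>?R. ?N #> r)"
    proof
      fix z assume z: "z \<in> ?N"
      have "z \<notin> ?N #> r" if "r \<in> ?R" for r
      proof
        assume "z \<in> ?N #> r"
        then have "z \<otimes> inv r \<in> ?N" using in_coset_iff[OF N'.subset, of r z] that R z by auto
        then have "inv (z \<otimes> inv r) \<otimes> z \<in> ?N" using z by simp
        then show False using that R z by (auto simp: word_simps)
      qed
      then show "z \<in> topspace T - (\<Union>r\<in>?R. ?N #> r)" using z by auto
    qed
    show "topspace T - (\<Union>r\<in>?R. ?N #> r) \<subseteq> ?N"
    proof
      fix z assume z: "z \<in> topspace T - (\<Union>r\<in>?R. ?N #> r)"
      then obtain r where r: "r \<in> R" "z \<in> ?N #> r" using all by auto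
      then have "r \<in> ?N" using z by auto
      then have "?N #> r = ?N" using coset_join2[OF _ N'.subgroup_axioms] by simp
      then show "z \<in> ?N" using r by simp
    qed
  qed
  moreover have "openin T (topspace T - (\<Union>r\<in>?R. ?N #> r))"
    by (rule openin_diff[OF openin_topspace clU]) blast
  ultimately have "openin T ?N" by (rule ssubst)
  then show ?thesis using nN by (simp add: open_normal_subgroup_def)
qed

lemma open_normal_supergroup:
  assumes U: "open_normal U" and H: "H \<lhd> G" "U \<subseteq> H"
  shows "open_normal H"
proof -
  interpret U: normal U G by (rule open_normal_normal[OF U])
  interpret H: normal H G by fact
  have "h \<in> U #> h" if "h \<in> H" for h
    by (rule rcos_self[OF H.mem_carrier[OF that] U.subgroup_axioms])
  moreover have "U #> h \<subseteq> H" if "h \<in> H" for h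
    using H.m_closed[OF subsetD[OF H(2)] that] by (auto simp: r_coset_def)
  ultimately have "H = (\<Union>h\<in>H. U #> h)" by blast
  moreover have "openin T (\<Union>h\<in>H. U #> h)"
    using open_coset[OF open_normal_open[OF U]] by (intro openin_Union) auto
  ultimately have "openin T H" by (rule ssubst)
  then show ?thesis using H(1) by (simp add: open_normal_subgroup_def)
qed

end

section \<open>Closed commutator subgroups and the rank of the first homology group\<close>

context profinite
begin

lemma closed_commutator_normal:
  assumes "U \<lhd> G"
  shows "closed_commutator G T U \<lhd> G"
proof -
  interpret D: normal "derived G U" G by (rule derived_is_normal[OF assms])
  have "T closure_of carrier G = carrier G" using closure_of_topspace[of T] by simp
  then show ?thesis
    unfolding closed_commutator_def
    by (rule closure_normal[OF D.subgroup_axioms _ order_refl]) (rule D.inv_op_closed2)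
qed

lemma derived_subset_closed_commutator:
  assumes "U \<lhd> G"
  shows "derived G U \<subseteq> closed_commutator G T U"
  unfolding closed_commutator_def
  by (rule closure_of_subset) (use normal.axioms(1)[OF derived_is_normal[OF assms]] subgroup.subset in auto)

lemma closed_commutator_subset:
  assumes U: "open_normal U"
  shows "closed_commutator G T U \<subseteq> U"
proof -
  interpret U: normal U G by (rule open_normal_normal[OF U])
  have "derived G U \<subseteq> U" by (rule derived_incl[OF order_refl U.subgroup_axioms])
  then have "T closure_of derived G U \<subseteq> T closure_of U" by (rule closure_of_mono)
  then show ?thesis using open_normal_closed[OF U] by (simp add: closed_commutator_def)
qed

lemma coset_eq_iff:
  assumes "U \<lhd> G" "g \<in> carrier G" "h \<in> carrier G"
  shows "U #> g = U #> h \<longleftrightarrow> g \<otimes> inv h \<in> U"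
proof -
  interpret U: normal U G by fact
  have "g \<otimes> inv h \<in> U \<longleftrightarrow> g \<in> U #> h" using in_coset_iff[OF U.subset assms(3,2)] by simp
  also have "\<dots> \<longleftrightarrow> U #> g = U #> h"
    using repr_independence[OF _ assms(3) U.subgroup_axioms] rcos_self[OF assms(2) U.subgroup_axioms] by metis
  finally show ?thesis by simp
qed

text \<open>\<open>quot_top\<close> is given through \<open>topology\<close>, whose open sets are
  the intended ones once these are shown to form a topology. For intersections this rests on the
  disjointness of distinct cosets.\<close>

lemma openin_quot_top:
  assumes U: "open_normal U" and K: "K \<lhd> (G\<lparr>carrier := U\<rparr>)"
  shows "openin (quot_top (subtopology T U) (G\<lparr>carrier := U\<rparr>) K) A \<longleftrightarrow>
      A \<subseteq> rcosets\<^bsub>G\<lparr>carrier := U\<rparr>\<^esub> K \<and> openin (subtopology T U) (\<Union>A)"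
proof -
  interpret K: normal K "G\<lparr>carrier := U\<rparr>" by (rule K)
  let ?R = "rcosets\<^bsub>G\<lparr>carrier := U\<rparr>\<^esub> K"
  have disj: "D = E" if "D \<in> ?R" "E \<in> ?R" "z \<in> D" "z \<in> E" for D E z
    using group.rcos_disjoint[OF K.is_group K.subgroup_axioms] that unfolding pairwise_def disjnt_def by blast
  have "istopology (\<lambda>A. A \<subseteq> ?R \<and> openin (subtopology T U) (\<Union>A))"
    unfolding istopology_def
  proof (intro conjI allI impI)
    fix A B
    assume AB: "A \<subseteq> ?R \<and> openin (subtopology T U) (\<Union>A)" "B \<subseteq> ?R \<and> openin (subtopology T U) (\<Union>B)"
    then show "A \<inter> B \<subseteq> ?R" by blast
    have "\<Union>(A \<inter> B) = \<Union>A \<inter> \<Union>B"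
    proof
      show "\<Union>A \<inter> \<Union>B \<subseteq> \<Union>(A \<inter> B)"
      proof
        fix z assume "z \<in> \<Union>A \<inter> \<Union>B"
        then obtain D E where "D \<in> A" "E \<in> B" "z \<in> D" "z \<in> E" by blast
        moreover have "D = E" by (rule disj) (use AB calculation in auto)
        ultimately show "z \<in> \<Union>(A \<inter> B)" by blast
      qed
    qed blast
    then show "openin (subtopology T U) (\<Union>(A \<inter> B))" using openin_Int[OF conjunct2[OF AB(1)] conjunct2[OF AB(2)]] by simp
  next
    fix \<K> assume K: "\<forall>A\<in>\<K>. A \<subseteq> ?R \<and> openin (subtopology T U) (\<Union>A)"
    then show "\<Union>\<K> \<subseteq> ?R" by blast
    have "\<Union>(\<Union>\<K>) = \<Union>(Union ` \<K>)" by blast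
    moreover have "openin (subtopology T U) (\<Union>(Union ` \<K>))"
      by (rule openin_Union) (use K in blast)
    ultimately show "openin (subtopology T U) (\<Union>(\<Union>\<K>))" by simp
  qed
  then show ?thesis unfolding quot_top_def by (simp add: topology_inverse')
qed

text \<open>Topological generation ignores closures, so it is enough to generate a dense part
  \<open>N\<close> of \<open>U\<close> modulo the closed commutator subgroup. In one application
  \<open>N\<close> is the normal closure of an element of \<open>\<Gamma>\<close>, in the other it
  is \<open>U\<close>.\<close>

lemma top_rank_H1_le:
  assumes U: "open_normal U" and N: "N \<subseteq> U" "U \<subseteq> T closure_of N"
    and Y: "finite Y" "Y \<subseteq> U" and gen: "N \<subseteq> generate G (Y \<union> closed_commutator G T U)"
  shows "top_rank (H1_group G T U) (H1_top G T U) \<le> card Y"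
proof -
  define K where "K = closed_commutator G T U"
  let ?GU = "G\<lparr>carrier := U\<rparr>"
  interpret U: normal U G by (rule open_normal_normal[OF U])
  have nK: "K \<lhd> G" unfolding K_def by (rule closed_commutator_normal) (rule U.normal_axioms)
  have KU: "K \<subseteq> U" unfolding K_def by (rule closed_commutator_subset[OF U])
  have K: "K \<lhd> ?GU" by (rule normal_restrict_supergroup[OF U.subgroup_axioms nK KU])
  interpret K: normal K ?GU by (rule K)
  let ?H = "?GU Mod K" and ?\<pi> = "\<lambda>u. K #> u"
  interpret H: group ?H by (rule K.factorgroup_is_group)
  have "?\<pi> \<in> hom ?GU ?H" using K.r_coset_hom_Mod by simp
  then interpret \<pi>: group_hom ?GU ?H ?\<pi>
    by (simp add: group_hom_def group_hom_axioms_def K.is_group H.is_group)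
  have carr: "carrier ?H = ?\<pi> ` U" by (simp add: carrier_FactGroup)
  have \<pi>K: "?\<pi> k = \<one>\<^bsub>?H\<^esub>" if "k \<in> K" for k
    using coset_join2[OF _ normal.axioms(1)[OF nK] that] that KU U.subset by auto
  let ?Y = "?\<pi> ` Y"
  have \<pi>N: "?\<pi> n \<in> generate ?H ?Y" if n: "n \<in> N" for n
  proof -
    have YK: "Y \<union> K \<subseteq> U" using Y KU by blast
    have "n \<in> generate ?GU (Y \<union> K)"
      using gen n generate_consistent[OF YK U.subgroup_axioms] by (auto simp: K_def)
    then have "?\<pi> n \<in> generate ?H (?\<pi> ` (Y \<union> K))"
      using \<pi>.generate_img[of "Y \<union> K"] YK by auto
    moreover have sY: "subgroup (generate ?H ?Y) ?H"
      by (rule H.generate_is_subgroup) (use Y carr in auto)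
    have "?\<pi> ` (Y \<union> K) \<subseteq> generate ?H ?Y"
    proof
      fix D assume "D \<in> ?\<pi> ` (Y \<union> K)"
      then consider "D \<in> ?Y" | k where "k \<in> K" "D = ?\<pi> k" by blast
      then show "D \<in> generate ?H ?Y"
        by cases (auto intro: generate.incl simp: \<pi>K subgroup.one_closed[OF sY] simp del: one_FactGroup)
    qed
    then have "generate ?H (?\<pi> ` (Y \<union> K)) \<subseteq> generate ?H ?Y" by (rule H.generate_subgroup_incl[OF _ sY])
    ultimately show ?thesis by blast
  qed
  define Tq where "Tq = H1_top G T U"
  have opn: "openin Tq A \<longleftrightarrow> A \<subseteq> carrier ?H \<and> openin (subtopology T U) (\<Union>A)" for A
    unfolding Tq_def H1_top_def K_def [symmetric] openin_quot_top[OF U K] by (simp add: FactGroup_def)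
  have "\<Union> (carrier ?H) = U" using group.rcosets_part_G[OF K.is_group K.subgroup_axioms] by (simp add: FactGroup_def)
  moreover have "openin (subtopology T U) U"
    using open_normal_open[OF U] by (simp add: openin_open_subtopology)
  ultimately have "openin Tq (carrier ?H)" using opn by simp
  then have top: "topspace Tq = carrier ?H"
    using opn openin_subset openin_topspace by (metis subset_antisym)
  have "carrier ?H \<subseteq> Tq closure_of generate ?H ?Y"
  proof
    fix D assume D: "D \<in> carrier ?H"
    \<comment> \<open>An open set of cosets has an open union, which meets the dense set
      \<open>N\<close>; the coset of a common point is in the generated subgroup.\<close>
    have "\<exists>E. E \<in> generate ?H ?Y \<and> E \<in> A" if A: "D \<in> A" "openin Tq A" for A
    proof -
      have A': "A \<subseteq> carrier ?H" "openin T (\<Union>A)" "\<Union>A \<subseteq> U"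
        using A(2) opn openin_open_subtopology[OF open_normal_open[OF U]] by auto
      obtain d where "d \<in> D" using D K.rcosets_non_empty[of D] by (auto simp: FactGroup_def)
      then have "d \<in> \<Union>A" "d \<in> T closure_of N" using A A' N(2) by auto
      then obtain n where n: "n \<in> N" "n \<in> \<Union>A" using A'(2) unfolding in_closure_of by blast
      then obtain E where E: "E \<in> A" "n \<in> E" by blast
      then obtain e where e: "e \<in> U" "E = ?\<pi> e" using A'(1) carr by auto
      have "?\<pi> n = E"
        using repr_independence[OF _ _ normal.axioms(1)[OF nK], of n e] E(2) e U.subset by auto
      then show ?thesis using \<pi>N[OF n(1)] E(1) by blast
    qed
    then show "D \<in> Tq closure_of generate ?H ?Y" unfolding in_closure_of using top D by blast
  qed
  then have "Tq closure_of generate ?H ?Y = carrier ?H"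
    using closure_of_subset_topspace[of Tq] top by auto
  moreover have "?Y \<subseteq> carrier ?H" "finite ?Y" using carr Y by auto
  ultimately have "\<exists>Z. Z \<subseteq> carrier ?H \<and> finite Z \<and> card Z = card ?Y \<and> Tq closure_of generate ?H Z = carrier ?H"
    by blast
  then have "top_rank ?H Tq \<le> card ?Y" unfolding top_rank_def by (rule Least_le)
  also have "\<dots> \<le> card Y" by (rule card_image_le[OF Y(1)])
  finally show ?thesis by (simp add: H1_group_def K_def Tq_def)
qed

end

lemma (in group) generate_finite_support:
  assumes "g \<in> generate G A"
  shows "\<exists>B. finite B \<and> B \<subseteq> A \<and> g \<in> generate G B"
  using assms
proof (induction g rule: generate.induct)
  case one show ?case by (rule exI[of _ "{}"]) (simp add: generate.one)
next
  case (incl h) then show ?case by (intro exI[of _ "{h}"]) (simp add: generate.incl)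
next
  case (inv h) then show ?case by (intro exI[of _ "{h}"]) (simp add: generate.inv)
next
  case (eng h1 h2)
  then obtain B1 B2 where B: "finite B1" "B1 \<subseteq> A" "h1 \<in> generate G B1" "finite B2" "B2 \<subseteq> A" "h2 \<in> generate G B2"
    by blast
  have "h1 \<in> generate G (B1 \<union> B2)" "h2 \<in> generate G (B1 \<union> B2)"
    using B mono_generate[of B1 "B1 \<union> B2"] mono_generate[of B2 "B1 \<union> B2"] by auto
  then show ?case using B by (intro exI[of _ "B1 \<union> B2"]) (auto intro: generate.eng)
qed

section \<open>Just infinite dense subgroups\<close>

text \<open>The negation of the theorem, with \<open>V\<close> and \<open>c\<close> as witnesses and
  the denominator of the gradient cleared; the context ends in a contradiction.\<close>

locale positive_gradient = profinite +
  fixes \<Gamma> S V :: "'a set" and c :: real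
  assumes \<Gamma>: "subgroup \<Gamma> G"
    and S: "finite S" "S \<subseteq> \<Gamma>" "generate G S = \<Gamma>"
    and dense: "T closure_of \<Gamma> = carrier G"
    and ji: "just_infinite (G\<lparr>carrier := \<Gamma>\<rparr>)"
    and V: "open_normal V"
    and c: "c > 0"
    and gradient: "\<And>U. open_normal U \<Longrightarrow> U \<subseteq> V \<Longrightarrow>
      c * real (card (rcosets U)) \<le> real (top_rank (H1_group G T U) (H1_top G T U))"
begin

sublocale \<Gamma>: subgroup \<Gamma> G by (rule \<Gamma>)

lemma infinite_\<Gamma>: "infinite \<Gamma>"
  using ji by (simp add: just_infinite_def)

lemma dense_approximation:
  assumes "g \<in> carrier G" "open_normal U"
  obtains \<gamma> where "\<gamma> \<in> \<Gamma>" "\<gamma> \<otimes> inv g \<in> U"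
  using assms dense closure_iff[OF \<Gamma>.subset assms(1)] by blast

lemma generators_bound:
  assumes U: "open_normal U" "U \<subseteq> V" and N: "N \<subseteq> U" "U \<subseteq> T closure_of N"
    and Y: "finite Y" "Y \<subseteq> U" and gen: "N \<subseteq> generate G (Y \<union> closed_commutator G T U)"
  shows "c * real (card (rcosets U)) \<le> real (card Y)"
  using gradient[OF U] top_rank_H1_le[OF U(1) N Y gen] by linarith

lemma infinite_inter:
  assumes U: "open_normal U"
  shows "infinite (\<Gamma> \<inter> U)"
proof
  assume fin: "finite (\<Gamma> \<inter> U)"
  interpret U: normal U G by (rule open_normal_normal[OF U])
  have "(\<lambda>g. U #> g) ` \<Gamma> \<subseteq> rcosets U" unfolding RCOSETS_def using \<Gamma>.subset by blast
  then have "finite ((\<lambda>g. U #> g) ` \<Gamma>)" using finite_index[OF U] finite_subset by blast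
  then obtain h where h: "h \<in> \<Gamma>" "infinite {g \<in> \<Gamma>. U #> g = U #> h}"
    using pigeonhole_infinite[OF infinite_\<Gamma>] by auto
  have "inj_on (\<lambda>g. g \<otimes> inv h) {g \<in> \<Gamma>. U #> g = U #> h}"
    by (rule inj_on_subset[OF inj_on_multc]) (use h(1) in auto)
  moreover have "(\<lambda>g. g \<otimes> inv h) ` {g \<in> \<Gamma>. U #> g = U #> h} \<subseteq> \<Gamma> \<inter> U"
    using h(1) coset_eq_iff[OF U.normal_axioms] by auto
  ultimately show False using h(2) fin finite_imageD finite_subset by blast
qed

text \<open>A finite set has only finitely many nontrivial quotients
  \<open>f \<otimes> inv g\<close>, and these can be kept out of an open normal subgroup.\<close>

lemma separating_subgroup:
  assumes W: "open_normal W" and F: "finite F" "F \<subseteq> carrier G"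
  shows "\<exists>U. open_normal U \<and> U \<subseteq> W \<and> (\<forall>f\<in>F. \<forall>g\<in>F. f \<noteq> g \<longrightarrow> f \<otimes> inv g \<notin> U)"
proof -
  let ?D = "(\<lambda>(f, g). f \<otimes> inv g) ` (F \<times> F) - {\<one>}"
  have D: "finite ?D" "?D \<subseteq> carrier G" "\<one> \<notin> ?D" using F by auto
  obtain U where U: "open_normal U" "U \<subseteq> W" "U \<inter> ?D = {}"
    using open_normal_avoiding[OF W D] by blast
  have "f \<otimes> inv g \<notin> U" if fg: "f \<in> F" "g \<in> F" "f \<noteq> g" for f g
  proof -
    have fgc: "f \<in> carrier G" "g \<in> carrier G" using fg F by auto
    have "f \<otimes> inv g \<noteq> \<one>" using fgc fg(3) by (metis inv_equality inv_inv inv_closed)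
    then have "f \<otimes> inv g \<in> ?D" using fg by auto
    then show ?thesis using U(3) by blast
  qed
  then show ?thesis using U by blast
qed

definition nc :: "'a \<Rightarrow> 'a set" where
  "nc \<gamma> = generate G ((\<lambda>g. g \<otimes> \<gamma> \<otimes> inv g) ` \<Gamma>)"

lemma conjugates_subset: "\<gamma> \<in> \<Gamma> \<Longrightarrow> (\<lambda>g. g \<otimes> \<gamma> \<otimes> inv g) ` \<Gamma> \<subseteq> \<Gamma>"
  by auto

lemma nc_normal:
  assumes \<gamma>: "\<gamma> \<in> \<Gamma>"
  shows "nc \<gamma> \<lhd> G\<lparr>carrier := \<Gamma>\<rparr>"
proof -
  let ?A = "(\<lambda>g. g \<otimes> \<gamma> \<otimes> inv g) ` \<Gamma>"
  interpret G': group "G\<lparr>carrier := \<Gamma>\<rparr>" by (rule subgroup_imp_group[OF \<Gamma>])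
  have "h \<otimes> (g \<otimes> \<gamma> \<otimes> inv g) \<otimes> inv h \<in> ?A" if "g \<in> \<Gamma>" "h \<in> \<Gamma>" for g h
  proof -
    have "h \<otimes> (g \<otimes> \<gamma> \<otimes> inv g) \<otimes> inv h = (h \<otimes> g) \<otimes> \<gamma> \<otimes> inv (h \<otimes> g)"
      using that \<gamma> by (simp add: word_simps)
    then show ?thesis using that by auto
  qed
  then have "generate (G\<lparr>carrier := \<Gamma>\<rparr>) ?A \<lhd> G\<lparr>carrier := \<Gamma>\<rparr>"
    using conjugates_subset[OF \<gamma>] by (intro G'.normal_generateI) (auto simp: m_inv_consistent[OF \<Gamma>])
  then show ?thesis
    unfolding nc_def generate_consistent[OF conjugates_subset[OF \<gamma>] \<Gamma>] .
qed

lemma nc_subset: "\<gamma> \<in> \<Gamma> \<Longrightarrow> nc \<gamma> \<subseteq> \<Gamma>"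
  unfolding nc_def by (rule generate_subgroup_incl[OF conjugates_subset \<Gamma>])

lemma nc_self: "\<gamma> \<in> \<Gamma> \<Longrightarrow> \<gamma> \<in> nc \<gamma>"
  unfolding nc_def by (rule generate.incl) (auto intro!: image_eqI[of _ _ \<one>])

text \<open>Just infiniteness gives finitely many cosets of \<open>N\<close> in
  \<open>\<Gamma>\<close>; density carries this finiteness over to the closure in
  \<open>G\<close>.\<close>

lemma just_infinite_closure:
  assumes N: "N \<lhd> G\<lparr>carrier := \<Gamma>\<rparr>" "N \<noteq> {\<one>}"
  shows "open_normal (T closure_of N)"
proof -
  let ?G = "G\<lparr>carrier := \<Gamma>\<rparr>"
  interpret N: normal N ?G by (rule N(1))
  have sub: "subgroup N G" by (rule incl_subgroup[OF \<Gamma> N.subgroup_axioms])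
  have conj: "\<gamma> \<otimes> n \<otimes> inv \<gamma> \<in> N" if "\<gamma> \<in> \<Gamma>" "n \<in> N" for \<gamma> n
    using N.inv_op_closed2[of \<gamma> n] that m_inv_consistent[OF \<Gamma>] by simp
  have fin: "finite (rcosets\<^bsub>?G\<^esub> N)"
    using ji N by (simp add: just_infinite_def)
  have eq: "rcosets\<^bsub>?G\<^esub> N = (\<lambda>g. N #> g) ` \<Gamma>" by (auto simp: RCOSETS_def)
  then obtain R where R: "R \<subseteq> \<Gamma>" "finite R" "(\<lambda>g. N #> g) ` \<Gamma> = (\<lambda>g. N #> g) ` R"
    using fin finite_subset_image[of "(\<lambda>g. N #> g) ` \<Gamma>" "\<lambda>g. N #> g" \<Gamma>] by auto
  have "\<Gamma> \<subseteq> (\<Union>r\<in>R. N #> r)"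
  proof
    fix g assume g: "g \<in> \<Gamma>"
    then have "g \<in> N #> g" using rcos_self[OF _ sub] by simp
    moreover have "N #> g \<in> (\<lambda>g. N #> g) ` R" unfolding R(3) [symmetric] using g by (rule imageI)
    ultimately show "g \<in> (\<Union>r\<in>R. N #> r)" by blast
  qed
  moreover have "R \<subseteq> carrier G" using R(1) \<Gamma>.subset by blast
  ultimately show "open_normal (T closure_of N)"
    using closure_open_normal[OF sub dense \<Gamma>.subset conj R(2)] by blast
qed

lemma open_normal_nc:
  assumes "\<gamma> \<in> \<Gamma>" "\<gamma> \<noteq> \<one>"
  shows "open_normal (T closure_of nc \<gamma>)"
  by (rule just_infinite_closure[OF nc_normal[OF assms(1)]]) (use nc_self[OF assms(1)] assms(2) in auto)

text \<open>The abelianization of the closure \<open>U\<close> of the normal closure of \<open>\<gamma>\<close> is generated by the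
  conjugates of \<open>\<gamma>\<close>, and these are constant on the cosets of the image in \<open>G/U\<close> of the centralizer
  of \<open>\<gamma>\<close>. So a large rank forces this image to be small.\<close>

lemma centralizer_bound:
  assumes \<gamma>: "\<gamma> \<in> \<Gamma>" "\<gamma> \<in> W" "\<gamma> \<noteq> \<one>" and W: "open_normal W" "W \<subseteq> V"
    and F: "finite F" "F \<subseteq> \<Gamma>" "\<And>f. f \<in> F \<Longrightarrow> f \<otimes> \<gamma> = \<gamma> \<otimes> f"
    and distinct: "\<And>f g. f \<in> F \<Longrightarrow> g \<in> F \<Longrightarrow> f \<noteq> g \<Longrightarrow> f \<otimes> inv g \<notin> W"
  shows "c * real (card F) \<le> 1"
proof -
  define N where "N = nc \<gamma>"
  define U where "U = T closure_of N"
  interpret W: normal W G by (rule open_normal_normal[OF W(1)])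
  have U: "open_normal U" unfolding U_def N_def by (rule open_normal_nc[OF \<gamma>(1,3)])
  interpret U: normal U G by (rule open_normal_normal[OF U])
  have NW: "N \<subseteq> W" unfolding N_def nc_def
    by (rule generate_subgroup_incl[OF _ W.subgroup_axioms]) (use \<gamma>(2) W.inv_op_closed2 in auto)
  have NU: "N \<subseteq> U"
    unfolding U_def by (rule closure_of_subset) (use NW W.subset in auto)
  have UW: "U \<subseteq> W"
    unfolding U_def using closure_of_mono[OF NW, of T] open_normal_closed[OF W(1)] by simp
  have \<gamma>c: "\<gamma> \<in> carrier G" using \<gamma> by simp
  have \<gamma>U: "\<gamma> \<in> U" using nc_self[OF \<gamma>(1)] NU by (auto simp: N_def)
  define K where "K = closed_commutator G T U"
  interpret K: normal K G unfolding K_def by (rule closed_commutator_normal[OF U.normal_axioms])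
  have KU: "K \<subseteq> U" unfolding K_def by (rule closed_commutator_subset[OF U])
  define C where "C = {g \<in> \<Gamma>. g \<otimes> \<gamma> = \<gamma> \<otimes> g}"
  have C: "subgroup C G"
  proof (rule subgroupI)
    show "C \<subseteq> carrier G" unfolding C_def using \<Gamma>.subset by blast
    have "\<one> \<in> C" unfolding C_def using \<gamma>c by simp
    then show "C \<noteq> {}" by blast
    show "inv g \<in> C" if "g \<in> C" for g
    proof -
      have g: "g \<in> \<Gamma>" "g \<otimes> \<gamma> = \<gamma> \<otimes> g" using that by (auto simp: C_def)
      then have "inv g \<otimes> (g \<otimes> \<gamma>) \<otimes> inv g = inv g \<otimes> (\<gamma> \<otimes> g) \<otimes> inv g" by simp
      then have "\<gamma> \<otimes> inv g = inv g \<otimes> \<gamma>" using g(1) \<gamma>c by (simp add: m_assoc)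
      then show ?thesis using g(1) by (simp add: C_def)
    qed
    show "g \<otimes> h \<in> C" if "g \<in> C" "h \<in> C" for g h
    proof -
      have g: "g \<in> \<Gamma>" "g \<otimes> \<gamma> = \<gamma> \<otimes> g" and h: "h \<in> \<Gamma>" "h \<otimes> \<gamma> = \<gamma> \<otimes> h" using that by (auto simp: C_def)
      have "g \<otimes> h \<otimes> \<gamma> = g \<otimes> \<gamma> \<otimes> h" using g(1) h \<gamma>c by (simp add: m_assoc)
      also have "\<dots> = \<gamma> \<otimes> (g \<otimes> h)" using g h(1) \<gamma>c by (simp add: m_assoc)
      finally show ?thesis using g(1) h(1) by (simp add: C_def)
    qed
  qed
  interpret C: subgroup C G by (rule C)
  let ?Q = "G Mod U" and ?\<pi> = "\<lambda>g. U #> g"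
  interpret Q: group ?Q by (rule U.factorgroup_is_group)
  interpret \<pi>: group_hom G ?Q ?\<pi>
    using U.r_coset_hom_Mod by (simp add: group_hom_def group_hom_axioms_def Q.is_group)
  have carr: "carrier ?Q = rcosets U" by (simp add: FactGroup_def)
  have finQ: "finite (carrier ?Q)" using finite_index[OF U] carr by simp
  define D where "D = ?\<pi> ` C"
  have D: "subgroup D ?Q" unfolding D_def by (rule \<pi>.subgroup_img_is_subgroup[OF C])
  have lag: "card (rcosets\<^bsub>?Q\<^esub> D) * card D = card (rcosets U)"
    using Q.lagrange[OF D] carr by (simp add: order_def)
  \<comment> \<open>By density every coset of \<open>D\<close> is represented by an element of
    \<open>\<Gamma>\<close>; one conjugate of \<open>\<gamma>\<close> per coset goes into
    \<open>Y\<close>.\<close>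
  have "\<exists>g\<in>\<Gamma>. ?\<pi> g \<in> E" if E: "E \<in> rcosets\<^bsub>?Q\<^esub> D" for E
  proof -
    obtain q where q: "q \<in> carrier ?Q" "E = D #>\<^bsub>?Q\<^esub> q" using E by (auto simp: RCOSETS_def)
    then obtain h where h: "h \<in> carrier G" "q = ?\<pi> h" by (auto simp: carrier_FactGroup)
    obtain g where g: "g \<in> \<Gamma>" "g \<otimes> inv h \<in> U" by (rule dense_approximation[OF h(1) U])
    then have "?\<pi> g = q" using coset_eq_iff[OF U.normal_axioms, of g h] h by simp
    then show ?thesis using Q.rcos_self[OF q(1) D] q(2) g(1) by metis
  qed
  then obtain t where t: "\<And>E. E \<in> rcosets\<^bsub>?Q\<^esub> D \<Longrightarrow> t E \<in> \<Gamma> \<and> ?\<pi> (t E) \<in> E" by metis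
  define Y where "Y = (\<lambda>E. inv (t E) \<otimes> \<gamma> \<otimes> t E) ` (rcosets\<^bsub>?Q\<^esub> D)"
  have finD: "finite (rcosets\<^bsub>?Q\<^esub> D)"
    using finQ Q.rcosets_subset_PowG[OF D] finite_subset by blast
  have finY: "finite Y" unfolding Y_def using finD by simp
  have cardY: "card Y \<le> card (rcosets\<^bsub>?Q\<^esub> D)" unfolding Y_def by (rule card_image_le[OF finD])
  have YU: "Y \<subseteq> U"
  proof -
    have "inv (t E) \<otimes> \<gamma> \<otimes> t E \<in> U" if "E \<in> rcosets\<^bsub>?Q\<^esub> D" for E
      using t[OF that] \<gamma>U by (intro U.inv_op_closed1) auto
    then show ?thesis unfolding Y_def by blast
  qed
  have YKc: "Y \<union> K \<subseteq> carrier G" using YU KU U.subset by blast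
  interpret L: subgroup "generate G (Y \<union> K)" G by (rule generate_is_subgroup[OF YKc])
  have "g \<otimes> \<gamma> \<otimes> inv g \<in> generate G (Y \<union> K)" if g: "g \<in> \<Gamma>" for g
  proof -
    \<comment> \<open>The cosets are right cosets \<open>D q\<close>, so conjugates are taken as
      \<open>inv s \<otimes> \<gamma> \<otimes> s\<close>: for \<open>h = u k s\<close> with
      \<open>k\<close> in the centralizer, the factor \<open>k\<close> then cancels.\<close>
    define s where "s = inv g"
    have sc: "s \<in> carrier G" using g by (simp add: s_def)
    have qs: "?\<pi> s \<in> carrier ?Q" using sc by (simp add: carrier_FactGroup)
    define E where "E = D #>\<^bsub>?Q\<^esub> ?\<pi> s"
    have E: "E \<in> rcosets\<^bsub>?Q\<^esub> D" unfolding E_def RCOSETS_def using qs by blast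
    define h where "h = t E"
    have h: "h \<in> \<Gamma>" "?\<pi> h \<in> E" using t[OF E] by (auto simp: h_def)
    obtain k where k: "k \<in> C" "?\<pi> h = ?\<pi> k \<otimes>\<^bsub>?Q\<^esub> ?\<pi> s"
      using h(2) unfolding E_def D_def r_coset_def[of ?Q] by auto
    have kc: "k \<in> carrier G" using k(1) by simp
    have "?\<pi> h = ?\<pi> (k \<otimes> s)" unfolding k(2) by (rule \<pi>.hom_mult[OF kc sc, symmetric])
    then have "h \<otimes> inv (k \<otimes> s) \<in> U"
      by (rule iffD1[OF coset_eq_iff[OF U.normal_axioms \<Gamma>.mem_carrier[OF h(1)] m_closed[OF kc sc]]])
    define u where "u = h \<otimes> inv (k \<otimes> s)"
    have u: "u \<in> U" unfolding u_def by fact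
    then have uc: "u \<in> carrier G" by simp
    have hus: "h = u \<otimes> (k \<otimes> s)" unfolding u_def using h(1) kc sc by (simp add: m_assoc)
    have kk: "k \<otimes> \<gamma> = \<gamma> \<otimes> k" using k(1) by (simp add: C_def)
    \<comment> \<open>Both \<open>u\<close> and \<open>\<gamma>\<close> lie in \<open>U\<close>, so
      conjugation by \<open>u\<close> does not change \<open>\<gamma>\<close> modulo
      \<open>K\<close>.\<close>
    define e where "e = comm G (inv u) \<gamma>"
    have eK: "e \<in> K"
      unfolding e_def K_def using comm_in_derived[of "inv u" U \<gamma>] u \<gamma>U
        derived_subset_closed_commutator[OF U.normal_axioms] by auto
    then have ec: "e \<in> carrier G" by simp
    have "inv k \<otimes> \<gamma> \<otimes> k = \<gamma>" using kk kc \<gamma>c by (simp add: m_assoc flip: kk)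
    have "inv h \<otimes> \<gamma> \<otimes> h = inv (k \<otimes> s) \<otimes> (inv u \<otimes> \<gamma> \<otimes> u) \<otimes> (k \<otimes> s)"
      unfolding hus using uc kc sc \<gamma>c by (simp add: word_simps)
    also have "inv u \<otimes> \<gamma> \<otimes> u = e \<otimes> \<gamma>" unfolding e_def comm_def using uc \<gamma>c by (simp add: m_assoc)
    also have "inv (k \<otimes> s) \<otimes> (e \<otimes> \<gamma>) \<otimes> (k \<otimes> s)
        = (inv (k \<otimes> s) \<otimes> e \<otimes> (k \<otimes> s)) \<otimes> (inv s \<otimes> (inv k \<otimes> \<gamma> \<otimes> k) \<otimes> s)"
      using kc sc \<gamma>c ec by (simp add: word_simps)
    finally have y: "inv h \<otimes> \<gamma> \<otimes> h = (inv (k \<otimes> s) \<otimes> e \<otimes> (k \<otimes> s)) \<otimes> (inv s \<otimes> \<gamma> \<otimes> s)"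
      by (simp only: \<open>inv k \<otimes> \<gamma> \<otimes> k = \<gamma>\<close>)
    define w where "w = inv (k \<otimes> s) \<otimes> e \<otimes> (k \<otimes> s)"
    have w: "w \<in> K" unfolding w_def by (rule K.inv_op_closed1) (use kc sc eK in auto)
    have wc: "w \<in> carrier G" using w by simp
    have "inv w \<otimes> (inv h \<otimes> \<gamma> \<otimes> h) = inv s \<otimes> \<gamma> \<otimes> s"
      unfolding y w_def [symmetric] using wc sc \<gamma>c by simp
    moreover have "inv s \<otimes> \<gamma> \<otimes> s = g \<otimes> \<gamma> \<otimes> inv g" using g by (simp add: s_def)
    moreover have "inv h \<otimes> \<gamma> \<otimes> h \<in> generate G (Y \<union> K)"
      using E by (intro generate.incl) (auto simp: Y_def h_def)
    moreover have "w \<in> generate G (Y \<union> K)" using w by (simp add: generate.incl)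
    ultimately show ?thesis by (metis L.m_closed L.m_inv_closed)
  qed
  then have NY: "N \<subseteq> generate G (Y \<union> K)"
    unfolding N_def nc_def by (intro generate_subgroup_incl[OF _ L.subgroup_axioms]) blast
  have "c * real (card (rcosets U)) \<le> real (card Y)"
    by (rule generators_bound[OF U _ NU _ finY YU]) (use UW W NY in \<open>auto simp: U_def K_def\<close>)
  also have "\<dots> \<le> real (card (rcosets\<^bsub>?Q\<^esub> D))" using cardY by simp
  \<comment> \<open>The index of \<open>U\<close> is the index of \<open>D\<close> times the order
    of \<open>D\<close>; the index of \<open>D\<close> cancels and leaves a bound for its
    order.\<close>
  finally have "c * real (card (rcosets\<^bsub>?Q\<^esub> D) * card D) \<le> real (card (rcosets\<^bsub>?Q\<^esub> D))" using lag by simp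
  then have "real (card (rcosets\<^bsub>?Q\<^esub> D)) * (c * real (card D)) \<le> real (card (rcosets\<^bsub>?Q\<^esub> D)) * 1"
    by (simp add: mult_ac)
  moreover have "card (rcosets\<^bsub>?Q\<^esub> D) > 0"
    using finD Q.rcosetsI[OF _ Q.one_closed, of D] subgroup.subset[OF D] by (metis card_gt_0_iff empty_iff)
  ultimately have cD: "c * real (card D) \<le> 1" by simp
  have "card F \<le> card D"
  proof (rule card_inj_on_le)
    show "inj_on ?\<pi> F"
    proof (rule inj_onI)
      fix f g assume fg: "f \<in> F" "g \<in> F" "?\<pi> f = ?\<pi> g"
      then have "f \<otimes> inv g \<in> U" using coset_eq_iff[OF U.normal_axioms, of f g] subsetD[OF F(2)] by simp
      then show "f = g" using distinct[OF fg(1,2)] UW by blast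
    qed
    show "?\<pi> ` F \<subseteq> D" unfolding D_def C_def using F(2,3) by blast
    show "finite D" using finQ subgroup.subset[OF D] finite_subset by blast
  qed
  then have "c * real (card F) \<le> c * real (card D)" using c by simp
  then show ?thesis using cD by linarith
qed

end

context group
begin

text \<open>All elements of a coset of \<open>W\<close> have the same image modulo \<open>W\<close>,
  so an exponent found for \<open>x\<close> serves the whole coset.\<close>

lemma pow_in_normal_iff:
  assumes W: "W \<lhd> G" and z: "z \<in> W" and x: "x \<in> carrier G"
  shows "(z \<otimes> x) [^] (i::nat) \<in> W \<longleftrightarrow> x [^] i \<in> W"
proof -
  interpret W: normal W G by (rule W)
  define t where "t = tpow G x z i"
  have t: "t \<in> W" unfolding t_def by (rule tpow_in_normal[OF W x z])
  have eq: "(z \<otimes> x) [^] i = t \<otimes> x [^] i"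
    unfolding t_def by (rule mult_pow_eq_tpow) (use x z in auto)
  have "x [^] i = inv t \<otimes> (t \<otimes> x [^] i)" using t x by simp
  then show ?thesis unfolding eq using t by (metis W.m_closed W.m_inv_closed)
qed

end

section \<open>Openness of derived subgroups, and torsion cosets\<close>

context positive_gradient
begin

text \<open>If \<open>\<Gamma> \<inter> U\<close> were abelian, a nontrivial element of a small
  \<open>W\<close> would commute with more than \<open>1/c\<close> elements that are distinct modulo
  \<open>W\<close>, against \<open>centralizer_bound\<close>.\<close>

lemma derived_nontrivial:
  assumes U: "open_normal U"
  shows "derived G (\<Gamma> \<inter> U) \<noteq> {\<one>}"
proof
  assume triv: "derived G (\<Gamma> \<inter> U) = {\<one>}"
  have com: "a \<otimes> b = b \<otimes> a" if a: "a \<in> \<Gamma> \<inter> U" and b: "b \<in> \<Gamma> \<inter> U" for a b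
  proof -
    have cc: "a \<in> carrier G" "b \<in> carrier G" using a b by auto
    have "comm G a b = \<one>" using comm_in_derived[OF a b] triv by blast
    then have "b = a \<otimes> b \<otimes> inv a" using comm_mult[OF cc] cc by simp
    then have "b \<otimes> a = a \<otimes> b \<otimes> inv a \<otimes> a" by simp
    then show ?thesis using cc by (simp add: m_assoc)
  qed
  obtain B :: nat where B: "1 < real B * c" using ex_less_of_nat_mult[OF c] by blast
  obtain F where F: "finite F" "card F = B" "F \<subseteq> \<Gamma> \<inter> U"
    using infinite_arbitrarily_large[OF infinite_inter[OF U]] by blast
  have Fc: "F \<subseteq> carrier G" using F(3) \<Gamma>.subset by blast
  obtain W where W: "open_normal W" "W \<subseteq> V \<inter> U" "\<forall>f\<in>F. \<forall>g\<in>F. f \<noteq> g \<longrightarrow> f \<otimes> inv g \<notin> W"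
    using separating_subgroup[OF open_normal_Int[OF V U] F(1) Fc] by (elim exE conjE)
  have "\<not> \<Gamma> \<inter> W \<subseteq> {\<one>}" using infinite_inter[OF W(1)] finite_subset by blast
  then obtain \<gamma> where \<gamma>: "\<gamma> \<in> \<Gamma>" "\<gamma> \<in> W" "\<gamma> \<noteq> \<one>" by blast
  have "c * real (card F) \<le> 1"
  proof (rule centralizer_bound[OF \<gamma> W(1) _ F(1)])
    show "W \<subseteq> V" using W(2) by simp
    show "F \<subseteq> \<Gamma>" using F(3) by simp
    show "f \<otimes> \<gamma> = \<gamma> \<otimes> f" if "f \<in> F" for f using com[of f \<gamma>] that F(3) \<gamma> W(2) by blast
    show "f \<otimes> inv g \<notin> W" if "f \<in> F" "g \<in> F" "f \<noteq> g" for f g using W(3) that by simp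
  qed
  then show False using B F(2) by (simp add: mult.commute)
qed

text \<open>The derived subgroup of \<open>\<Gamma> \<inter> U\<close> is nontrivial and normal in
  \<open>\<Gamma>\<close>, so already its closure is open. This keeps the closed derived series
  among the subgroups to which \<open>gradient\<close> applies.\<close>

lemma open_normal_closed_commutator:
  assumes U: "open_normal U"
  shows "open_normal (closed_commutator G T U)"
proof -
  interpret U: normal U G by (rule open_normal_normal[OF U])
  let ?D = "\<Gamma> \<inter> U" and ?G = "G\<lparr>carrier := \<Gamma>\<rparr>"
  interpret G': group ?G by (rule subgroup_imp_group[OF \<Gamma>])
  have "U \<inter> \<Gamma> \<lhd> ?G" by (rule normal_Int_subgroup[OF \<Gamma> U.normal_axioms])
  then have "derived ?G ?D \<lhd> ?G" by (intro G'.derived_is_normal) (simp add: Int_commute)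
  then have "derived G ?D \<lhd> ?G" by (simp add: derived_consistent[OF _ \<Gamma>])
  then have "open_normal (T closure_of derived G ?D)"
    by (rule just_infinite_closure[OF _ derived_nontrivial[OF U]])
  moreover have "T closure_of derived G ?D \<subseteq> closed_commutator G T U"
    unfolding closed_commutator_def by (rule closure_of_mono, rule mono_derived) simp
  ultimately show ?thesis
    using open_normal_supergroup closed_commutator_normal[OF U.normal_axioms] by blast
qed

lemma pow_trivial:
  assumes y: "y \<in> \<Gamma>" and W: "open_normal W" "W \<subseteq> V"
    and m: "y [^] (m::nat) \<in> W" "\<And>i. 0 < i \<Longrightarrow> i < m \<Longrightarrow> y [^] i \<notin> W"
    and big: "1 < c * real m"
  shows "y [^] m = \<one>"
proof (rule ccontr)
  assume ne: "y [^] m \<noteq> \<one>"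
  interpret W: normal W G by (rule open_normal_normal[OF W(1)])
  have yc: "y \<in> carrier G" using y by simp
  have pow\<Gamma>: "y [^] i \<in> \<Gamma>" for i :: nat by (induction i) (use y in auto)
  have diff: "y [^] j \<otimes> inv (y [^] i) = y [^] (j - i)" if "i \<le> j" for i j :: nat
  proof -
    have "y [^] j = y [^] (j - i) \<otimes> y [^] i" using yc that by (simp add: nat_pow_mult)
    then show ?thesis using yc by (simp add: m_assoc)
  qed
  have ndiff: "y [^] i \<otimes> inv (y [^] j) \<notin> W" if ij: "i < m" "j < m" "i \<noteq> j" for i j
  proof (cases "j < i")
    case True
    then show ?thesis using diff[of j i] m(2)[of "i - j"] ij by simp
  next
    case False
    then have "y [^] j \<otimes> inv (y [^] i) \<notin> W" using diff[of i j] m(2)[of "j - i"] ij by simp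
    moreover have "inv (y [^] i \<otimes> inv (y [^] j)) = y [^] j \<otimes> inv (y [^] i)"
      using yc by (simp add: inv_mult_group)
    ultimately show ?thesis using W.m_inv_closed by metis
  qed
  let ?F = "(\<lambda>i. y [^] i) ` {..<m}"
  have "inj_on (\<lambda>i. y [^] i) {..<m}"
  proof (rule inj_onI)
    fix i j assume ij: "i \<in> {..<m}" "j \<in> {..<m}" "y [^] i = y [^] j"
    then have "y [^] i \<otimes> inv (y [^] j) = \<one>" using yc by simp
    then show "i = j" using ndiff[of i j] ij W.one_closed by force
  qed
  then have card: "card ?F = m" by (simp add: card_image)
  have "c * real (card ?F) \<le> 1"
  proof (rule centralizer_bound[OF pow\<Gamma> m(1) ne W])
    show "finite ?F" by simp
    show "?F \<subseteq> \<Gamma>" using pow\<Gamma> by blast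
    show "f \<otimes> y [^] m = y [^] m \<otimes> f" if "f \<in> ?F" for f
      using that yc by (auto simp: nat_pow_mult add.commute)
    show "f \<otimes> inv g \<notin> W" if "f \<in> ?F" "g \<in> ?F" "f \<noteq> g" for f g
      using that ndiff by auto
  qed
  then show False using card big by simp
qed

text \<open>The law is demanded on \<open>\<Gamma>\<close> only, where
  \<open>centralizer_bound\<close> can prove it; density transfers it to the finite quotients of
  \<open>G\<close>.\<close>

definition torsion_coset :: "nat \<Rightarrow> 'a \<Rightarrow> 'a set \<Rightarrow> bool" where
  "torsion_coset m x W \<longleftrightarrow> 0 < m \<and> x \<in> \<Gamma> \<and> open_normal W \<and> W \<subseteq> V \<and>
     (\<forall>z\<in>\<Gamma> \<inter> W. (z \<otimes> x) [^] m = \<one>)"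

text \<open>Dichotomy at some \<open>B > 1/c\<close>. If an \<open>x\<close> has no trivial power
  with exponent up to \<open>B\<close>, a small \<open>W\<close> gives it order above
  \<open>B\<close> modulo \<open>W\<close>, and \<open>pow_trivial\<close> applies to its whole
  coset. Otherwise all orders in \<open>\<Gamma>\<close> are at most \<open>B\<close> and divide
  \<open>fact B\<close>.\<close>

lemma torsion_coset_exists: "\<exists>m x W. torsion_coset m x W"
proof -
  obtain B :: nat where B: "1 < real B * c" using ex_less_of_nat_mult[OF c] by blast
  show ?thesis
  proof (cases "\<exists>x\<in>\<Gamma>. \<forall>r\<in>{1..B}. x [^] r \<noteq> \<one>")
    case True
    then obtain x where x: "x \<in> \<Gamma>" "\<forall>r\<in>{1..B}. x [^] r \<noteq> \<one>" by blast
    have xc: "x \<in> carrier G" using x by simp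
    let ?F = "(\<lambda>r. x [^] r) ` {1..B}"
    have "finite ?F" "?F \<subseteq> carrier G" "\<one> \<notin> ?F" using x xc by force+
    then obtain W where W: "open_normal W" "W \<subseteq> V" "W \<inter> ?F = {}"
      using open_normal_avoiding[OF V] by metis
    interpret W: normal W G by (rule open_normal_normal[OF W(1)])
    let ?Q = "G Mod W"
    interpret Q: group ?Q by (rule W.factorgroup_is_group)
    interpret \<pi>: group_hom G ?Q "\<lambda>g. W #> g"
      using W.r_coset_hom_Mod by (simp add: group_hom_def group_hom_axioms_def Q.is_group)
    define M where "M m \<longleftrightarrow> 0 < m \<and> x [^] m \<in> W" for m :: nat
    have "M (order ?Q)"
    proof -
      have fin: "finite (carrier ?Q)" using finite_index[OF W(1)] by (simp add: FactGroup_def)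
      have "W #> x \<in> carrier ?Q" using xc by (simp add: carrier_FactGroup)
      then have "(W #> x) [^]\<^bsub>?Q\<^esub> order ?Q = W" using Q.pow_order_eq_1 fin by simp
      then have "W #> (x [^] order ?Q) = W" using \<pi>.hom_nat_pow[OF xc] by simp
      then have "x [^] order ?Q \<in> W" using xc by (metis W.subgroup_axioms nat_pow_closed rcos_self)
      then show ?thesis unfolding M_def using Q.order_gt_0_iff_finite fin by simp
    qed
    then have Mm: "M (LEAST m. M m)" by (rule LeastI)
    define m where "m = (LEAST m. M m)"
    have m: "0 < m" "x [^] m \<in> W" using Mm unfolding M_def m_def by auto
    have least: "x [^] i \<notin> W" if "0 < i" "i < m" for i
      using not_less_Least[of i M] that unfolding m_def M_def by blast
    have "B < m"
    proof (rule ccontr)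
      assume "\<not> B < m"
      then have "x [^] m \<in> ?F" using m(1) by auto
      then show False using W(3) m(2) by blast
    qed
    then have "real B * c \<le> real m * c" using c by (intro mult_right_mono) auto
    then have big: "1 < c * real m" using B by (simp add: mult.commute)
    have "(z \<otimes> x) [^] m = \<one>" if z: "z \<in> \<Gamma> \<inter> W" for z
    proof (rule pow_trivial[OF _ W(1,2) _ _ big])
      have zW: "z \<in> W" using z by simp
      note iff = pow_in_normal_iff[OF W.normal_axioms zW xc]
      show "z \<otimes> x \<in> \<Gamma>" using z x by simp
      show "(z \<otimes> x) [^] m \<in> W" using iff m(2) by simp
      show "(z \<otimes> x) [^] i \<notin> W" if "0 < i" "i < m" for i using iff least[OF that] by simp
    qed
    then have "torsion_coset m x W" unfolding torsion_coset_def using m(1) x(1) W(1,2) by simp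
    then show ?thesis by blast
  next
    case False
    have "(z \<otimes> \<one>) [^] (fact B :: nat) = \<one>" if z: "z \<in> \<Gamma> \<inter> V" for z
    proof -
      have zc: "z \<in> carrier G" using z by simp
      obtain r where r: "r \<in> {1..B}" "z [^] r = \<one>" using False z by blast
      have "r dvd (fact B :: nat)" using r(1) by (intro dvd_fact) auto
      then obtain k where "(fact B :: nat) = r * k" by blast
      then have "z [^] (fact B :: nat) = (z [^] r) [^] k" using zc by (simp add: nat_pow_pow)
      then show ?thesis using r(2) zc by simp
    qed
    then have "torsion_coset (fact B) \<one> V" unfolding torsion_coset_def using V by simp
    then show ?thesis by blast
  qed
qed

text \<open>For the least possible exponent, every proper power can be made nontrivial by moving the
  base point inside the coset.\<close>

lemma minimal_torsion_coset:
  obtains m x W where "torsion_coset m x W" "\<And>r. 0 < r \<Longrightarrow> r < m \<Longrightarrow> x [^] r \<noteq> \<one>"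
proof -
  define A where "A m \<longleftrightarrow> (\<exists>x W. torsion_coset m x W)" for m
  obtain m0 where "A m0" using torsion_coset_exists unfolding A_def by blast
  then have Am: "A (LEAST m. A m)" by (rule LeastI)
  define m where "m = (LEAST m. A m)"
  have least: "\<not> A k" if "k < m" for k using not_less_Least[of k A] that unfolding m_def by blast
  \<comment> \<open>The condition \<open>x^r \<notin> W\<close> is stronger than
    \<open>x^r \<noteq> \<one>\<close> and survives the induction: it does not change when the base
    point moves inside its coset, and it persists when \<open>W\<close> shrinks.\<close>
  have "\<exists>x W. torsion_coset m x W \<and> (\<forall>r. 0 < r \<and> r < k \<longrightarrow> x [^] r \<notin> W)" if "k \<le> m" for k
    using that
  proof (induction k)
    case 0 then show ?case using Am unfolding A_def m_def by auto
  next
    case (Suc k)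
    then obtain x W where xW: "torsion_coset m x W" and nW: "\<And>r. 0 < r \<Longrightarrow> r < k \<Longrightarrow> x [^] r \<notin> W" by auto
    show ?case
    proof (cases "k = 0")
      case True then show ?thesis using xW by (intro exI[of _ x] exI[of _ W]) auto
    next
      case False
      have x: "x \<in> \<Gamma>" and W: "open_normal W" "W \<subseteq> V" and pow: "\<And>z. z \<in> \<Gamma> \<inter> W \<Longrightarrow> (z \<otimes> x) [^] m = \<one>"
        and m: "0 < m"
        using xW unfolding torsion_coset_def by auto
      interpret W: normal W G by (rule open_normal_normal[OF W(1)])
      \<comment> \<open>Minimality of \<open>m\<close> denies the law with exponent
        \<open>k\<close>, and the failure supplies a base point \<open>y\<close> in the same coset
        with nontrivial \<open>y^k\<close>.\<close>
      have "\<not> torsion_coset k x W" using least[of k] Suc.prems unfolding A_def by auto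
      then obtain z where z: "z \<in> \<Gamma> \<inter> W" "(z \<otimes> x) [^] k \<noteq> \<one>"
        using x W False unfolding torsion_coset_def by auto
      define y where "y = z \<otimes> x"
      have y: "y \<in> \<Gamma>" using z x by (simp add: y_def)
      have F: "finite {y [^] k}" "{y [^] k} \<subseteq> carrier G" "\<one> \<notin> {y [^] k}" using y z(2) by (auto simp: y_def)
      obtain W' where W': "open_normal W'" "W' \<subseteq> W" "W' \<inter> {y [^] k} = {}"
        using open_normal_avoiding[OF W(1) F] by blast
      have "(w \<otimes> y) [^] m = \<one>" if w: "w \<in> \<Gamma> \<inter> W'" for w
      proof -
        have "w \<otimes> z \<in> \<Gamma> \<inter> W" using w z W'(2) by auto
        moreover have "w \<otimes> y = w \<otimes> z \<otimes> x" using w z x by (simp add: y_def m_assoc)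
        ultimately show ?thesis using pow by simp
      qed
      then have "torsion_coset m y W'" unfolding torsion_coset_def using m y W' W by auto
      moreover have "y [^] r \<notin> W'" if r: "0 < r" "r < Suc k" for r
      proof (cases "r = k")
        case True then show ?thesis using W'(3) by blast
      next
        case False
        then have "x [^] r \<notin> W" using nW r by simp
        then have "y [^] r \<notin> W"
          unfolding y_def using pow_in_normal_iff[OF W.normal_axioms, of z x r] z x by simp
        then show ?thesis using W'(2) by blast
      qed
      ultimately show ?thesis by blast
    qed
  qed
  then obtain x W where xW: "torsion_coset m x W" "\<forall>r. 0 < r \<and> r < m \<longrightarrow> x [^] r \<notin> W" by blast
  have "x [^] r \<noteq> \<one>" if "0 < r" "r < m" for r
  proof -
    have "subgroup W G"
      using xW(1) unfolding torsion_coset_def open_normal_subgroup_def by (simp add: normal.axioms(1))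
    then show ?thesis using xW(2) that subgroup.one_closed by metis
  qed
  then show ?thesis using that xW(1) by blast
qed

text \<open>A subgroup of finite index in the finitely generated group \<open>\<Gamma>\<close> is
  finitely generated, and each of its generators involves finitely many conjugates. The number of
  conjugates is thus settled in \<open>\<Gamma>\<close>, independently of the later choice of
  \<open>U0\<close>.\<close>

lemma normal_closure_generators:
  assumes y: "y \<in> \<Gamma>" "y \<noteq> \<one>"
  shows "\<exists>gs. finite gs \<and> gs \<subseteq> \<Gamma> \<and> nc y \<subseteq> generate G ((\<lambda>g. g \<otimes> y \<otimes> inv g) ` gs)"
proof -
  let ?G = "G\<lparr>carrier := \<Gamma>\<rparr>"
  interpret G': group ?G by (rule subgroup_imp_group[OF \<Gamma>])
  have "nc y \<noteq> {\<one>}" using nc_self[OF y(1)] y(2) by blast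
  then have fin: "finite (rcosets\<^bsub>?G\<^esub> nc y)"
    using ji nc_normal[OF y(1)] by (simp add: just_infinite_def)
  have sub: "subgroup (nc y) ?G" by (rule normal.axioms(1)[OF nc_normal[OF y(1)]])
  have "generate ?G S = carrier ?G" using generate_consistent[OF S(2) \<Gamma>] S(3) by simp
  then obtain E where E: "finite E" "E \<subseteq> nc y" "generate ?G E = nc y"
    using G'.schreier_generators[OF S(1) _ _ sub fin] S(2) by auto
  have EG: "generate G E = nc y"
    using generate_consistent[OF subset_trans[OF E(2) nc_subset[OF y(1)]] \<Gamma>] E(3) by simp
  let ?f = "\<lambda>g. g \<otimes> y \<otimes> inv g"
  have "\<exists>B. finite B \<and> B \<subseteq> ?f ` \<Gamma> \<and> e \<in> generate G B" if "e \<in> E" for e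
    using generate_finite_support[of e "?f ` \<Gamma>"] that E(2) unfolding nc_def by blast
  then obtain B where B: "\<And>e. e \<in> E \<Longrightarrow> finite (B e) \<and> B e \<subseteq> ?f ` \<Gamma> \<and> e \<in> generate G (B e)" by metis
  have "finite (\<Union>e\<in>E. B e)" "(\<Union>e\<in>E. B e) \<subseteq> ?f ` \<Gamma>" using B E(1) by blast+
  from finite_subset_image[OF this]
  obtain gs where gs: "gs \<subseteq> \<Gamma>" "finite gs" "(\<Union>e\<in>E. B e) = ?f ` gs" by (elim exE conjE)
  have sc: "?f ` gs \<subseteq> carrier G" using gs(1) y by auto
  have "E \<subseteq> generate G (?f ` gs)"
  proof
    fix e assume e: "e \<in> E"
    have "B e \<subseteq> ?f ` gs" using gs(3) e by blast
    then show "e \<in> generate G (?f ` gs)" using B[OF e] mono_generate by blast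
  qed
  then have "generate G E \<subseteq> generate G (?f ` gs)"
    by (rule generate_subgroup_incl[OF _ generate_is_subgroup[OF sc]])
  then show ?thesis using gs(1,2) EG by (intro exI[of _ gs]) simp
qed

end

section \<open>Passage to a finite quotient\<close>

context normal
begin

lemma coset_hom: "group_hom G (G Mod H) (\<lambda>g. H #> g)"
  using r_coset_hom_Mod factorgroup_is_group by (simp add: group_hom_def group_hom_axioms_def)

lemma coset_image_iff:
  assumes U: "subgroup U G" "H \<subseteq> U" and g: "g \<in> carrier G"
  shows "H #> g \<in> (\<lambda>u. H #> u) ` U \<longleftrightarrow> g \<in> U"
proof
  assume "H #> g \<in> (\<lambda>u. H #> u) ` U"
  then obtain u where u: "u \<in> U" "H #> g = H #> u" by blast
  then have "g \<in> H #> u" using rcos_self[OF g subgroup_axioms] by simp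
  then show "g \<in> U" using U u(1) by (auto simp: r_coset_def subgroup.m_closed)
qed simp

lemma image_r_coset:
  assumes U: "U \<subseteq> carrier G" and g: "g \<in> carrier G"
  shows "(\<lambda>u. H #> u) ` (U #> g) = ((\<lambda>u. H #> u) ` U) #>\<^bsub>G Mod H\<^esub> (H #> g)"
proof -
  interpret \<pi>: group_hom G "G Mod H" "\<lambda>g. H #> g" by (rule coset_hom)
  have "(\<lambda>u. H #> u) ` (U #> g) = (\<lambda>u. H #> (u \<otimes> g)) ` U" by (auto simp: r_coset_def [of G U])
  also have "\<dots> = (\<lambda>u. (H #> u) \<otimes>\<^bsub>G Mod H\<^esub> (H #> g)) ` U"
    by (rule image_cong[OF refl]) (rule \<pi>.hom_mult, use U g in auto)
  also have "\<dots> = ((\<lambda>u. H #> u) ` U) #>\<^bsub>G Mod H\<^esub> (H #> g)" by (auto simp: r_coset_def [of "G Mod H"])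
  finally show ?thesis .
qed

lemma card_rcosets_image:
  assumes U: "subgroup U G" "H \<subseteq> U"
  shows "card (rcosets\<^bsub>G Mod H\<^esub> ((\<lambda>u. H #> u) ` U)) = card (rcosets U)"
proof -
  let ?\<pi> = "\<lambda>u. H #> u"
  interpret U: subgroup U G by fact
  have "rcosets\<^bsub>G Mod H\<^esub> (?\<pi> ` U) = (\<lambda>D. ?\<pi> ` D) ` (rcosets U)"
  proof -
    have "rcosets\<^bsub>G Mod H\<^esub> (?\<pi> ` U) = (\<lambda>g. (?\<pi> ` U) #>\<^bsub>G Mod H\<^esub> ?\<pi> g) ` carrier G"
      unfolding RCOSETS_def carrier_FactGroup by auto
    also have "\<dots> = (\<lambda>g. ?\<pi> ` (U #> g)) ` carrier G"
      by (rule image_cong[OF refl]) (rule image_r_coset[OF U.subset, symmetric])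
    also have "\<dots> = (\<lambda>D. ?\<pi> ` D) ` (rcosets U)" unfolding RCOSETS_def by auto
    finally show ?thesis .
  qed
  moreover have "inj_on (\<lambda>D. ?\<pi> ` D) (rcosets U)"
  proof (rule inj_onI)
    fix D E assume "D \<in> rcosets U" "E \<in> rcosets U" and eq: "?\<pi> ` D = ?\<pi> ` E"
    then obtain g h where g: "g \<in> carrier G" "D = U #> g" and h: "h \<in> carrier G" "E = U #> h"
      by (auto simp: RCOSETS_def)
    have "g \<in> D" unfolding g(2) by (rule rcos_self[OF g(1) U(1)])
    then have "?\<pi> g \<in> ?\<pi> ` E" unfolding eq [symmetric] by (rule imageI)
    then obtain u where u: "u \<in> U" "?\<pi> g = ?\<pi> (u \<otimes> h)" by (auto simp: h(2) r_coset_def [of G U])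
    then have "g \<in> H #> (u \<otimes> h)" using rcos_self[OF g(1) subgroup_axioms] by simp
    then obtain k where k: "k \<in> H" "g = k \<otimes> (u \<otimes> h)" by (auto simp: r_coset_def)
    have "g = (k \<otimes> u) \<otimes> h" using k u(1) h(1) by (simp add: m_assoc)
    moreover have "k \<otimes> u \<in> U" using k(1) U(2) u(1) by auto
    ultimately have "g \<in> U #> h" by (auto simp: r_coset_def)
    then show "D = E" using repr_independence[OF _ h(1) U(1)] g(2) h(2) by simp
  qed
  ultimately show ?thesis by (simp add: card_image)
qed

text \<open>The kernel \<open>H\<close> lies in \<open>U'\<close>, so membership in the generated
  group can be tested in the quotient; generators of the image lift without a change in
  number.\<close>

lemma lift_generators:
  assumes U: "subgroup U G" and U': "subgroup U' G" "U' \<subseteq> U" "H \<subseteq> U'"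
    and Z: "finite Z" "Z \<subseteq> (\<lambda>u. H #> u) ` U"
    and gen: "(\<lambda>u. H #> u) ` U \<subseteq> generate (G Mod H) (Z \<union> (\<lambda>u. H #> u) ` U')"
  shows "\<exists>Y. finite Y \<and> Y \<subseteq> U \<and> card Y = card Z \<and> U \<subseteq> generate G (Y \<union> U')"
proof -
  let ?\<pi> = "\<lambda>u. H #> u"
  interpret \<pi>: group_hom G "G Mod H" ?\<pi> by (rule coset_hom)
  obtain Y where Y: "Y \<subseteq> U" "inj_on ?\<pi> Y" "Z = ?\<pi> ` Y" using Z(2) subset_image_inj by metis
  have finY: "finite Y" using Y(2,3) Z(1) finite_imageD by blast
  have cardY: "card Y = card Z" unfolding Y(3) by (rule card_image[OF Y(2), symmetric])
  have YU: "Y \<union> U' \<subseteq> carrier G" using Y(1) U'(2) subgroup.subset[OF U] by blast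
  have L: "subgroup (generate G (Y \<union> U')) G" by (rule generate_is_subgroup[OF YU])
  have HL: "H \<subseteq> generate G (Y \<union> U')" using U'(3) by (auto intro: generate.incl)
  have "U \<subseteq> generate G (Y \<union> U')"
  proof
    fix u assume u: "u \<in> U"
    then have uc: "u \<in> carrier G" using subgroup.subset[OF U] by blast
    have "?\<pi> u \<in> generate (G Mod H) (?\<pi> ` (Y \<union> U'))" using gen u unfolding Y(3) image_Un by blast
    then have "?\<pi> u \<in> ?\<pi> ` generate G (Y \<union> U')" using \<pi>.generate_img[OF YU] by simp
    then show "u \<in> generate G (Y \<union> U')" using coset_image_iff[OF L HL uc] by simp
  qed
  then show ?thesis using Y(1) finY cardY by blast
qed

end

section \<open>The order of the choices and the final count\<close>

context positive_gradient
begin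

lemma contradiction: False
proof -
  obtain m x W where tors: "torsion_coset m x W" and xr: "\<And>r. 0 < r \<Longrightarrow> r < m \<Longrightarrow> x [^] r \<noteq> \<one>"
    using minimal_torsion_coset by metis
  have m0: "0 < m" and x: "x \<in> \<Gamma>" and W: "open_normal W" "W \<subseteq> V"
    and pow: "\<And>z. z \<in> \<Gamma> \<Longrightarrow> z \<in> W \<Longrightarrow> (z \<otimes> x) [^] m = \<one>"
    using tors unfolding torsion_coset_def by auto
  have xc: "x \<in> carrier G" using x by simp
  \<comment> \<open>Exponent 1 would make \<open>\<Gamma> \<inter> W\<close> a single
    element.\<close>
  have m1: "1 < m"
  proof (rule ccontr)
    assume "\<not> 1 < m"
    then have "m = Suc 0" using m0 by simp
    interpret W: normal W G by (rule open_normal_normal[OF W(1)])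
    have "z \<otimes> x = \<one>" if "z \<in> \<Gamma> \<inter> W" for z
      using pow[of z] that x unfolding \<open>m = Suc 0\<close> by simp
    then have "inv x = z" if "z \<in> \<Gamma> \<inter> W" for z using that xc by (intro inv_equality) auto
    then have "\<Gamma> \<inter> W \<subseteq> {inv x}" by blast
    then show False using infinite_inter[OF W(1)] finite_subset by blast
  qed
  have pow\<Gamma>: "x [^] r \<in> \<Gamma>" for r :: nat by (induction r) (use x in auto)
  define I where "I = {r. 0 < r \<and> r < m}"
  have finI: "finite I" unfolding I_def by simp
  have "\<forall>r\<in>I. \<exists>gs. finite gs \<and> gs \<subseteq> \<Gamma> \<and> nc (x [^] r) \<subseteq> generate G ((\<lambda>g. g \<otimes> x [^] r \<otimes> inv g) ` gs)"
    using normal_closure_generators[OF pow\<Gamma> xr] by (simp add: I_def)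
  from bchoice[OF this] obtain gs where gs: "\<forall>r\<in>I. finite (gs r) \<and> gs r \<subseteq> \<Gamma> \<and>
      nc (x [^] r) \<subseteq> generate G ((\<lambda>g. g \<otimes> x [^] r \<otimes> inv g) ` gs r)" ..
  \<comment> \<open>One bound for all exponents \<open>r\<close>. It is fixed here, as are
    \<open>d\<close> and \<open>K\<close>, before \<open>U0\<close> is chosen.\<close>
  define l where "l = (\<Sum>r\<in>I. card (gs r))"
  have l: "card (gs r) \<le> l" if "r \<in> I" for r
    unfolding l_def using member_le_sum[of r I "\<lambda>r. card (gs r)"] that finI by simp
  define d where "d = card S"
  obtain K :: nat where K: "\<And>a b s y. K \<le> a \<Longrightarrow> c * real a \<le> real y \<Longrightarrow> 2 ^ y * a \<le> b \<Longrightarrow>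
     c * real b \<le> real (d * a)^2 + real l * real s \<Longrightarrow>
     \<not> c * 2 ^ s \<le> real (d * b)^2 * (real (d * b) + 1) ^ (m - 1)"
    using rank_inequalities_contradictory[OF c, of d l "m - 1"] by blast
  \<comment> \<open>Inside such an \<open>A\<close> the conjugates in \<open>gs r\<close> do their
    work for all \<open>r\<close> at once: in a finite quotient by an open normal subgroup they
    generate a group containing the image of \<open>A\<close>.\<close>
  have "\<exists>A. open_normal A \<and> A \<subseteq> W \<and> (\<forall>r\<in>J. A \<subseteq> T closure_of nc (x [^] r))" if "finite J" "J \<subseteq> I" for J
    using that
  proof (induction J rule: finite_induct)
    case empty then show ?case using W(1) by blast
  next
    case (insert r J)
    then obtain A where A: "open_normal A" "A \<subseteq> W" "\<forall>r\<in>J. A \<subseteq> T closure_of nc (x [^] r)" by auto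
    have "open_normal (T closure_of nc (x [^] r))"
      by (rule open_normal_nc[OF pow\<Gamma> xr]) (use insert.prems in \<open>auto simp: I_def\<close>)
    then have "open_normal (A \<inter> T closure_of nc (x [^] r))" by (rule open_normal_Int[OF A(1)])
    moreover have "A \<inter> T closure_of nc (x [^] r) \<subseteq> W" using A(2) by blast
    moreover have "\<forall>s\<in>insert r J. A \<inter> T closure_of nc (x [^] r) \<subseteq> T closure_of nc (x [^] s)" using A(3) by blast
    ultimately show ?case by (intro exI conjI)
  qed
  from this[OF finI order_refl] obtain A
    where A: "open_normal A" "A \<subseteq> W" "\<forall>r\<in>I. A \<subseteq> T closure_of nc (x [^] r)" by (elim exE conjE)
  \<comment> \<open>\<open>K\<close> elements of \<open>\<Gamma>\<close> that remain distinct modulo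
    \<open>U0\<close> push the index of \<open>U0\<close> up to \<open>K\<close>.\<close>
  obtain F where F: "finite F" "card F = K" "F \<subseteq> \<Gamma>" using infinite_arbitrarily_large[OF infinite_\<Gamma>] by blast
  have Fc: "F \<subseteq> carrier G" using F(3) \<Gamma>.subset by blast
  from separating_subgroup[OF A(1) F(1) Fc]
  obtain U0 where U0: "open_normal U0" "U0 \<subseteq> A" "\<forall>f\<in>F. \<forall>g\<in>F. f \<noteq> g \<longrightarrow> f \<otimes> inv g \<notin> U0" by (elim exE conjE)
  interpret U0: normal U0 G by (rule open_normal_normal[OF U0(1)])
  have KU0: "K \<le> card (rcosets U0)"
  proof -
    have "inj_on (\<lambda>f. U0 #> f) F"
    proof (rule inj_onI)
      fix f g assume fg: "f \<in> F" "g \<in> F" "U0 #> f = U0 #> g"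
      then have "f \<otimes> inv g \<in> U0" using coset_eq_iff[OF U0.normal_axioms, of f g] subsetD[OF Fc] by simp
      then show "f = g" using U0(3) fg(1,2) by metis
    qed
    moreover have "(\<lambda>f. U0 #> f) ` F \<subseteq> rcosets U0" unfolding RCOSETS_def using Fc by blast
    ultimately show ?thesis using card_inj_on_le finite_index[OF U0(1)] F(2) by metis
  qed
  define U1 where "U1 = closed_commutator G T U0"
  have U1: "open_normal U1" unfolding U1_def by (rule open_normal_closed_commutator[OF U0(1)])
  interpret U1: normal U1 G by (rule open_normal_normal[OF U1])
  define U2 where "U2 = closed_commutator G T U1"
  have U2: "open_normal U2" unfolding U2_def by (rule open_normal_closed_commutator[OF U1])
  interpret U2: normal U2 G by (rule open_normal_normal[OF U2])
  define U3 where "U3 = closed_commutator G T U2"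
  have U3: "open_normal U3" unfolding U3_def by (rule open_normal_closed_commutator[OF U2])
  interpret U3: normal U3 G by (rule open_normal_normal[OF U3])
  have U10: "U1 \<subseteq> U0" unfolding U1_def by (rule closed_commutator_subset[OF U0(1)])
  have U21: "U2 \<subseteq> U1" unfolding U2_def by (rule closed_commutator_subset[OF U1])
  have U32: "U3 \<subseteq> U2" unfolding U3_def by (rule closed_commutator_subset[OF U2])
  have U0V: "U0 \<subseteq> V" using U0(2) A(2) W(2) by blast
  let ?H = "G Mod U3" and ?\<pi> = "\<lambda>g. U3 #> g"
  interpret H: group ?H by (rule U3.factorgroup_is_group)
  interpret \<pi>: group_hom G ?H ?\<pi> by (rule U3.coset_hom)
  have surj: "?\<pi> ` carrier G = carrier ?H" by (rule carrier_FactGroup[symmetric])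
  \<comment> \<open>Modulo the open subgroup \<open>U3\<close> a set and its closure have the same
    image. So closed commutators become derived subgroups, and \<open>\<Gamma>\<close> maps onto the
    quotient.\<close>
  have closure_image: "?\<pi> ` (T closure_of Z) = ?\<pi> ` Z" if Z: "Z \<subseteq> carrier G" for Z
  proof
    show "?\<pi> ` (T closure_of Z) \<subseteq> ?\<pi> ` Z"
    proof
      fix D assume "D \<in> ?\<pi> ` (T closure_of Z)"
      then obtain g where g: "g \<in> T closure_of Z" "D = ?\<pi> g" by blast
      then have gc: "g \<in> carrier G" using closure_carrier by blast
      obtain a where a: "a \<in> Z" "a \<otimes> inv g \<in> U3" using g(1) closure_iff[OF Z gc] U3 by blast
      then have "?\<pi> a = ?\<pi> g" using coset_eq_iff[OF U3.normal_axioms, of a g] gc Z by auto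
      then show "D \<in> ?\<pi> ` Z" using a(1) g(2) by (metis imageI)
    qed
    show "?\<pi> ` Z \<subseteq> ?\<pi> ` (T closure_of Z)"
      by (rule image_mono, rule closure_of_subset) (use Z in simp)
  qed
  have derived_image: "?\<pi> ` closed_commutator G T U = derived ?H (?\<pi> ` U)" if "U \<lhd> G" for U
  proof -
    have Uc: "U \<subseteq> carrier G" using subgroup.subset[OF normal.axioms(1)[OF that]] .
    have "derived G U \<subseteq> carrier G" by (rule derived_in_carrier[OF Uc])
    then show ?thesis unfolding closed_commutator_def using closure_image \<pi>.derived_img[OF Uc] by simp
  qed
  have finH: "finite (carrier ?H)" using finite_index[OF U3] by (simp add: FactGroup_def)
  have U3_image: "?\<pi> ` U3 = {\<one>\<^bsub>?H\<^esub>}"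
  proof -
    have "?\<pi> u = U3" if "u \<in> U3" for u using coset_join2[OF _ U3.subgroup_axioms that] that by simp
    then have "?\<pi> ` U3 \<subseteq> {U3}" by blast
    moreover have "?\<pi> ` U3 \<noteq> {}" using U3.one_closed by blast
    ultimately show ?thesis by (metis one_FactGroup subset_singletonD)
  qed
  interpret D: derived_tower ?H "?\<pi> ` U0" "?\<pi> ` U1" "?\<pi> ` U2" "?\<pi> x"
  proof (intro derived_tower.intro derived_tower_axioms.intro)
    show "group ?H" by (rule U3.factorgroup_is_group)
    show "finite (carrier ?H)" by (rule finH)
    show "?\<pi> ` U0 \<lhd> ?H" by (rule U0.surj_hom_normal_subgroup[OF \<pi>.group_hom_axioms surj])
    show "?\<pi> ` U1 = derived ?H (?\<pi> ` U0)" unfolding U1_def by (rule derived_image[OF U0.normal_axioms])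
    show "?\<pi> ` U2 = derived ?H (?\<pi> ` U1)" unfolding U2_def by (rule derived_image[OF U1.normal_axioms])
    show "derived ?H (?\<pi> ` U2) = {\<one>\<^bsub>?H\<^esub>}"
      unfolding derived_image[OF U2.normal_axioms, symmetric] U3_def [symmetric] by (rule U3_image)
    show "?\<pi> x \<in> carrier ?H" by (rule \<pi>.hom_closed[OF xc])
  qed
  have rank: "c * real (card (rcosets U)) \<le> real (card Z)"
    if U: "open_normal U" "U \<subseteq> V" and U': "U3 \<subseteq> closed_commutator G T U"
      and Z: "finite Z" "Z \<subseteq> ?\<pi> ` U"
      and gen: "?\<pi> ` U \<subseteq> generate ?H (Z \<union> ?\<pi> ` closed_commutator G T U)" for U Z
  proof -
    interpret U: normal U G by (rule open_normal_normal[OF U(1)])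
    have nK: "closed_commutator G T U \<lhd> G" by (rule closed_commutator_normal[OF U.normal_axioms])
    obtain Y where Y: "finite Y" "Y \<subseteq> U" "card Y = card Z" "U \<subseteq> generate G (Y \<union> closed_commutator G T U)"
      using U3.lift_generators[OF U.subgroup_axioms normal.axioms(1)[OF nK] closed_commutator_subset[OF U(1)] U' Z gen]
      by (elim exE conjE)
    have "U \<subseteq> T closure_of U" using open_normal_closed[OF U(1)] by simp
    then show ?thesis using generators_bound[OF U order_refl _ Y(1,2,4)] Y(3) by simp
  qed
  define a where "a = card (rcosets U0)"
  define b where "b = card (rcosets U1)"
  note index = U3.card_rcosets_image
  have idx: "card (rcosets\<^bsub>?H\<^esub> (?\<pi> ` U0)) = a" "card (rcosets\<^bsub>?H\<^esub> (?\<pi> ` U1)) = b"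
    "card (rcosets\<^bsub>?H\<^esub> (?\<pi> ` U2)) = card (rcosets U2)"
    unfolding a_def b_def using U32 U21 U10
    by (intro index U0.subgroup_axioms U1.subgroup_axioms U2.subgroup_axioms; blast)+
  have U1V: "U1 \<subseteq> V" using U10 U0V by (rule subset_trans)
  have U2V: "U2 \<subseteq> V" using U21 U1V by (rule subset_trans)
  have finU0: "finite (?\<pi> ` U0)" using finite_subset[OF subgroup.subset[OF D.U0.subgroup_axioms] finH] .
  \<comment> \<open>\<open>card Z\<close> is at least \<open>c a\<close> by the rank hypothesis,
    while doubling bounds \<open>2 ^ card Z\<close> by the index of \<open>U1\<close> in
    \<open>U0\<close>: hence the exponential growth from \<open>a\<close> to
    \<open>b\<close>.\<close>
  obtain Z where Z: "finite Z" "Z \<subseteq> ?\<pi> ` U0" "?\<pi> ` U0 = generate ?H (Z \<union> ?\<pi> ` U1)"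
      "2 ^ card Z * card (?\<pi> ` U1) \<le> card (?\<pi> ` U0)"
    using H.small_generating_set_over[OF D.U1.subgroup_axioms D.U0.subgroup_axioms D.U1_subset finU0]
    by (elim exE conjE)
  have y0: "c * real a \<le> real (card Z)"
    unfolding a_def
    by (rule rank[OF U0(1) U0V _ Z(1,2)]) (use U32 U21 equalityD1[OF Z(3)] in \<open>auto simp: U1_def\<close>)
  have y1: "2 ^ card Z * a \<le> b"
  proof -
    have l1: "a * card (?\<pi> ` U0) = order ?H" using H.lagrange[OF D.U0.subgroup_axioms] idx by simp
    have l2: "b * card (?\<pi> ` U1) = order ?H" using H.lagrange[OF D.U1.subgroup_axioms] idx by simp
    have "2 ^ card Z * a * card (?\<pi> ` U1) = a * (2 ^ card Z * card (?\<pi> ` U1))"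
      by (simp only: mult_ac)
    also have "\<dots> \<le> a * card (?\<pi> ` U0)" by (rule mult_le_mono2[OF Z(4)])
    also have "\<dots> = b * card (?\<pi> ` U1)" using l1 l2 by (rule trans_sym)
    finally have "2 ^ card Z * a * card (?\<pi> ` U1) \<le> b * card (?\<pi> ` U1)" .
    moreover have "card (?\<pi> ` U1) \<noteq> 0"
      using finite_subset[OF D.U1_subset finU0] D.U1.one_closed by (metis card_0_eq empty_iff)
    ultimately show ?thesis by simp
  qed
  have "\<exists>s. c * real b \<le> real (d * a)^2 + real l * real s \<and>
    c * 2 ^ s \<le> real (d * b)^2 * (real (d * b) + 1) ^ (m - 1)"
    unfolding idx [symmetric]
  proof (rule D.rank_inequalities)
    show "finite (?\<pi> ` S)" using S(1) by simp
    have Sc: "S \<subseteq> carrier G" using S(2) \<Gamma>.subset by (rule subset_trans)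
    show "?\<pi> ` S \<subseteq> carrier ?H" unfolding surj [symmetric] using Sc by (rule image_mono)
    have "?\<pi> ` carrier G = ?\<pi> ` \<Gamma>" using closure_image[OF \<Gamma>.subset] dense by simp
    then show "generate ?H (?\<pi> ` S) = carrier ?H"
      unfolding \<pi>.generate_img[OF Sc] S(3) surj [symmetric] by (rule sym)
    show "card (?\<pi> ` S) \<le> d" unfolding d_def by (rule card_image_le[OF S(1)])
    show "1 < m" by (rule m1)
    show "(z \<otimes>\<^bsub>?H\<^esub> ?\<pi> x) [^]\<^bsub>?H\<^esub> m = \<one>\<^bsub>?H\<^esub>" if z: "z \<in> ?\<pi> ` U0" for z
    proof -
      obtain u where u: "u \<in> U0" "z = ?\<pi> u" using z by blast
      have uc: "u \<in> carrier G" using u(1) by simp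
      \<comment> \<open>The law is known on \<open>\<Gamma>\<close> only, so \<open>u\<close> is
        replaced by a congruent element of \<open>\<Gamma>\<close>, which stays in \<open>U0\<close>
        because \<open>U3\<close> is contained in it.\<close>
      obtain \<gamma> where \<gamma>: "\<gamma> \<in> \<Gamma>" "\<gamma> \<otimes> inv u \<in> U3" by (rule dense_approximation[OF uc U3])
      have \<gamma>c: "\<gamma> \<in> carrier G" using \<gamma>(1) by simp
      have "\<gamma> \<otimes> inv u \<in> U0" using \<gamma>(2) U32 U21 U10 by blast
      then have "(\<gamma> \<otimes> inv u) \<otimes> u \<in> U0" using u(1) by (rule U0.m_closed)
      then have "\<gamma> \<in> U0" using \<gamma>c uc by (simp add: m_assoc)
      then have "(\<gamma> \<otimes> x) [^] m = \<one>" using pow[OF \<gamma>(1)] U0(2) A(2) by blast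
      moreover have "?\<pi> \<gamma> = z" unfolding u(2) using coset_eq_iff[OF U3.normal_axioms \<gamma>c uc] \<gamma>(2) by simp
      ultimately show ?thesis
        using \<pi>.hom_nat_pow[of "\<gamma> \<otimes> x" m] \<pi>.hom_mult[OF \<gamma>c xc] \<pi>.hom_one \<gamma>c xc by (metis m_closed)
    qed
    show "\<exists>gs. finite gs \<and> gs \<subseteq> carrier ?H \<and> card gs \<le> l \<and>
        ?\<pi> ` U0 \<subseteq> generate ?H ((\<lambda>g. g \<otimes>\<^bsub>?H\<^esub> ?\<pi> x [^]\<^bsub>?H\<^esub> r \<otimes>\<^bsub>?H\<^esub> inv\<^bsub>?H\<^esub> g) ` gs)"
      if r: "0 < r" "r < m" for r
    proof (intro exI conjI)
      have rI: "r \<in> I" using r by (simp add: I_def)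
      have g: "finite (gs r)" "gs r \<subseteq> \<Gamma>" "nc (x [^] r) \<subseteq> generate G ((\<lambda>g. g \<otimes> x [^] r \<otimes> inv g) ` gs r)"
        using gs rI by auto
      have gc: "gs r \<subseteq> carrier G" using g(2) \<Gamma>.subset by (rule subset_trans)
      show "finite (?\<pi> ` gs r)" using g(1) by simp
      show "?\<pi> ` gs r \<subseteq> carrier ?H" unfolding surj [symmetric] using gc by (rule image_mono)
      show "card (?\<pi> ` gs r) \<le> l" using card_image_le[OF g(1)] l[OF rI] by (rule le_trans)
      let ?A = "(\<lambda>g. g \<otimes> x [^] r \<otimes> inv g) ` gs r"
      have Ac: "?A \<subseteq> carrier G" using gc xc by auto
      have ncc: "nc (x [^] r) \<subseteq> carrier G" using nc_subset[OF pow\<Gamma>] \<Gamma>.subset by (rule subset_trans)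
      have "U0 \<subseteq> T closure_of nc (x [^] r)" using U0(2) A(3) rI by blast
      then have "?\<pi> ` U0 \<subseteq> ?\<pi> ` (T closure_of nc (x [^] r))" by (rule image_mono)
      also have "\<dots> = ?\<pi> ` nc (x [^] r)" by (rule closure_image[OF ncc])
      also have "\<dots> \<subseteq> ?\<pi> ` generate G ?A" by (rule image_mono[OF g(3)])
      also have "\<dots> = generate ?H (?\<pi> ` ?A)" by (rule \<pi>.generate_img[OF Ac, symmetric])
      also have "?\<pi> ` ?A = (\<lambda>g. g \<otimes>\<^bsub>?H\<^esub> ?\<pi> x [^]\<^bsub>?H\<^esub> r \<otimes>\<^bsub>?H\<^esub> inv\<^bsub>?H\<^esub> g) ` (?\<pi> ` gs r)"
        unfolding image_image
      proof (rule image_cong[OF refl])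
        fix g assume "g \<in> gs r"
        then have gG: "g \<in> carrier G" using gc by blast
        have "?\<pi> (g \<otimes> x [^] r \<otimes> inv g) = ?\<pi> g \<otimes>\<^bsub>?H\<^esub> ?\<pi> (x [^] r) \<otimes>\<^bsub>?H\<^esub> ?\<pi> (inv g)"
          using \<pi>.hom_mult[of "g \<otimes> x [^] r" "inv g"] \<pi>.hom_mult[of g "x [^] r"] gG xc by simp
        then show "?\<pi> (g \<otimes> x [^] r \<otimes> inv g) = ?\<pi> g \<otimes>\<^bsub>?H\<^esub> ?\<pi> x [^]\<^bsub>?H\<^esub> r \<otimes>\<^bsub>?H\<^esub> inv\<^bsub>?H\<^esub> (?\<pi> g)"
          using \<pi>.hom_nat_pow[OF xc, of r] \<pi>.hom_inv[OF gG] by (simp only:)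
      qed
      finally show "?\<pi> ` U0 \<subseteq> generate ?H ((\<lambda>g. g \<otimes>\<^bsub>?H\<^esub> ?\<pi> x [^]\<^bsub>?H\<^esub> r \<otimes>\<^bsub>?H\<^esub> inv\<^bsub>?H\<^esub> g) ` (?\<pi> ` gs r))" .
    qed
    show "c * real (card (rcosets\<^bsub>?H\<^esub> (?\<pi> ` U1))) \<le> real (card Z)"
      if Z: "finite Z" "Z \<subseteq> ?\<pi> ` U1" "?\<pi> ` U1 = generate ?H (Z \<union> ?\<pi> ` U2)" for Z
      unfolding idx b_def
      by (rule rank[OF U1 U1V _ Z(1,2)]) (use U32 Z(3) in \<open>simp_all add: U2_def [symmetric]\<close>)
    show "c * real (card (rcosets\<^bsub>?H\<^esub> (?\<pi> ` U2))) \<le> real (card Z)"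
      if Z: "finite Z" "Z \<subseteq> ?\<pi> ` U2" "?\<pi> ` U2 = generate ?H Z" for Z
      unfolding idx
    proof (rule rank[OF U2 U2V _ Z(1,2)])
      show "U3 \<subseteq> closed_commutator G T U2" by (simp add: U3_def)
      show "?\<pi> ` U2 \<subseteq> generate ?H (Z \<union> ?\<pi> ` closed_commutator G T U2)"
        unfolding Z(3) by (rule H.mono_generate) blast
    qed
  qed
  then obtain s where "c * real b \<le> real (d * a)^2 + real l * real s"
    "c * 2 ^ s \<le> real (d * b)^2 * (real (d * b) + 1) ^ (m - 1)"
    by (elim exE conjE)
  then show False using K[OF _ y0 y1] KU0 unfolding a_def by blast
qed

end

theorem theorem1p3:
  fixes G :: "('a, 'b) monoid_scheme" and T :: "'a topology" and \<Gamma> :: "'a set"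
  assumes "profinite_group G T"
    and "subgroup \<Gamma> G"
    and "\<exists>S. finite S \<and> S \<subseteq> \<Gamma> \<and> generate G S = \<Gamma>"
    and "T closure_of \<Gamma> = carrier G"
    and "just_infinite (G\<lparr>carrier := \<Gamma>\<rparr>)"
  shows "normal_homology_rank_gradient G T = 0"
proof -
  interpret profinite G T
    using assms(1) by (simp add: profinite_def profinite_axioms_def profinite_group_def)
  define f where "f U = ereal (real (top_rank (H1_group G T U) (H1_top G T U)) / real (card (rcosets\<^bsub>G\<^esub> U)))" for U
  define g where "g V = (INF U \<in> {U. open_normal U \<and> U \<subseteq> V}. f U)" for V
  have f0: "0 \<le> f U" for U by (simp add: f_def)
  have g0: "0 \<le> g V" for V unfolding g_def by (rule INF_greatest) (rule f0)
  have "g V \<le> 0" if V: "open_normal V" for V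
  proof (rule ccontr)
    assume "\<not> g V \<le> 0"
    then have "0 < g V" by simp
    \<comment> \<open>Any real number strictly between 0 and the infimum over the subgroups of
      \<open>V\<close> serves as the constant.\<close>
    then obtain c where c: "0 < ereal c" "ereal c < g V" using ereal_dense2 by blast
    obtain S where S: "finite S" "S \<subseteq> \<Gamma>" "generate G S = \<Gamma>" using assms(3) by blast
    interpret positive_gradient G T \<Gamma> S V c
    proof (intro positive_gradient.intro positive_gradient_axioms.intro)
      show "profinite G T" by (rule profinite_axioms)
      show "c * real (card (rcosets\<^bsub>G\<^esub> U)) \<le> real (top_rank (H1_group G T U) (H1_top G T U))"
        if U: "open_normal U" "U \<subseteq> V" for U
      proof -
        have "g V \<le> f U" unfolding g_def by (rule INF_lower) (use U in simp)
        then have "ereal c < f U" using c(2) by simp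
        then have lt: "c < real (top_rank (H1_group G T U) (H1_top G T U)) / real (card (rcosets\<^bsub>G\<^esub> U))"
          by (simp add: f_def)
        interpret U: normal U G by (rule open_normal_normal[OF U(1)])
        have "rcosets\<^bsub>G\<^esub> U \<noteq> {}" using U.subgroup_in_rcosets[OF is_group] by blast
        then have "0 < real (card (rcosets\<^bsub>G\<^esub> U))" using finite_index[OF U(1)] by (simp add: card_gt_0_iff)
        then show ?thesis using lt by (simp add: field_simps)
      qed
    qed (use assms S V c in simp_all)
    show False by (rule contradiction)
  qed
  then have "g V = 0" if "open_normal V" for V using g0[of V] that by (simp add: antisym)
  then have "(SUP V \<in> {V. open_normal V}. g V) = (SUP V \<in> {V. open_normal V}. 0)" by (intro SUP_cong) auto
  \<comment> \<open>The whole group makes the index set nonempty; over an empty set the supremum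
    would be minus infinity.\<close>
  also have "\<dots> = 0" using open_normal_carrier by (subst SUP_const) auto
  finally show ?thesis unfolding normal_homology_rank_gradient_def g_def f_def .
qed

end
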